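(* There is a smallest integer $d_0\ge5$ such that $$\mu:=\mu(d)=49\Big(\frac2d+\Big(1-\frac2d\Big)q(d-2)\Big)<1\quad\text{for all }d\ge d_0 .$$ For $d\ge d_0$, setting $c_0=8d\,\big(\log\frac1\mu\big)^{-1}>0$, one has: (i) there is $u_0=u_0(d)>0$ such that $\lim_{N\to\infty}P[\mathcal U_{c_0,uN^d}]=1$ for all $0<u\le u_0$; (ii) $\lim_{u\to0}\liminf_{N\to\infty}P[\mathcal C_{c_0,0,uN^d}]=1$.
   Context: $[\cdot]$ denotes integer part. For $\nu\ge1$, $q(\nu)$ is the probability that simple random walk on $\mathbb Z^\nu$ started at the origin returns to the origin at some time $n\ge1$. For $N\ge1$, $E=(\mathbb Z/N\mathbb Z)^d$, $\pi_E:\mathbb Z^d\to E$ is the canonical projection, $e_1,\dots,e_d$ the canonical basis; $|\cdot|$ and $|\cdot|_\infty$ denote the Euclidean and $\ell^\infty$ distances (on $\mathbb Z^d$ or the induced ones on $E$). $x,y$ are neighbors if $|x-y|=1$; connectedness and nearest neighbor paths refer to this relation. $S(x,r)=\{y\in E:|y-x|_\infty=r\}$. $P$ is the law of simple random walk $(X_n)_{n\ge0}$ on $E$ (uniform nearest neighbor steps $\pm e_i$) started from the uniform distribution; $X_{[0,t]}=\{X_n:0\le n\le t\}$. $\mathcal L_2$ is the collection of sets $F=\pi_E(y+\mathbb Ze_i+\mathbb Ze_j)$ with $y\in\mathbb Z^d$, $1\le i<j\le d$. For $K>0$, $t\ge0$, $x\in E$: - $\mathcal U_{K,t}$ is the event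 that for any $F\in\mathcal L_2$ and any connected subsets $O_1,O_2$ of $F\setminus X_{[0,t]}$ with $|\cdot|_\infty$-diameter at least $[K\log N]$, $O_1$ and $O_2$ are contained in the same connected component of $F\setminus X_{[0,t]}$; - $\mathcal C_{K,x,t}$ is the event that for some $F\in\mathcal L_2$ with $x\in F$ there is a nearest neighbor path in $F\setminus X_{[0,t]}$ from $x$ to $S(x,[K\log N])$. *)

theory Defs
  imports "HOL-Probability.Probability" "HOL-Library.Function_Algebras"
begin

text \<open>
  The dimension varies inside the theorem, so a point of \<open>\<int>\<^sup>d\<close> is a function
  \<open>nat \<Rightarrow> int\<close> vanishing at all indices \<open>\<ge> d\<close>; the coordinate directions are \<open>0, \<dots>, d - 1\<close>.
  Addition, subtraction and \<open>0\<close> are the pointwise ones.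
\<close>

type_synonym point = "nat \<Rightarrow> int"

definition lattice :: "nat \<Rightarrow> point set" where
  "lattice d = {x. \<forall>i\<ge>d. x i = 0}"

definition basis_vec :: "nat \<Rightarrow> point" where
  "basis_vec i = (\<lambda>k. if k = i then 1 else 0)"

definition l2_dist :: "nat \<Rightarrow> point \<Rightarrow> point \<Rightarrow> real" where
  "l2_dist d x y = sqrt (\<Sum>i<d. (real_of_int (x i - y i))\<^sup>2)"

text \<open>Only meaningful for \<open>d \<ge> 1\<close>, as the maximum runs over the coordinates.\<close>

definition linf_dist :: "nat \<Rightarrow> point \<Rightarrow> point \<Rightarrow> nat" where
  "linf_dist d x y = Max ((\<lambda>i. nat \<bar>x i - y i\<bar>) ` {..<d})"

text \<open>
  For \<open>N \<ge> 1\<close>, a class in \<open>(\<int>/N\<int>)\<^sup>d\<close> is represented by its member with all coordinates in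
  \<open>{0, \<dots>, N - 1}\<close>, and the canonical projection takes residues coordinatewise.
\<close>

definition proj :: "nat \<Rightarrow> point \<Rightarrow> point" where
  "proj N x = (\<lambda>i. x i mod int N)"

definition torus :: "nat \<Rightarrow> nat \<Rightarrow> point set" where
  "torus d N = proj N ` lattice d"

definition induced_dist ::
  "nat \<Rightarrow> nat \<Rightarrow> (point \<Rightarrow> point \<Rightarrow> 'b::Inf) \<Rightarrow> point \<Rightarrow> point \<Rightarrow> 'b" where
  "induced_dist d N \<delta> x y =
     Inf {\<delta> a b | a b. a \<in> lattice d \<and> b \<in> lattice d \<and> proj N a = x \<and> proj N b = y}"

abbreviation torus_l2 :: "nat \<Rightarrow> nat \<Rightarrow> point \<Rightarrow> point \<Rightarrow> real" where
  "torus_l2 d N \<equiv> induced_dist d N (l2_dist d)"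

abbreviation torus_linf :: "nat \<Rightarrow> nat \<Rightarrow> point \<Rightarrow> point \<Rightarrow> nat" where
  "torus_linf d N \<equiv> induced_dist d N (linf_dist d)"

definition neighbors :: "nat \<Rightarrow> nat \<Rightarrow> point \<Rightarrow> point \<Rightarrow> bool" where
  "neighbors d N x y \<longleftrightarrow> x \<in> torus d N \<and> y \<in> torus d N \<and> torus_l2 d N x y = 1"

definition sphere_inf :: "nat \<Rightarrow> nat \<Rightarrow> point \<Rightarrow> nat \<Rightarrow> point set" where
  "sphere_inf d N x r = {y \<in> torus d N. torus_linf d N y x = r}"

text \<open>\<open>Sup\<close> on \<open>nat\<close> is the maximum for the finite sets of distances occurring here.\<close>

definition diam_inf :: "nat \<Rightarrow> nat \<Rightarrow> point set \<Rightarrow> nat" where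
  "diam_inf d N A = Sup {torus_linf d N x y | x y. x \<in> A \<and> y \<in> A}"

definition planes :: "nat \<Rightarrow> nat \<Rightarrow> point set set" where
  "planes d N =
     {proj N ` {(\<lambda>k. y k + a * basis_vec i k + b * basis_vec j k) | a b :: int. True} | y i j.
        y \<in> lattice d \<and> i < j \<and> j < d}"

definition joined_in :: "nat \<Rightarrow> nat \<Rightarrow> point set \<Rightarrow> point \<Rightarrow> point \<Rightarrow> bool" where
  "joined_in d N A x y \<longleftrightarrow> (\<exists>p. p \<noteq> [] \<and> hd p = x \<and> last p = y \<and> set p \<subseteq> A
                               \<and> successively (neighbors d N) p)"

definition nn_connected :: "nat \<Rightarrow> nat \<Rightarrow> point set \<Rightarrow> bool" where
  "nn_connected d N A \<longleftrightarrow> A \<noteq> {} \<and> (\<forall>x\<in>A. \<forall>y\<in>A. joined_in d N A x y)"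

definition nn_components :: "nat \<Rightarrow> nat \<Rightarrow> point set \<Rightarrow> point set set" where
  "nn_components d N A = {{y. joined_in d N A x y} | x. x \<in> A}"

definition unit_steps :: "nat \<Rightarrow> point set" where
  "unit_steps d = (\<Union>i<d. {basis_vec i, - basis_vec i})"

definition step_law :: "nat \<Rightarrow> (nat \<Rightarrow> point) measure" where
  "step_law d = (\<Pi>\<^sub>M k\<in>UNIV. measure_pmf (pmf_of_set (unit_steps d)))"

definition return_prob :: "nat \<Rightarrow> real" where
  "return_prob \<nu> = \<P>(\<xi> in step_law \<nu>. \<exists>n\<ge>1. (\<Sum>k<n. \<xi> k) = 0)"

text \<open>
  The walk on the torus is realised on the product of a uniform starting point and an independent
  i.i.d. sequence of uniform steps.
\<close>

definition walk_space :: "nat \<Rightarrow> nat \<Rightarrow> (point \<times> (nat \<Rightarrow> point)) measure" where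
  "walk_space d N = measure_pmf (pmf_of_set (torus d N)) \<Otimes>\<^sub>M step_law d"

definition walk :: "nat \<Rightarrow> nat \<Rightarrow> point \<times> (nat \<Rightarrow> point) \<Rightarrow> point" where
  "walk N n \<omega> = proj N (fst \<omega> + (\<Sum>k<n. snd \<omega> k))"

definition visited :: "nat \<Rightarrow> real \<Rightarrow> point \<times> (nat \<Rightarrow> point) \<Rightarrow> point set" where
  "visited N t \<omega> = {walk N n \<omega> | n. real n \<le> t}"

definition uniqueness_event ::
  "nat \<Rightarrow> nat \<Rightarrow> real \<Rightarrow> real \<Rightarrow> (point \<times> (nat \<Rightarrow> point)) set" where
  "uniqueness_event d N K t = {\<omega> \<in> space (walk_space d N).
     \<forall>F\<in>planes d N. \<forall>O1 O2.
       O1 \<subseteq> F - visited N t \<omega> \<and> nn_connected d N O1 \<and> diam_inf d N O1 \<ge> nat \<lfloor>K * ln (real N)\<rfloor> \<and>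
       O2 \<subseteq> F - visited N t \<omega> \<and> nn_connected d N O2 \<and> diam_inf d N O2 \<ge> nat \<lfloor>K * ln (real N)\<rfloor>
       \<longrightarrow> (\<exists>C\<in>nn_components d N (F - visited N t \<omega>). O1 \<subseteq> C \<and> O2 \<subseteq> C)}"

definition connection_event ::
  "nat \<Rightarrow> nat \<Rightarrow> real \<Rightarrow> point \<Rightarrow> real \<Rightarrow> (point \<times> (nat \<Rightarrow> point)) set" where
  "connection_event d N K x t = {\<omega> \<in> space (walk_space d N).
     \<exists>F\<in>planes d N. x \<in> F \<and>
       (\<exists>y\<in>sphere_inf d N x (nat \<lfloor>K * ln (real N)\<rfloor>). joined_in d N (F - visited N t \<omega>) x y)}"

definition mu :: "nat \<Rightarrow> real" where
  "mu d = 49 * (2 / real d + (1 - 2 / real d) * return_prob (d - 2))"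

definition c0 :: "nat \<Rightarrow> real" where
  "c0 d = 8 * real d * inverse (ln (1 / mu d))"

end

theory Submission
  imports Defs "HOL-Real_Asymp.Real_Asymp"
begin

text \<open>
  Both statements are Peierls arguments.  If a long path in the vacant set of a plane is not connected
  to another one, or if the origin is not connected to distance \<open>c\<^sub>0 log N\<close>, then by planar duality
  the visited sites of the plane contain a long self-avoiding path with diagonal steps allowed.  There
  are at most \<open>8\<^sup>n\<close> such paths of \<open>n\<close> steps from a given point, so it suffices to bound the probability that
  the walk covers a given set \<open>S\<close> of a plane by \<open>C (s e\<^bsup>C' u\<^esup>)\<^bsup>|S|\<^esup>\<close> with \<open>s = \<surd>\<mu> / 49\<close>.

  The constant \<open>\<mu> / 49\<close> is the probability that the walk on \<open>\<int>\<^sup>d\<close> returns to a plane.  Kill the walk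
  at rate \<open>M |S| / N\<^sup>d\<close>: starting in \<open>S\<close> it then returns to \<open>S\<close> with probability close to \<open>\<mu> / 49 < s\<close>,
  since after leaving the plane for good it is spread out by the heat kernel of the torus.  With \<open>h\<close> the
  killed hitting probability of \<open>S\<close>, the function \<open>1 + c h\<close> is a supersolution that gains a factor
  \<open>1 / s\<close> at each visit to \<open>S\<close> and loses only a factor \<open>1 + O(|S| / N\<^sup>d)\<close> per unit of time.

  The heat kernel is bounded by the Fourier transform on the torus, where \<open>|cos t| \<le> 1 - sin\<^sup>2 t / 2\<close>
  makes the bound a product over the coordinates; the same bound shows \<open>q(\<nu>) \<rightarrow> 0\<close> by dominated
  convergence and hence that \<open>d\<^sub>0\<close> exists.  Planar duality is a form of the Hex theorem, obtained here
  from Kuhn's combinatorial lemma, together with a parity argument for crossing paths.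
\<close>

section \<open>The averaging operator and the step law\<close>

text \<open>Why killing: on the finite torus the unkilled walk hits \<open>S\<close> almost surely,
  so its hitting probability carries no information. A rate proportional to |S| / N^d is large
  enough to suppress late returns uniformly in |S|, and small enough that running for time u N^d
  costs only a factor e^(C' u) per site of \<open>S\<close>. Why s is a square root: the strict gap
  between mu / 49 and s pays for the late returns, while eight directions per step and e^(C' u)
  \<le> 2 still leave 16 s \<le> sqrt(mu) / 2 per step. The constant c_0 turns sqrt(mu)^(c_0 log N)
  into N^(-4d), which beats the N^d base points of paths. Why crude heat kernel bounds suffice: they
  decay like t^(-1/3) instead of t^(-1/2) per coordinate, but mu < 1 forces d \<ge> 99. Connected
  sets in a plane of the torus may wind around it. Duality is therefore applied to the periodic
  pullback of the visited set to Z^2, where paths lift and open paths are compared through crossings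
  of arbitrarily large boxes.\<close>

lemma basis_vec_eq_iff [simp]: "basis_vec i = basis_vec j \<longleftrightarrow> i = j"
  by (auto simp: basis_vec_def fun_eq_iff split: if_splits)

lemma basis_vec_neq_uminus [simp]: "basis_vec i \<noteq> - basis_vec j" "- basis_vec j \<noteq> basis_vec i"
  by (auto simp: basis_vec_def fun_eq_iff intro!: exI[of _ i])

lemma basis_vec_neq_0 [simp]: "basis_vec i \<noteq> 0" "0 \<noteq> basis_vec i"
  by (auto simp: basis_vec_def fun_eq_iff intro!: exI[of _ i])

lemma finite_unit_steps [simp]: "finite (unit_steps d)"
  by (auto simp: unit_steps_def)

lemma sum_unit_steps:
  fixes f :: "point \<Rightarrow> 'a::comm_monoid_add"
  shows "(\<Sum>e\<in>unit_steps d. f e) = (\<Sum>i<d. f (basis_vec i) + f (- basis_vec i))"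
  unfolding unit_steps_def by (subst sum.UNION_disjoint) auto

lemma card_unit_steps: "card (unit_steps d) = 2 * d"
  using sum_unit_steps[of "\<lambda>_. 1::nat" d] by (simp add: mult_2)

lemma unit_steps_nonempty: "d \<ge> 1 \<Longrightarrow> unit_steps d \<noteq> {}"
  by (auto simp: unit_steps_def intro!: exI[of _ 0])

text \<open>The transition operator of the walk, over a normed field because it acts on real hitting
  probabilities and on complex characters. The torus enters only through periodic arguments.\<close>

definition avg :: "nat \<Rightarrow> (point \<Rightarrow> 'a::real_normed_field) \<Rightarrow> point \<Rightarrow> 'a" where
  "avg d f x = (\<Sum>e\<in>unit_steps d. f (x + e)) / of_nat (2 * d)"

lemma avg_alt: "avg d f x = (\<Sum>i<d. f (x + basis_vec i) + f (x - basis_vec i)) / of_nat (2 * d)"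
  by (simp add: avg_def sum_unit_steps)

lemma avg_mono:
  fixes f g :: "point \<Rightarrow> real"
  assumes "\<And>e. e \<in> unit_steps d \<Longrightarrow> f (x + e) \<le> g (x + e)"
  shows "avg d f x \<le> avg d g x"
  unfolding avg_def by (intro divide_right_mono sum_mono) (use assms in auto)

lemma avg_const: "d \<ge> 1 \<Longrightarrow> avg d (\<lambda>_. c) x = c"
  by (simp add: avg_def card_unit_steps)

lemma avg_add: "avg d (\<lambda>x. f x + g x) x = avg d f x + avg d g x"
  by (simp add: avg_def sum.distrib add_divide_distrib)

lemma avg_cmult: "avg d (\<lambda>x. c * f x) x = c * avg d f x"
  by (simp add: avg_def sum_distrib_left)

lemma avg_sum: "avg d (\<lambda>x. \<Sum>i\<in>I. f i x) x = (\<Sum>i\<in>I. avg d (f i) x)"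
  by (simp add: avg_def sum_divide_distrib) (rule sum.swap)

lemma avg_nonneg:
  fixes f :: "point \<Rightarrow> real"
  shows "(\<And>y. f y \<ge> 0) \<Longrightarrow> avg d f x \<ge> 0"
  unfolding avg_def by (intro divide_nonneg_nonneg sum_nonneg) auto

lemma avg_le:
  fixes f :: "point \<Rightarrow> real"
  assumes "\<And>y. f y \<le> c" "d \<ge> 1"
  shows "avg d f x \<le> c"
  using avg_mono[of d f x "\<lambda>_. c"] assms by (simp add: avg_const)

section \<open>The i.i.d. step sequence and hitting within finitely many steps\<close>

lemma space_step_law [simp]: "space (step_law d) = UNIV"
  by (simp add: step_law_def space_PiM)

lemma prob_space_step_law: "prob_space (step_law d)"
  unfolding step_law_def by (intro prob_space_PiM measure_pmf.prob_space_axioms)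

text \<open>Prepending an independent step preserves the product law (\<open>PiM_iter\<close>).
  Through this identity probabilities of the walk become recursions in \<open>avg\<close>.\<close>

lemma measure_step_law_first_step:
  assumes E: "E \<in> sets (step_law d)" and d: "d \<ge> 1"
  shows "measure (step_law d) E
    = (\<Sum>e\<in>unit_steps d. measure (step_law d) {\<xi>. case_nat e \<xi> \<in> E}) / (2 * real d)"
proof -
  define M where "M = measure_pmf (pmf_of_set (unit_steps d))"
  have M: "prob_space M" unfolding M_def by (rule prob_space_measure_pmf)
  interpret sequence_space M
    by (intro sequence_space.intro product_prob_spaceI M)
  have S: "step_law d = S" by (simp add: step_law_def M_def)
  define f :: "point \<times> (nat \<Rightarrow> point) \<Rightarrow> nat \<Rightarrow> point" where "f = (\<lambda>(s, \<omega>). case_nat s \<omega>)"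
  have f: "f \<in> M \<Otimes>\<^sub>M S \<rightarrow>\<^sub>M S"
    unfolding f_def by measurable
  have E': "E \<in> sets S" using E by (simp add: S)
  have sp: "space M = UNIV" "space S = UNIV" by (simp_all add: M_def space_PiM)
  have "emeasure S E = emeasure (distr (M \<Otimes>\<^sub>M S) S f) E"
    using PiM_iter by (simp add: f_def)
  also have "\<dots> = emeasure (M \<Otimes>\<^sub>M S) (f -` E \<inter> space (M \<Otimes>\<^sub>M S))"
    by (rule emeasure_distr[OF f E'])
  also have "\<dots> = (\<integral>\<^sup>+ e. emeasure S (Pair e -` (f -` E \<inter> space (M \<Otimes>\<^sub>M S))) \<partial>M)"
    by (rule emeasure_pair_measure_alt) (rule measurable_sets[OF f E'])
  also have "\<dots> = (\<integral>\<^sup>+ e. emeasure S {\<xi>. case_nat e \<xi> \<in> E} \<partial>M)"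
    by (intro nn_integral_cong arg_cong2[of _ _ _ _ emeasure] refl)
       (auto simp: f_def space_pair_measure sp)
  also have "\<dots> = (\<Sum>e\<in>unit_steps d. emeasure S {\<xi>. case_nat e \<xi> \<in> E}) / card (unit_steps d)"
    unfolding M_def by (rule nn_integral_pmf_of_set) (use d unit_steps_nonempty in auto)
  finally have *: "emeasure S E = (\<Sum>e\<in>unit_steps d. emeasure S {\<xi>. case_nat e \<xi> \<in> E}) / (2 * d)"
    by (simp add: card_unit_steps)
  have "ennreal (measure S E) = ennreal ((\<Sum>e\<in>unit_steps d. measure S {\<xi>. case_nat e \<xi> \<in> E}) / (2 * real d))"
    using * d unfolding P.emeasure_eq_measure
    by (simp add: sum_nonneg divide_ennreal[symmetric] sum_ennreal ennreal_of_nat_eq_real_of_nat ennreal_mult)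
  then show ?thesis
    unfolding S by (subst (asm) ennreal_inj) (auto intro!: sum_nonneg divide_nonneg_nonneg)
qed

lemma sum_fun_apply: "(\<Sum>k\<in>I. f k) i = (\<Sum>k\<in>I. f k i)" for f :: "'k \<Rightarrow> 'b \<Rightarrow> 'c::comm_monoid_add"
  by (induction I rule: infinite_finite_induct) auto

text \<open>
  The steps range over the uncountable type \<^typ>\<open>point\<close>, on which addition need not be measurable for
  the product of the discrete sigma-algebras; measurability has to be checked coordinatewise.
\<close>

lemma measurable_coordinate_sum:
  fixes X :: "nat \<Rightarrow> 'w \<Rightarrow> int"
  assumes "\<And>k. X k \<in> M \<rightarrow>\<^sub>M count_space UNIV"
  shows "(\<lambda>w. \<Sum>k<n. X k w) \<in> M \<rightarrow>\<^sub>M count_space UNIV"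
proof (induction n)
  case (Suc n)
  have "(\<lambda>w. (\<lambda>c w. (\<Sum>k<n. X k w) + c) (X n w) w) \<in> M \<rightarrow>\<^sub>M count_space UNIV"
    by (rule measurable_compose_countable[OF measurable_compose[OF Suc] assms]) auto
  then show ?case by simp
qed auto

lemma measurable_step_coordinate:
  "(\<lambda>\<xi>. \<xi> k i) \<in> step_law d \<rightarrow>\<^sub>M count_space UNIV" for k i :: nat
proof -
  have "(\<lambda>\<xi>. \<xi> k) \<in> step_law d \<rightarrow>\<^sub>M measure_pmf (pmf_of_set (unit_steps d))"
    unfolding step_law_def by measurable
  then show ?thesis
    by (rule measurable_compose) auto
qed

lemma pred_partial_sum:
  "Measurable.pred (step_law d) (\<lambda>\<xi>. \<forall>i::nat. G i ((\<Sum>k<n. \<xi> k) i))"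
proof (rule pred_intros_countable)
  fix i
  show "Measurable.pred (step_law d) (\<lambda>\<xi>. G i ((\<Sum>k<n. \<xi> k) i))"
    unfolding sum_fun_apply
    by (rule measurable_compose[OF measurable_coordinate_sum[OF measurable_step_coordinate]]) simp
qed

lemma pred_position_proj:
  "Measurable.pred (step_law d) (\<lambda>\<xi>. proj N (x + (\<Sum>k<n. \<xi> k)) = y)"
  using pred_partial_sum[where d = d and n = n and G = "\<lambda>i s. (x i + s) mod int N = y i"]
  by (simp add: proj_def fun_eq_iff)

lemma pred_position:
  "Measurable.pred (step_law d) (\<lambda>\<xi>. x + (\<Sum>k<n. \<xi> k) = y)"
  using pred_partial_sum[where d = d and n = n and G = "\<lambda>i s. (x i + s) = y i"]
  by (simp add: fun_eq_iff)

lemma partial_sum_case_nat: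
  "(\<Sum>k<Suc n. (case_nat e \<xi> :: nat \<Rightarrow> 'a::comm_monoid_add) k) = e + (\<Sum>k<n. \<xi> k)"
  by (subst sum.lessThan_Suc_shift) simp

text \<open>The walk survives each step with probability \<open>q\<close>; for \<open>q < 1\<close> it is killed at a geometric time.\<close>

primrec hit :: "nat \<Rightarrow> real \<Rightarrow> (point \<Rightarrow> bool) \<Rightarrow> nat \<Rightarrow> point \<Rightarrow> real" where
  "hit d q Q 0 x = of_bool (Q x)"
| "hit d q Q (Suc k) x = (if Q x then 1 else q * avg d (hit d q Q k) x)"

abbreviation hitp :: "nat \<Rightarrow> nat \<Rightarrow> point \<Rightarrow> real" where
  "hitp \<nu> \<equiv> hit \<nu> 1 (\<lambda>z. z = 0)"

lemma all_le_Suc_shift: "(\<exists>j\<le>Suc k. P j) \<longleftrightarrow> P 0 \<or> (\<exists>j\<le>k. P (Suc j))"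
  by (metis Suc_le_mono le0 not0_implies_Suc)

lemma hitp_eq_measure:
  assumes "\<nu> \<ge> 1"
  shows "hitp \<nu> k z = measure (step_law \<nu>) {\<xi>. \<exists>j\<le>k. z + (\<Sum>i<j. \<xi> i) = 0}"
proof (induction k arbitrary: z)
  case 0
  interpret prob_space "step_law \<nu>" by (rule prob_space_step_law)
  show ?case using prob_space by auto
next
  case (Suc k)
  interpret prob_space "step_law \<nu>" by (rule prob_space_step_law)
  let ?E = "{\<xi>. \<exists>j\<le>Suc k. z + (\<Sum>i<j. \<xi> i) = 0}"
  show ?case
  proof (cases "z = 0")
    case True
    then have "?E = space (step_law \<nu>)" by (auto intro!: exI[of _ 0])
    then have "prob ?E = 1" using prob_space by (simp only:)
    then show ?thesis using True by (simp only: hit.simps mult_1 if_True simp_thms)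
  next
    case False
    have "Measurable.pred (step_law \<nu>) (\<lambda>\<xi>. \<exists>j\<in>{..Suc k}. z + (\<Sum>i<j. \<xi> i) = 0)"
      by (intro pred_intros_countable_bounded pred_position countableI_type)
    then have "?E \<in> sets (step_law \<nu>)" by (simp add: pred_def Bex_def)
    note measure_step_law_first_step[OF this assms]
    moreover have "{\<xi>. case_nat e \<xi> \<in> ?E} = {\<xi>. \<exists>j\<le>k. (z + e) + (\<Sum>i<j. \<xi> i) = 0}" for e
      unfolding mem_Collect_eq all_le_Suc_shift partial_sum_case_nat using False by (simp add: add.assoc)
    ultimately show ?thesis using False
      by (simp only: avg_def[of \<nu> "hitp \<nu> k"] Suc hit.simps mult_1 if_False of_nat_mult of_nat_numeral)
  qed
qed

text \<open>Applying \<open>avg\<close> at 0 takes a step before the first test, so the left side is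
  the probability of a return at some time between 1 and k + 1.\<close>

lemma avg_hitp_le_return_prob:
  assumes "\<nu> \<ge> 1"
  shows "avg \<nu> (hitp \<nu> k) 0 \<le> return_prob \<nu>"
proof -
  interpret prob_space "step_law \<nu>" by (rule prob_space_step_law)
  let ?E = "{\<xi>. \<exists>j\<le>k. 0 + (\<Sum>i<Suc j. \<xi> i) = 0}"
  have "Measurable.pred (step_law \<nu>) (\<lambda>\<xi>. \<exists>j\<in>{..k}. 0 + (\<Sum>i<Suc j. \<xi> i) = 0)"
    by (intro pred_intros_countable_bounded pred_position countableI_type)
  then have "?E \<in> sets (step_law \<nu>)" by (simp add: pred_def Bex_def del: sum.lessThan_Suc)
  note first = measure_step_law_first_step[OF this assms]
  have "{\<xi>. case_nat e \<xi> \<in> ?E} = {\<xi>. \<exists>j\<le>k. (0 + e) + (\<Sum>i<j. \<xi> i) = 0}" for e :: point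
    unfolding mem_Collect_eq partial_sum_case_nat by simp
  then have "avg \<nu> (hitp \<nu> k) 0 = measure (step_law \<nu>) ?E"
    by (simp only: avg_def[of \<nu> "hitp \<nu> k"] hitp_eq_measure[OF assms] of_nat_mult of_nat_numeral first)
  also have "\<dots> \<le> measure (step_law \<nu>) {\<xi>. \<exists>n\<ge>1. (\<Sum>k<n. \<xi> k) = 0}"
  proof (rule finite_measure_mono)
    have "Measurable.pred (step_law \<nu>) (\<lambda>\<xi>. \<exists>n\<in>{1..}. 0 + (\<Sum>k<n. \<xi> k) = 0)"
      by (intro pred_intros_countable_bounded pred_position countableI_type)
    then show "{\<xi>. \<exists>n\<ge>1. (\<Sum>k<n. \<xi> k) = 0} \<in> events" by (simp add: pred_def Bex_def)
    show "?E \<subseteq> {\<xi>. \<exists>n\<ge>1. (\<Sum>k<n. \<xi> k) = 0}"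
    proof
      fix \<xi> assume "\<xi> \<in> ?E"
      then obtain j where "0 + (\<Sum>i<Suc j. \<xi> i) = 0" by blast
      then have "(\<Sum>i<Suc j. \<xi> i) = 0" by (simp only: add_0)
      then show "\<xi> \<in> {\<xi>. \<exists>n\<ge>1. (\<Sum>k<n. \<xi> k) = 0}" by (intro CollectI exI[of _ "Suc j"]) auto
    qed
  qed
  also have "\<dots> = return_prob \<nu>"
    by (simp add: return_prob_def)
  finally show ?thesis .
qed

lemma measure_position_eq:
  assumes "d \<ge> 1"
  shows "measure (step_law d) {\<xi>. x + (\<Sum>k<n. \<xi> k) = y} = (avg d ^^ n) (\<lambda>x. of_bool (x = y)) x"
proof (induction n arbitrary: x)
  case 0
  interpret prob_space "step_law d" by (rule prob_space_step_law)
  show ?case using prob_space by auto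
next
  case (Suc n)
  let ?E = "{\<xi>. x + (\<Sum>k<Suc n. \<xi> k) = y}"
  have "?E \<in> sets (step_law d)" using pred_position[where d = d and x = x and n = "Suc n" and y = y] by (simp add: pred_def)
  note measure_step_law_first_step[OF this assms]
  moreover have "{\<xi>. case_nat e \<xi> \<in> ?E} = {\<xi>. (x + e) + (\<Sum>k<n. \<xi> k) = y}" for e
    unfolding mem_Collect_eq partial_sum_case_nat by (simp add: add.assoc)
  ultimately show ?case
    unfolding funpow.simps o_apply avg_def[of d "(avg d ^^ n) (\<lambda>x. of_bool (x = y))"]
    by (simp only: Suc of_nat_mult of_nat_numeral)
qed

lemma return_prob_le_suminf:
  assumes "\<nu> \<ge> 1" "summable (\<lambda>n. (avg \<nu> ^^ Suc n) (\<lambda>x. of_bool (x = 0) :: real) 0)"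
  shows "return_prob \<nu> \<le> (\<Sum>n. (avg \<nu> ^^ Suc n) (\<lambda>x. of_bool (x = 0)) 0)"
proof -
  interpret prob_space "step_law \<nu>" by (rule prob_space_step_law)
  define A where "A = (\<lambda>n. {\<xi>::nat\<Rightarrow>point. 0 + (\<Sum>k<Suc n. \<xi> k) = 0})"
  have A: "A n \<in> events" for n
    using pred_position[where d = \<nu> and x = 0 and n = "Suc n" and y = 0] unfolding A_def by (simp add: pred_def)
  have mA: "measure (step_law \<nu>) (A n) = (avg \<nu> ^^ Suc n) (\<lambda>x. of_bool (x = 0)) 0" for n
    unfolding A_def by (rule measure_position_eq[OF assms(1)])
  have "return_prob \<nu> = measure (step_law \<nu>) {\<xi>. \<exists>n\<ge>1. (\<Sum>k<n. \<xi> k) = 0}"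
    by (simp add: return_prob_def)
  also have "{\<xi>::nat\<Rightarrow>point. \<exists>n\<ge>1. (\<Sum>k<n. \<xi> k) = 0} = (\<Union>n. A n)"
  proof (intro equalityI subsetI)
    fix \<xi> :: "nat \<Rightarrow> point" assume "\<xi> \<in> {\<xi>. \<exists>n\<ge>1. (\<Sum>k<n. \<xi> k) = 0}"
    then obtain n where "n \<ge> 1" "(\<Sum>k<n. \<xi> k) = 0" by blast
    then have "\<xi> \<in> A (n - 1)" by (simp add: A_def del: sum.lessThan_Suc)
    then show "\<xi> \<in> (\<Union>n. A n)" by blast
  next
    fix \<xi> :: "nat \<Rightarrow> point" assume "\<xi> \<in> (\<Union>n. A n)"
    then obtain n where "0 + (\<Sum>k<Suc n. \<xi> k) = 0" unfolding A_def by blast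
    then have "(\<Sum>k<Suc n. \<xi> k) = 0" by (simp only: add_0)
    then show "\<xi> \<in> {\<xi>. \<exists>n\<ge>1. (\<Sum>k<n. \<xi> k) = 0}" by (intro CollectI exI[of _ "Suc n"]) auto
  qed
  also have "measure (step_law \<nu>) (\<Union>n. A n) \<le> (\<Sum>n. measure (step_law \<nu>) (A n))"
    by (rule finite_measure_subadditive_countably) (use A assms(2) in \<open>auto simp only: mA image_subset_iff\<close>)
  finally show ?thesis by (simp only: mA)
qed

section \<open>Heat kernel bounds on the torus\<close>

lemma cis_eq_1_iff_dvd:
  assumes "N > 0"
  shows "cis (2 * pi * real_of_int m / real N) = 1 \<longleftrightarrow> int N dvd m"
proof -
  have "cis (2 * pi * real_of_int m / real N) = 1 \<longleftrightarrow>
      (\<exists>n::int. 2 * pi * real_of_int m / real N = of_int (2 * n) * pi)"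
    by (simp add: cis_conv_exp exp_eq_1)
  also have "\<dots> \<longleftrightarrow> (\<exists>n::int. real_of_int m = real_of_int (int N * n))"
    using assms by (intro ex_cong1) (simp add: field_simps)
  also have "\<dots> \<longleftrightarrow> int N dvd m"
    by (simp only: of_int_eq_iff dvd_def)
  finally show ?thesis .
qed

lemma sum_cis_roots:
  assumes "N > 0"
  shows "(\<Sum>j<N. cis (2 * pi * real j * real_of_int m / real N)) = (if int N dvd m then of_nat N else 0)"
proof -
  define z where "z = cis (2 * pi * real_of_int m / real N)"
  have pow: "z ^ j = cis (2 * pi * real j * real_of_int m / real N)" for j
    unfolding z_def Complex.DeMoivre by (rule arg_cong[of _ _ cis]) simp
  have "z ^ N = 1"
    using cis_multiple_2pi[of "real_of_int m"] assms by (simp add: pow mult_ac)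
  then have "(\<Sum>j<N. z ^ j) = (if z = 1 then of_nat N else 0)"
    by (simp add: sum_gp_strict)
  then show ?thesis
    using cis_eq_1_iff_dvd[OF assms, of m] by (simp add: pow flip: z_def)
qed

definition freqs :: "nat \<Rightarrow> nat \<Rightarrow> (nat \<Rightarrow> nat) set" where
  "freqs d N = ({..<d} \<rightarrow>\<^sub>E {..<N})"

definition character :: "nat \<Rightarrow> nat \<Rightarrow> (nat \<Rightarrow> nat) \<Rightarrow> point \<Rightarrow> complex" where
  "character d N \<theta> x = (\<Prod>i<d. cis (2 * pi * real (\<theta> i) * real_of_int (x i) / real N))"

definition symbol :: "nat \<Rightarrow> nat \<Rightarrow> (nat \<Rightarrow> nat) \<Rightarrow> real" where
  "symbol d N \<theta> = (\<Sum>i<d. cos (2 * pi * real (\<theta> i) / real N)) / real d"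

lemma finite_freqs [simp]: "finite (freqs d N)"
  unfolding freqs_def by (intro finite_PiE) auto

lemma norm_character [simp]: "norm (character d N \<theta> x) = 1"
  by (simp add: character_def flip: prod_norm)

lemma character_shift:
  assumes "i < d"
  shows "character d N \<theta> (x + basis_vec i) = cis (2 * pi * real (\<theta> i) / real N) * character d N \<theta> x"
    and "character d N \<theta> (x - basis_vec i) = cis (- (2 * pi * real (\<theta> i) / real N)) * character d N \<theta> x"
proof -
  let ?c = "\<lambda>x k. cis (2 * pi * real (\<theta> k) * real_of_int (x k) / real N)"
  have rem: "character d N \<theta> y = ?c y i * (\<Prod>k\<in>{..<d} - {i}. ?c y k)" for y
    unfolding character_def using assms by (subst prod.remove[of _ i]) auto
  have rest: "(\<Prod>k\<in>{..<d} - {i}. ?c y k) = (\<Prod>k\<in>{..<d} - {i}. ?c x k)"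
    if "y = x + basis_vec i \<or> y = x - basis_vec i" for y
    using that by (intro prod.cong) (auto simp: basis_vec_def)
  have "?c (x + basis_vec i) i = cis (2 * pi * real (\<theta> i) / real N) * ?c x i"
    unfolding cis_mult by (rule arg_cong[of _ _ cis]) (simp add: basis_vec_def ring_distribs add_divide_distrib)
  then show "character d N \<theta> (x + basis_vec i) = cis (2 * pi * real (\<theta> i) / real N) * character d N \<theta> x"
    unfolding rem[of "x + basis_vec i"] rem[of x] using rest[of "x + basis_vec i"]
    by (simp only: mult.assoc simp_thms)
  have "?c (x - basis_vec i) i = cis (- (2 * pi * real (\<theta> i) / real N)) * ?c x i"
    unfolding cis_mult by (rule arg_cong[of _ _ cis]) (simp add: basis_vec_def ring_distribs diff_divide_distrib)
  then show "character d N \<theta> (x - basis_vec i) = cis (- (2 * pi * real (\<theta> i) / real N)) * character d N \<theta> x"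
    unfolding rem[of "x - basis_vec i"] rem[of x] using rest[of "x - basis_vec i"]
    by (simp only: mult.assoc simp_thms)
qed

lemma avg_character: "avg d (character d N \<theta>) x = of_real (symbol d N \<theta>) * character d N \<theta> x"
proof -
  have "character d N \<theta> (x + basis_vec i) + character d N \<theta> (x - basis_vec i) =
      of_real (2 * cos (2 * pi * real (\<theta> i) / real N)) * character d N \<theta> x" if "i < d" for i
    unfolding character_shift[OF that] ring_distribs(2)[symmetric]
    by (simp add: complex_eq_iff)
  then have "(\<Sum>i<d. character d N \<theta> (x + basis_vec i) + character d N \<theta> (x - basis_vec i)) =
      (\<Sum>i<d. of_real (2 * cos (2 * pi * real (\<theta> i) / real N)) * character d N \<theta> x)"
    by (intro sum.cong) auto
  then show ?thesis
    unfolding avg_alt symbol_def by (simp add: sum_distrib_left sum_distrib_right field_simps flip: sum_distrib_left)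
qed

definition congruent_mod :: "nat \<Rightarrow> nat \<Rightarrow> point \<Rightarrow> point \<Rightarrow> bool" where
  "congruent_mod d N a x \<longleftrightarrow> (\<forall>i<d. int N dvd x i - a i)"

lemma indicator_characters:
  assumes "N > 0"
  shows "of_bool (congruent_mod d N a x) = (\<Sum>\<theta>\<in>freqs d N. character d N \<theta> (x - a)) / of_nat N ^ d"
proof -
  have "(\<Sum>\<theta>\<in>freqs d N. character d N \<theta> (x - a)) =
      (\<Prod>i<d. \<Sum>j<N. cis (2 * pi * real j * real_of_int ((x - a) i) / real N))"
    unfolding character_def freqs_def by (subst prod_sum_PiE) auto
  also have "\<dots> = (\<Prod>i<d. if int N dvd x i - a i then of_nat N else 0)"
    unfolding sum_cis_roots[OF assms] by simp
  also have "\<dots> = of_bool (congruent_mod d N a x) * of_nat N ^ d"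
    by (auto simp: congruent_mod_def)
  finally show ?thesis using assms by simp
qed

lemma avg_shift: "avg d (\<lambda>x. f (x - a)) x = avg d f (x - a)"
  by (simp only: avg_def add_diff_eq[symmetric] diff_add_eq)

text \<open>The torus heat kernel lifted to a periodic function on the lattice; \<open>a\<close> is
  the target, the last argument the starting point.\<close>

definition heat :: "nat \<Rightarrow> nat \<Rightarrow> point \<Rightarrow> nat \<Rightarrow> point \<Rightarrow> real" where
  "heat d N a n = (avg d ^^ n) (\<lambda>x. of_bool (congruent_mod d N a x))"

text \<open>The triangle inequality in the Fourier inversion formula: a bound free of both end
  points and, unlike \<open>heat\<close> itself, decreasing in time even when the parity of the walk
  matters.\<close>

definition heat_sup :: "nat \<Rightarrow> nat \<Rightarrow> nat \<Rightarrow> real" where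
  "heat_sup d N n = (\<Sum>\<theta>\<in>freqs d N. \<bar>symbol d N \<theta>\<bar> ^ n) / real N ^ d"

lemma of_real_avg: "complex_of_real (avg d f x) = avg d (\<lambda>x. complex_of_real (f x)) x"
  by (simp only: avg_def of_real_divide of_real_sum of_real_of_nat_eq)

lemma heat_fourier:
  assumes "N > 0"
  shows "complex_of_real (heat d N a n x) =
    (\<Sum>\<theta>\<in>freqs d N. of_real (symbol d N \<theta> ^ n) * character d N \<theta> (x - a)) / of_nat N ^ d"
proof (induction n arbitrary: x)
  case 0
  have "complex_of_real (heat d N a 0 x) = of_bool (congruent_mod d N a x)" by (simp add: heat_def)
  then show ?case
    unfolding indicator_characters[OF assms] by (simp only: power_0 of_real_1 mult_1)
next
  case (Suc n)
  have "complex_of_real (heat d N a (Suc n) x) = avg d (\<lambda>x. complex_of_real (heat d N a n x)) x"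
    by (simp only: heat_def funpow.simps o_apply of_real_avg)
  also have "\<dots> = avg d (\<lambda>x. \<Sum>\<theta>\<in>freqs d N. (of_real (symbol d N \<theta> ^ n) / of_nat N ^ d) *
      character d N \<theta> (x - a)) x"
    unfolding Suc sum_divide_distrib by (simp only: times_divide_eq_left)
  also have "\<dots> = (\<Sum>\<theta>\<in>freqs d N. (of_real (symbol d N \<theta> ^ n) / of_nat N ^ d) *
      (of_real (symbol d N \<theta>) * character d N \<theta> (x - a)))"
    by (simp only: avg_sum avg_cmult avg_shift avg_character)
  also have "\<dots> = (\<Sum>\<theta>\<in>freqs d N. of_real (symbol d N \<theta> ^ Suc n) * character d N \<theta> (x - a)) / of_nat N ^ d"
    by (simp add: sum_divide_distrib mult_ac)
  finally show ?case .
qed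

lemma heat_le_heat_sup:
  assumes "N > 0"
  shows "heat d N a n x \<le> heat_sup d N n"
proof -
  have "heat d N a n x \<le> norm (complex_of_real (heat d N a n x))" by simp
  also have "\<dots> \<le> (\<Sum>\<theta>\<in>freqs d N. norm (complex_of_real (symbol d N \<theta> ^ n) * character d N \<theta> (x - a))) / real N ^ d"
    unfolding heat_fourier[OF assms] norm_divide
    by (simp only: norm_power norm_of_nat) (intro divide_right_mono norm_sum, simp)
  also have "\<dots> = heat_sup d N n"
    by (simp add: heat_sup_def norm_mult norm_power power_abs)
  finally show ?thesis .
qed

lemma abs_symbol_le_1: "\<bar>symbol d N \<theta>\<bar> \<le> 1"
proof -
  have "\<bar>\<Sum>i<d. cos (2 * pi * real (\<theta> i) / real N)\<bar> \<le> (\<Sum>i<d. 1)"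
    by (rule order_trans[OF sum_abs]) (intro sum_mono abs_cos_le_one)
  then show ?thesis by (cases "d = 0") (auto simp: symbol_def divide_simps)
qed

lemma heat_sup_antimono: "n \<le> n' \<Longrightarrow> heat_sup d N n' \<le> heat_sup d N n"
  unfolding heat_sup_def
  by (intro divide_right_mono sum_mono power_decreasing) (auto intro: abs_symbol_le_1)

lemma heat_sup_nonneg: "heat_sup d N n \<ge> 0"
  unfolding heat_sup_def by (intro divide_nonneg_nonneg sum_nonneg) auto

lemma congruent_unit_steps:
  assumes "N \<ge> 3" "e \<in> unit_steps d" "e' \<in> unit_steps d" "congruent_mod d N e e'"
  shows "e = e'"
proof (rule ccontr)
  assume ne: "e \<noteq> e'"
  obtain i where i: "i < d" "e = basis_vec i \<or> e = - basis_vec i" using assms(2) by (auto simp: unit_steps_def)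
  obtain j where j: "j < d" "e' = basis_vec j \<or> e' = - basis_vec j" using assms(3) by (auto simp: unit_steps_def)
  have "int N dvd e' i - e i" using assms(4) i by (auto simp: congruent_mod_def)
  moreover have "e' i - e i \<noteq> 0" "\<bar>e' i - e i\<bar> \<le> 2"
    using i j ne by (auto simp: basis_vec_def split: if_splits)
  ultimately show False using assms(1) zdvd_not_zless[of "\<bar>e' i - e i\<bar>" "int N"] by auto
qed

text \<open>At even times \<open>heat_sup\<close> is the return probability itself. After one step
  at most one unit step leads back, because unit steps are pairwise incongruent for N \<ge>
  3.\<close>

lemma heat_sup_2:
  assumes "N \<ge> 3" "d \<ge> 1"
  shows "heat_sup d N 2 \<le> 1 / (2 * real d)"
proof -
  have N: "N > 0" using assms by simp
  have one: "avg d (\<lambda>x. of_bool (congruent_mod d N 0 x)) e \<le> 1 / (2 * real d)" for e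
  proof -
    let ?S = "{e' \<in> unit_steps d. congruent_mod d N 0 (e + e')}"
    have "(\<Sum>e'\<in>unit_steps d. of_bool (congruent_mod d N 0 (e + e'))) = real (card ?S)"
      by (simp add: of_bool_def sum.If_cases Int_def)
    also have "\<dots> \<le> 1"
    proof (rule ccontr)
      assume "\<not> real (card ?S) \<le> 1"
      then have "card ?S \<ge> 2" by linarith
      then obtain a b where ab: "a \<in> ?S" "b \<in> ?S" "a \<noteq> b"
        using card_le_Suc0_iff_eq[of ?S] by fastforce
      have "congruent_mod d N a b"
        unfolding congruent_mod_def
      proof (intro allI impI)
        fix i assume "i < d"
        then have "int N dvd (e + b) i - 0 i" "int N dvd (e + a) i - 0 i"
          using ab unfolding congruent_mod_def by blast+
        then have "int N dvd ((e + b) i - 0 i) - ((e + a) i - 0 i)" by (rule dvd_diff)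
        then show "int N dvd b i - a i" by simp
      qed
      then show False using congruent_unit_steps[OF assms(1), of a d b] ab by auto
    qed
    finally have "(\<Sum>e'\<in>unit_steps d. of_bool (congruent_mod d N 0 (e + e'))) \<le> (1::real)" .
    then show ?thesis
      unfolding avg_def using assms(2) by (simp only: of_nat_mult of_nat_numeral) (intro divide_right_mono, auto)
  qed
  have "heat d N 0 2 0 \<le> 1 / (2 * real d)"
    unfolding heat_def numeral_2_eq_2 funpow.simps o_apply
    by (rule avg_le) (use one assms(2) in auto)
  moreover have "complex_of_real (heat d N 0 2 0) = complex_of_real (heat_sup d N 2)"
    unfolding heat_fourier[OF N] heat_sup_def by (simp add: character_def)
  then have "heat d N 0 2 0 = heat_sup d N 2" by (simp only: of_real_eq_iff)
  ultimately show ?thesis by simp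
qed

section \<open>One-coordinate factors of the Fourier bound\<close>

definition gauss_sum :: "nat \<Rightarrow> real \<Rightarrow> real" where
  "gauss_sum N t = (\<Sum>j<N. exp (- t * (sin (2 * pi * real j / real N))\<^sup>2)) / real N"

text \<open>The absolute value makes frequencies near pi as dangerous as those near 0, which is why
  sin^2, vanishing at both, takes the place of 1 - cos.\<close>

lemma abs_symbol_le_exp:
  assumes "d \<ge> 1"
  shows "\<bar>symbol d N \<theta>\<bar> \<le> exp (- (\<Sum>i<d. (sin (2 * pi * real (\<theta> i) / real N))\<^sup>2) / (2 * real d))"
proof -
  have c: "\<bar>cos t\<bar> \<le> 1 - (sin t)\<^sup>2 / 2" for t :: real
  proof -
    have "0 \<le> (1 - \<bar>cos t\<bar>)\<^sup>2" by simp
    then have "2 * \<bar>cos t\<bar> \<le> 1 + (cos t)\<^sup>2" by (simp add: power2_diff)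
    then show ?thesis by (simp add: sin_squared_eq field_simps)
  qed
  have "\<bar>symbol d N \<theta>\<bar> \<le> (\<Sum>i<d. \<bar>cos (2 * pi * real (\<theta> i) / real N)\<bar>) / real d"
    unfolding symbol_def by (simp add: divide_right_mono sum_abs)
  also have "\<dots> \<le> (\<Sum>i<d. 1 - (sin (2 * pi * real (\<theta> i) / real N))\<^sup>2 / 2) / real d"
    by (intro divide_right_mono sum_mono c) auto
  also have "\<dots> = 1 + - (\<Sum>i<d. (sin (2 * pi * real (\<theta> i) / real N))\<^sup>2) / (2 * real d)"
    using assms by (simp add: sum_subtractf diff_divide_distrib sum_divide_distrib)
  also have "\<dots> \<le> exp (- (\<Sum>i<d. (sin (2 * pi * real (\<theta> i) / real N))\<^sup>2) / (2 * real d))"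
    by (rule exp_ge_add_one_self)
  finally show ?thesis .
qed

lemma heat_sup_le_gauss_sum:
  assumes "d \<ge> 1"
  shows "heat_sup d N n \<le> gauss_sum N (real n / (2 * real d)) ^ d"
proof -
  let ?s = "\<lambda>j. (sin (2 * pi * real j / real N))\<^sup>2"
  let ?t = "real n / (2 * real d)"
  have "\<bar>symbol d N \<theta>\<bar> ^ n \<le> (\<Prod>i<d. exp (- ?t * ?s (\<theta> i)))" for \<theta>
  proof -
    have "\<bar>symbol d N \<theta>\<bar> ^ n \<le> exp (- (\<Sum>i<d. ?s (\<theta> i)) / (2 * real d)) ^ n"
      by (intro power_mono abs_symbol_le_exp assms) auto
    also have "\<dots> = exp (\<Sum>i<d. - ?t * ?s (\<theta> i))"
      by (simp add: exp_of_nat_mult[symmetric] sum_distrib_left sum_divide_distrib sum_negf)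
    finally show ?thesis by (simp add: exp_sum)
  qed
  then have "heat_sup d N n \<le> (\<Sum>\<theta>\<in>freqs d N. \<Prod>i<d. exp (- ?t * ?s (\<theta> i))) / real N ^ d"
    unfolding heat_sup_def by (intro divide_right_mono sum_mono) auto
  also have "(\<Sum>\<theta>\<in>freqs d N. \<Prod>i<d. exp (- ?t * ?s (\<theta> i))) = (\<Prod>i<d. \<Sum>j<N. exp (- ?t * ?s j))"
    unfolding freqs_def by (subst prod_sum_PiE) auto
  finally show ?thesis by (simp add: gauss_sum_def power_divide)
qed

lemma gauss_sum_antimono: "t \<le> t' \<Longrightarrow> gauss_sum N t' \<le> gauss_sum N t"
  unfolding gauss_sum_def by (intro divide_right_mono sum_mono) (auto intro: mult_right_mono)

lemma gauss_sum_nonneg: "gauss_sum N t \<ge> 0"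
  unfolding gauss_sum_def by (intro divide_nonneg_nonneg sum_nonneg) auto

lemma sum_sin_squared:
  assumes "N \<ge> 3"
  shows "(\<Sum>j<N. (sin (2 * pi * real j / real N))\<^sup>2) = real N / 2"
proof -
  have "\<not> int N dvd 2" using assms zdvd_imp_le[of "int N" 2] by auto
  then have "(\<Sum>j<N. cis (2 * pi * real j * real_of_int 2 / real N)) = 0"
    using sum_cis_roots[of N 2] assms by simp
  then have "(\<Sum>j<N. cos (2 * pi * real j * 2 / real N)) = 0"
    by (simp add: complex_eq_iff)
  moreover have "(sin (2 * pi * real j / real N))\<^sup>2 = 1 / 2 - cos (2 * pi * real j * 2 / real N) / 2" for j
    using cos_double_sin[of "2 * pi * real j / real N"] by (simp add: field_simps)
  ultimately show ?thesis
    by (simp add: sum_subtractf sum_divide_distrib[symmetric])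
qed

text \<open>The mean of sin^2 over the N frequencies is 1/2, and exp(-y) \<le> 1 - y/2 on [0, 1]. At
  t = 1 every coordinate gains a factor 3/4, which in high dimension is an exponential gain.\<close>

lemma gauss_sum_small_time:
  assumes "N \<ge> 3" "0 \<le> t" "t \<le> 1"
  shows "gauss_sum N t \<le> 1 - t / 4"
proof -
  have e: "exp (- y) \<le> 1 - y / 2" if "0 \<le> y" "y \<le> 1" for y :: real
  proof -
    have "exp (- y) * (1 + y) \<le> exp (- y) * exp y"
      by (intro mult_left_mono exp_ge_add_one_self) auto
    also have "\<dots> = 1" by (simp add: exp_minus)
    also have "1 \<le> (1 - y / 2) * (1 + y)"
      using mult_nonneg_nonneg[OF that(1), of "1 - y"] that by (simp add: algebra_simps)
    finally show ?thesis using that by (simp add: mult_le_cancel_right)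
  qed
  have "exp (- t * (sin x)\<^sup>2) \<le> 1 - t * (sin x)\<^sup>2 / 2" for x
    using e[of "t * (sin x)\<^sup>2"] assms mult_mono[of t 1 "(sin x)\<^sup>2" 1] by (simp add: abs_square_le_1)
  then have "gauss_sum N t \<le> (\<Sum>j<N. 1 - t * (sin (2 * pi * real j / real N))\<^sup>2 / 2) / real N"
    unfolding gauss_sum_def by (intro divide_right_mono sum_mono) auto
  also have "(\<Sum>j<N. 1 - t * (sin (2 * pi * real j / real N))\<^sup>2 / 2) = real N - t / 2 * (real N / 2)"
    unfolding sum_sin_squared[OF assms(1), symmetric] by (simp add: sum_subtractf sum_distrib_left)
  also have "(real N - t / 2 * (real N / 2)) / real N = 1 - t / 4"
    using assms by (simp add: field_simps)
  finally show ?thesis .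
qed

lemma abs_sin_ge:
  fixes x :: real
  assumes "\<bar>x\<bar> \<le> pi / 2"
  shows "\<bar>x\<bar> / 2 \<le> \<bar>sin x\<bar>"
proof -
  have "\<bar>sin x - x\<bar> \<le> \<bar>x\<bar> ^ 3 / 6"
    using Maclaurin_sin_bound[of x 3] by (simp add: numeral_3_eq_3 sin_coeff_def lessThan_Suc fact_numeral field_simps)
  moreover have "\<bar>x\<bar> ^ 2 \<le> 3"
  proof -
    have "\<bar>x\<bar> \<le> 1.6" using assms pi_less_4 pi_approx by auto
    then have "\<bar>x\<bar> ^ 2 \<le> 1.6 ^ 2" by (intro power_mono) auto
    then show ?thesis by (simp add: power2_eq_square)
  qed
  then have "\<bar>x\<bar> ^ 3 \<le> 3 * \<bar>x\<bar>"
    using mult_right_mono[of "\<bar>x\<bar> ^ 2" 3 "\<bar>x\<bar>"] by (simp add: power2_eq_square power3_eq_cube)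
  ultimately show ?thesis by linarith
qed

lemma card_near:
  fixes c r :: real
  assumes "r \<ge> 0"
  shows "real (card {j::nat. \<bar>real j - c\<bar> \<le> r}) \<le> 2 * r + 1" "finite {j::nat. \<bar>real j - c\<bar> \<le> r}"
proof -
  have sub: "int ` {j::nat. \<bar>real j - c\<bar> \<le> r} \<subseteq> {\<lceil>c - r\<rceil>..\<lfloor>c + r\<rfloor>}"
    by (auto simp: ceiling_le_iff le_floor_iff abs_le_iff)
  then show fin: "finite {j::nat. \<bar>real j - c\<bar> \<le> r}"
    using finite_subset finite_imageD by (metis finite_atLeastAtMost_int inj_on_of_nat)
  have "card {j::nat. \<bar>real j - c\<bar> \<le> r} = card (int ` {j::nat. \<bar>real j - c\<bar> \<le> r})"
    by (simp add: card_image)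
  also have "\<dots> \<le> nat (\<lfloor>c + r\<rfloor> - \<lceil>c - r\<rceil> + 1)"
    using card_mono[OF _ sub] by simp
  finally have "real (card {j::nat. \<bar>real j - c\<bar> \<le> r}) \<le> real (nat (\<lfloor>c + r\<rfloor> - \<lceil>c - r\<rceil> + 1))"
    by simp
  also have "\<dots> \<le> 2 * r + 1" using assms by linarith
  finally show "real (card {j::nat. \<bar>real j - c\<bar> \<le> r}) \<le> 2 * r + 1" .
qed

text \<open>Frequencies with |sin| below \<beta> = t^(-1/3) are counted, the others contribute at
  most 1/(t \<beta>^2); this \<beta> makes the two parts of equal order. The term 3/N is one extra
  index for each of three windows around the zeros of sin; it survives as t grows, as the uniform
  law does.\<close>

lemma gauss_sum_large_time:
  assumes N: "N \<ge> 1" and t: "t \<ge> 1"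
  shows "gauss_sum N t \<le> 3 / real N + 3 * t powr (- 1 / 3)"
proof -
  define \<beta> where "\<beta> = t powr (- 1 / 3)"
  have \<beta>: "\<beta> > 0" "\<beta> \<le> 1" using t powr_mono[of "- 1 / 3" 0 t] by (auto simp: \<beta>_def)
  have t\<beta>: "t * \<beta> ^ 2 = 1 / \<beta>"
  proof -
    have "t * \<beta> ^ 3 = t powr 1 * t powr (- 1 / 3 * 3)"
      using t unfolding \<beta>_def by (simp add: powr_powr powr_realpow[symmetric])
    also have "\<dots> = 1" using t by (simp add: powr_add[symmetric] powr_minus)
    finally show ?thesis using \<beta> by (simp add: field_simps power2_eq_square power3_eq_cube)
  qed
  let ?s = "\<lambda>j::nat. sin (2 * pi * real j / real N)"
  define J where "J = {j \<in> {..<N}. \<bar>?s j\<bar> < \<beta>}"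
  \<comment> \<open>|x|/2 \<le> |sin x| < \<beta> gives |x| < 2 \<beta>; on the index scale x = 2 pi
    j / N this is a distance below \<beta> N / pi, enlarged by pi > 3.\<close>
  define r where "r = \<beta> * real N / 3"
  have r: "r \<ge> 0" using \<beta> by (simp add: r_def)
  let ?K = "\<lambda>k::real. {j::nat. \<bar>real j - k * real N / 2\<bar> \<le> r}"
  have "J \<subseteq> ?K 0 \<union> ?K 1 \<union> ?K 2"
  proof
    fix j assume j: "j \<in> J"
    define x where "x = 2 * pi * real j / real N"
    have x: "0 \<le> x" "x \<le> 2 * pi" "\<bar>sin x\<bar> < \<beta>" using j N by (auto simp: x_def J_def field_simps)
    have close: "j \<in> ?K k" if "\<bar>x - k * pi\<bar> \<le> pi / 2" "\<bar>sin (x - k * pi)\<bar> = \<bar>sin x\<bar>" for k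
    proof -
      have "\<bar>x - k * pi\<bar> / 2 < \<beta>" using abs_sin_ge[OF that(1)] x(3) unfolding that(2) by (rule le_less_trans)
      then have "\<bar>x - k * pi\<bar> \<le> 2 * \<beta>" by simp
      moreover have "x - k * pi = 2 * pi / real N * (real j - k * real N / 2)"
        using N by (simp add: x_def field_simps)
      ultimately have "2 * pi / real N * \<bar>real j - k * real N / 2\<bar> \<le> 2 * \<beta>"
        using N by (simp add: abs_mult)
      then have "pi * \<bar>real j - k * real N / 2\<bar> \<le> \<beta> * real N" using N by (simp add: field_simps)
      moreover have "3 * \<bar>real j - k * real N / 2\<bar> \<le> pi * \<bar>real j - k * real N / 2\<bar>"
        using pi_gt3 by (intro mult_right_mono) auto
      ultimately show ?thesis by (simp add: r_def)
    qed
    consider "x \<le> pi / 2" | "pi / 2 \<le> x" "x \<le> 3 * pi / 2" | "3 * pi / 2 \<le> x" by linarith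
    then show "j \<in> ?K 0 \<union> ?K 1 \<union> ?K 2"
    proof cases
      case 1
      then show ?thesis using close[of 0] x by simp
    next
      case 2
      then have "\<bar>x - 1 * pi\<bar> \<le> pi / 2" by linarith
      then have "j \<in> ?K 1" by (rule close) (simp add: sin_diff)
      then show ?thesis by blast
    next
      case 3
      then have "\<bar>x - 2 * pi\<bar> \<le> pi / 2" using x by linarith
      then have "j \<in> ?K 2" by (rule close) (simp add: sin_diff)
      then show ?thesis by blast
    qed
  qed
  then have "card J \<le> card (?K 0 \<union> ?K 1 \<union> ?K 2)"
    by (intro card_mono finite_UnI card_near(2)[OF r])
  also have "\<dots> \<le> card (?K 0) + card (?K 1) + card (?K 2)"
    by (meson add_le_mono1 card_Un_le le_trans)
  finally have "real (card J) \<le> real (card (?K 0)) + real (card (?K 1)) + real (card (?K 2))"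
    by (simp add: of_nat_mono flip: of_nat_add)
  also have "\<dots> \<le> (2 * r + 1) + (2 * r + 1) + (2 * r + 1)"
    by (intro add_mono card_near(1)[OF r])
  finally have J: "real (card J) \<le> 2 * \<beta> * real N + 3" by (simp add: r_def)
  have ex: "exp (- t * (?s j)\<^sup>2) \<le> \<beta>" if "\<not> \<bar>?s j\<bar> < \<beta>" for j
  proof -
    have "\<beta> ^ 2 \<le> \<bar>?s j\<bar> ^ 2" using that \<beta> by (intro power_mono) auto
    then have "1 / \<beta> \<le> t * (?s j)\<^sup>2" using t mult_left_mono[of "\<beta>\<^sup>2" "(?s j)\<^sup>2" t] t\<beta> by simp
    also have "\<dots> \<le> exp (t * (?s j)\<^sup>2)" using exp_ge_add_one_self[of "t * (?s j)\<^sup>2"] by linarith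
    finally have "1 / exp (t * (?s j)\<^sup>2) \<le> \<beta>" using \<beta> by (simp add: field_simps)
    then show ?thesis by (simp add: exp_minus field_simps)
  qed
  have "(\<Sum>j<N. exp (- t * (?s j)\<^sup>2)) \<le> (\<Sum>j<N. of_bool (\<bar>?s j\<bar> < \<beta>) + \<beta>)"
  proof (rule sum_mono)
    fix j
    show "exp (- t * (?s j)\<^sup>2) \<le> of_bool (\<bar>?s j\<bar> < \<beta>) + \<beta>"
      using ex[of j] t \<beta> by (cases "\<bar>?s j\<bar> < \<beta>") (auto intro: order_trans[of _ 1])
  qed
  also have "\<dots> = real (card J) + real N * \<beta>"
    by (simp add: sum.distrib of_bool_def sum.If_cases J_def Int_def)
  also have "\<dots> \<le> 3 + 3 * \<beta> * real N" using J by simp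
  finally show ?thesis
    unfolding gauss_sum_def \<beta>_def[symmetric] using N by (simp add: divide_simps)
qed

section \<open>Return probabilities on the lattice in high dimension\<close>

lemma funpow_avg_mono:
  fixes f g :: "point \<Rightarrow> real"
  assumes "\<And>x. f x \<le> g x"
  shows "(avg d ^^ n) f x \<le> (avg d ^^ n) g x"
proof (induction n arbitrary: x)
  case (Suc n)
  then show ?case unfolding funpow.simps o_apply by (intro avg_mono) auto
qed (simp add: assms)

lemma funpow_avg_const_0: "(avg d ^^ n) (\<lambda>_. 0) x = 0"
  by (induction n arbitrary: x) (simp_all add: avg_def)

abbreviation lattice_return :: "nat \<Rightarrow> nat \<Rightarrow> real" where
  "lattice_return \<nu> n \<equiv> (avg \<nu> ^^ n) (\<lambda>x. of_bool (x = 0)) 0"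

lemma lattice_return_nonneg: "lattice_return \<nu> n \<ge> 0"
  using funpow_avg_mono[where f = "\<lambda>_. 0" and g = "\<lambda>x. of_bool (x = 0)" and d = \<nu> and n = n and x = 0]
  unfolding funpow_avg_const_0 by simp

text \<open>Projection to a torus can only create returns, so the lattice is compared with a torus
  of convenient size: side 3 for short times, side n + 3 for long ones.\<close>

lemma lattice_return_le_heat_sup:
  assumes "N > 0"
  shows "lattice_return \<nu> n \<le> heat_sup \<nu> N n"
proof -
  have "lattice_return \<nu> n \<le> heat \<nu> N 0 n 0"
    unfolding heat_def by (rule funpow_avg_mono) (auto simp: congruent_mod_def)
  also have "\<dots> \<le> heat_sup \<nu> N n" by (rule heat_le_heat_sup[OF assms])
  finally show ?thesis .
qed

lemma lattice_return_le_inverse: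
  assumes "\<nu> \<ge> 1" "n \<ge> 1"
  shows "lattice_return \<nu> n \<le> 1 / (2 * real \<nu>)"
proof (cases "n = 1")
  case True
  have "(\<Sum>e\<in>unit_steps \<nu>. of_bool (0 + e = 0) :: real) = 0"
    by (rule sum.neutral) (auto simp: unit_steps_def)
  then have "lattice_return \<nu> n = 0" unfolding True by (simp add: avg_def)
  then show ?thesis by simp
next
  case False
  have "lattice_return \<nu> n \<le> heat_sup \<nu> 3 n" by (rule lattice_return_le_heat_sup) simp
  also have "\<dots> \<le> heat_sup \<nu> 3 2" by (rule heat_sup_antimono) (use False assms in simp)
  also have "\<dots> \<le> 1 / (2 * real \<nu>)" by (rule heat_sup_2) (use assms in auto)
  finally show ?thesis .
qed

lemma lattice_return_le_short:
  assumes "\<nu> \<ge> 1" "n \<le> 2 * \<nu>"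
  shows "lattice_return \<nu> n \<le> exp (- real n / 8)"
proof -
  let ?t = "real n / (2 * real \<nu>)"
  have t: "0 \<le> ?t" "?t \<le> 1" using assms by (auto simp: field_simps simp flip: of_nat_mult)
  have "lattice_return \<nu> n \<le> heat_sup \<nu> 3 n" by (rule lattice_return_le_heat_sup) simp
  also have "\<dots> \<le> gauss_sum 3 ?t ^ \<nu>" by (rule heat_sup_le_gauss_sum[OF assms(1)])
  also have "\<dots> \<le> (1 - ?t / 4) ^ \<nu>"
    by (intro power_mono gauss_sum_small_time gauss_sum_nonneg) (use t in auto)
  also have "\<dots> \<le> exp (- ?t / 4) ^ \<nu>"
    using exp_ge_add_one_self[of "- ?t / 4"] t by (intro power_mono) auto
  also have "\<dots> = exp (- real n / 8)"
    using assms by (simp add: exp_of_nat_mult[symmetric])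
  finally show ?thesis .
qed

lemma gauss_sum_le_powr:
  assumes "t \<ge> 1" "real N \<ge> t"
  shows "gauss_sum N t \<le> 6 * t powr (- 1 / 3)"
proof -
  have "1 / real N \<le> 1 / t" using assms by (intro divide_left_mono) auto
  also have "\<dots> = t powr (- 1)" using assms by (simp add: powr_minus_divide)
  also have "\<dots> \<le> t powr (- 1 / 3)" using assms by (intro powr_mono) auto
  finally show ?thesis using gauss_sum_large_time[of N t] assms by linarith
qed

text \<open>Of the \<nu> one-coordinate factors, six give the summable decay n^(-2) and the
  remaining \<nu> - 6, each at most 3/4, give smallness in the dimension. Side n + 3 keeps the term
  3/N below 3 t^(-1/3).\<close>

lemma lattice_return_le_long:
  assumes "\<nu> \<ge> 6" "n > 2 * \<nu>"
  shows "lattice_return \<nu> n \<le> (3 / 4) ^ (\<nu> - 6) * (6 ^ 6 * 4 * real \<nu> ^ 2) / real n ^ 2"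
proof -
  let ?t = "real n / (2 * real \<nu>)" and ?N = "n + 3"
  have t: "?t \<ge> 1" using assms by (auto simp: field_simps simp flip: of_nat_mult)
  have tN: "?t \<le> real ?N" proof -
    have "real n / (2 * real \<nu>) \<le> real n / 1" using assms by (intro divide_left_mono) auto
    then show ?thesis by simp
  qed
  have "gauss_sum ?N ?t \<le> gauss_sum ?N 1" by (rule gauss_sum_antimono[OF t])
  also have "\<dots> \<le> 3 / 4" using gauss_sum_small_time[of ?N 1] by simp
  finally have g1: "gauss_sum ?N ?t \<le> 3 / 4" .
  have g2: "gauss_sum ?N ?t \<le> 6 * ?t powr (- 1 / 3)" by (rule gauss_sum_le_powr[OF t tN])
  have "lattice_return \<nu> n \<le> heat_sup \<nu> ?N n" by (rule lattice_return_le_heat_sup) simp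
  also have "\<dots> \<le> gauss_sum ?N ?t ^ \<nu>" by (rule heat_sup_le_gauss_sum) (use assms in simp)
  also have "\<dots> = gauss_sum ?N ?t ^ (\<nu> - 6) * gauss_sum ?N ?t ^ 6"
    using assms by (simp flip: power_add)
  also have "\<dots> \<le> (3 / 4) ^ (\<nu> - 6) * (6 * ?t powr (- 1 / 3)) ^ 6"
    by (intro mult_mono power_mono g1 g2 gauss_sum_nonneg) (auto intro: gauss_sum_nonneg)
  also have "(6 * ?t powr (- 1 / 3)) ^ 6 = 6 ^ 6 * (?t powr (- 1 / 3)) powr 6"
    using t assms by (simp add: power_mult_distrib powr_numeral)
  also have "(?t powr (- 1 / 3)) powr 6 = 1 / ?t ^ 2"
  proof -
    have "(?t powr (- 1 / 3)) powr 6 = ?t powr (- 2)" by (simp add: powr_powr)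
    also have "\<dots> = 1 / ?t powr 2" by (rule powr_minus_divide)
    also have "?t powr 2 = ?t ^ 2" using t by (subst powr_numeral) auto
    finally show ?thesis .
  qed
  also have "(3 / 4) ^ (\<nu> - 6) * (6 ^ 6 * (1 / ?t ^ 2)) = (3 / 4) ^ (\<nu> - 6) * (6 ^ 6 * 4 * real \<nu> ^ 2) / real n ^ 2"
    using assms by (simp add: power_divide power_mult_distrib)
  finally show ?thesis .
qed

theorem return_prob_tendsto_0: "return_prob \<longlonglongrightarrow> 0"
proof -
  \<comment> \<open>The gain (3/4)^\<nu> absorbs the factor \<nu>^2 left over from t = n/(2 \<nu>),
    so the long-time bound holds with one constant B for all dimensions.\<close>
  have "(\<lambda>\<nu>. (3 / 4 :: real) ^ \<nu> / (3 / 4) ^ 6 * (6 ^ 6 * 4 * real \<nu> ^ 2)) \<longlonglongrightarrow> 0"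
    by real_asymp
  then have "Bseq (\<lambda>\<nu>. (3 / 4 :: real) ^ \<nu> / (3 / 4) ^ 6 * (6 ^ 6 * 4 * real \<nu> ^ 2))"
    by (intro convergent_imp_Bseq) (unfold convergent_def, blast)
  then obtain B where B: "\<And>\<nu>. norm ((3 / 4 :: real) ^ \<nu> / (3 / 4) ^ 6 * (6 ^ 6 * 4 * real \<nu> ^ 2)) \<le> B"
    unfolding Bseq_def by blast
  have B': "(3 / 4) ^ (\<nu> - 6) * (6 ^ 6 * 4 * real \<nu> ^ 2) \<le> B" if "\<nu> \<ge> 6" for \<nu>
  proof -
    have "(3 / 4 :: real) ^ (\<nu> - 6) = (3 / 4) ^ \<nu> / (3 / 4) ^ 6" using that by (simp add: power_diff)
    then show ?thesis using B[of \<nu>] by (simp only: real_norm_def)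
  qed
  have B0: "B \<ge> 0" using B[of 0] norm_ge_zero order_trans by blast
  \<comment> \<open>A majorant independent of \<nu>, the sum of the short-time and the long-time
    bound, as Tannery's theorem demands.\<close>
  define M where "M = (\<lambda>k. exp (- 1 / 8) ^ Suc k + B * (1 / real (Suc k) ^ 2))"
  have bound: "\<bar>lattice_return \<nu> (Suc k)\<bar> \<le> M k" if "\<nu> \<ge> 6" for \<nu> k
  proof (cases "Suc k \<le> 2 * \<nu>")
    case True
    then have "lattice_return \<nu> (Suc k) \<le> exp (- real (Suc k) / 8)"
      by (intro lattice_return_le_short) (use that in auto)
    also have "\<dots> = exp (- 1 / 8) ^ Suc k"
      by (subst exp_of_nat_mult[symmetric]) (rule arg_cong[of _ _ exp], simp add: field_simps)
    also have "\<dots> \<le> M k" using B0 by (simp add: M_def)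
    finally show ?thesis using lattice_return_nonneg[where \<nu> = \<nu> and n = "Suc k"] by linarith
  next
    case False
    then have "lattice_return \<nu> (Suc k) \<le> (3 / 4) ^ (\<nu> - 6) * (6 ^ 6 * 4 * real \<nu> ^ 2) / real (Suc k) ^ 2"
      by (intro lattice_return_le_long) (use that in auto)
    also have "\<dots> \<le> B / real (Suc k) ^ 2" by (intro divide_right_mono B' that) auto
    also have "\<dots> \<le> M k" by (simp add: M_def)
    finally show ?thesis using lattice_return_nonneg[where \<nu> = \<nu> and n = "Suc k"] by linarith
  qed
  have M: "summable M"
    unfolding M_def
  proof (intro summable_add summable_mult)
    show "summable (\<lambda>k. exp (- 1 / 8 :: real) ^ Suc k)"
      by (subst summable_Suc_iff) (rule summable_geometric, simp)
    have "summable (\<lambda>n. inverse (real n ^ 2))" by (rule inverse_power_summable) simp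
    then show "summable (\<lambda>k. 1 / real (Suc k) ^ 2)"
      by (subst (asm) summable_Suc_iff[symmetric]) (simp only: inverse_eq_divide)
  qed
  have lim: "(\<lambda>\<nu>. lattice_return \<nu> (Suc k)) \<longlonglongrightarrow> 0" for k
  proof (rule real_tendsto_sandwich)
    show "eventually (\<lambda>\<nu>. 0 \<le> lattice_return \<nu> (Suc k)) sequentially"
      using lattice_return_nonneg by (intro always_eventually) blast
    show "eventually (\<lambda>\<nu>. lattice_return \<nu> (Suc k) \<le> 1 / (2 * real \<nu>)) sequentially"
      using eventually_ge_at_top[of 1] by eventually_elim (rule lattice_return_le_inverse, auto)
    show "(\<lambda>\<nu>. 1 / (2 * real \<nu>)) \<longlonglongrightarrow> 0" by real_asymp
  qed simp
  have "eventually (\<lambda>z. True \<and> snd z \<ge> 6) (at_top \<times>\<^sub>F (sequentially :: nat filter))"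
    using eventually_prodI[OF always_eventually[of "\<lambda>_. True"] eventually_ge_at_top[of "6::nat"]] by simp
  then have ev: "eventually (\<lambda>(k, \<nu>). norm (lattice_return \<nu> (Suc k)) \<le> M k) (at_top \<times>\<^sub>F sequentially)"
    by eventually_elim (use bound in \<open>auto simp only: real_norm_def snd_conv split: prod.splits\<close>)
  have T: "(\<lambda>\<nu>. \<Sum>k. lattice_return \<nu> (Suc k)) \<longlonglongrightarrow> (\<Sum>k. 0)"
    using tannerys_theorem[OF lim ev M] by simp
  have le: "return_prob \<nu> \<le> (\<Sum>k. lattice_return \<nu> (Suc k))" if "\<nu> \<ge> 6" for \<nu>
  proof (rule return_prob_le_suminf)
    show "summable (\<lambda>k. lattice_return \<nu> (Suc k))"
      by (rule summable_comparison_test'[OF M, of 0]) (use bound[OF that] in \<open>simp only: real_norm_def\<close>)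
  qed (use that in simp)
  show ?thesis
  proof (rule real_tendsto_sandwich[OF _ _ tendsto_const])
    show "eventually (\<lambda>\<nu>. 0 \<le> return_prob \<nu>) sequentially"
      by (intro always_eventually) (simp add: return_prob_def)
    show "eventually (\<lambda>\<nu>. return_prob \<nu> \<le> (\<Sum>k. lattice_return \<nu> (Suc k))) sequentially"
      using eventually_ge_at_top[of 6] by eventually_elim (rule le)
    show "(\<lambda>\<nu>. \<Sum>k. lattice_return \<nu> (Suc k)) \<longlonglongrightarrow> 0" using T by simp
  qed
qed

lemma mu_tendsto_0: "mu \<longlonglongrightarrow> 0"
proof -
  have "(\<lambda>d. return_prob (d - 2)) \<longlonglongrightarrow> 0"
    by (rule filterlim_compose[OF return_prob_tendsto_0 filterlim_minus_const_nat_at_top])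
  moreover have "(\<lambda>d. 2 / real d) \<longlonglongrightarrow> 0" "(\<lambda>d. 1 - 2 / real d) \<longlonglongrightarrow> 1" by real_asymp+
  ultimately have "(\<lambda>d. 49 * (2 / real d + (1 - 2 / real d) * return_prob (d - 2))) \<longlonglongrightarrow> 49 * (0 + 1 * 0)"
    by (intro tendsto_intros)
  then show ?thesis by (simp add: mu_def[abs_def])
qed

section \<open>Covering a subset of a plane\<close>

lemma hit_bounds:
  assumes "0 \<le> q" "q \<le> 1" "d \<ge> 1"
  shows "0 \<le> hit d q Q k x" "hit d q Q k x \<le> 1"
proof -
  have "\<forall>x. 0 \<le> hit d q Q k x \<and> hit d q Q k x \<le> 1"
  proof (induction k)
    case (Suc k)
    then have "0 \<le> avg d (hit d q Q k) x" "avg d (hit d q Q k) x \<le> 1" for x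
      by (intro avg_nonneg avg_le assms; blast)+
    then show ?case using assms by (simp add: mult_le_one)
  qed simp
  then show "0 \<le> hit d q Q k x" "hit d q Q k x \<le> 1" by auto
qed

lemma hit_mono:
  assumes "0 \<le> q" "q \<le> 1" "d \<ge> 1"
  shows "hit d q Q k x \<le> hit d q Q (Suc k) x"
proof (induction k arbitrary: x)
  case 0
  then show ?case using assms by (auto intro!: mult_nonneg_nonneg avg_nonneg)
next
  case (Suc k)
  have "avg d (hit d q Q k) x \<le> avg d (hit d q Q (Suc k)) x" by (intro avg_mono Suc)
  then have "q * avg d (hit d q Q k) x \<le> q * avg d (hit d q Q (Suc k)) x" by (rule mult_left_mono) fact
  then show ?case by (cases "Q x") (simp_all only: hit.simps(2)[of d q Q k] hit.simps(2)[of d q Q "Suc k"] if_True if_False order_refl)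
qed

context
  fixes d :: nat and i j :: nat and x0 :: point and \<tau> :: "nat \<Rightarrow> nat"
  assumes ij: "i < j" "j < d" and \<tau>: "bij_betw \<tau> {..<d - 2} ({..<d} - {i, j})"
begin

text \<open>\<open>\<tau>\<close> lists the d - 2 directions orthogonal to the plane through
  \<open>x0\<close>, so this is the displacement across the plane, read as a point of the (d -
  2)-dimensional lattice.\<close>

definition transversal :: "point \<Rightarrow> point" where
  "transversal x = (\<lambda>l. if l < d - 2 then x (\<tau> l) - x0 (\<tau> l) else 0)"

text \<open>Across the plane the walk is lazy: with probability 2/d the step lies in the plane,
  otherwise it is a simple random walk step in dimension d - 2. The formula for \<open>mu\<close>
  originates here.\<close>

lemma avg_transversal:
  "avg d (\<lambda>x. g (transversal x)) x =
    2 / real d * g (transversal x) + (1 - 2 / real d) * avg (d - 2) g (transversal x)" for g :: "point \<Rightarrow> real"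
proof -
  let ?z = transversal
  let ?G = "\<lambda>c. g (?z (x + basis_vec c)) + g (?z (x - basis_vec c))"
  have \<tau>ran: "\<tau> l \<noteq> i" "\<tau> l \<noteq> j" if "l < d - 2" for l
    using \<tau> that unfolding bij_betw_def by auto
  have \<tau>inj: "\<tau> l = \<tau> l' \<longleftrightarrow> l = l'" if "l < d - 2" "l' < d - 2" for l l'
    using \<tau> that unfolding bij_betw_def inj_on_def by auto
  have same: "?z (x + basis_vec c) = ?z x" "?z (x - basis_vec c) = ?z x" if "c = i \<or> c = j" for c
    using that \<tau>ran by (auto simp: transversal_def basis_vec_def fun_eq_iff)
  have step: "?z (x + basis_vec (\<tau> l)) = ?z x + basis_vec l" "?z (x - basis_vec (\<tau> l)) = ?z x - basis_vec l"
    if "l < d - 2" for l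
    using that \<tau>inj by (auto simp: transversal_def basis_vec_def fun_eq_iff)
  have "(\<Sum>c<d. ?G c) = (\<Sum>c\<in>{i, j} \<union> ({..<d} - {i, j}). ?G c)"
    by (rule sum.cong) (use ij in auto)
  also have "\<dots> = ?G i + ?G j + (\<Sum>c\<in>{..<d} - {i, j}. ?G c)"
    using ij by (subst sum.union_disjoint) auto
  also have "(\<Sum>c\<in>{..<d} - {i, j}. ?G c) = (\<Sum>l<d - 2. ?G (\<tau> l))"
    by (rule sum.reindex_bij_betw[OF \<tau>, symmetric])
  also have "\<dots> = (\<Sum>l<d - 2. g (?z x + basis_vec l) + g (?z x - basis_vec l))"
    by (intro sum.cong) (auto simp: step)
  also have "\<dots> = of_nat (2 * (d - 2)) * avg (d - 2) g (?z x)"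
    by (cases "d - 2 = 0") (simp_all add: avg_alt)
  also have "?G i + ?G j = 4 * g (?z x)" by (simp add: same)
  finally have "(\<Sum>c<d. ?G c) = 4 * g (?z x) + of_nat (2 * (d - 2)) * avg (d - 2) g (?z x)" .
  then show ?thesis
    unfolding avg_alt[of d] using ij by (simp add: of_nat_diff field_simps)
qed

text \<open>Up to time \<open>N\<close> the walk on the torus does not feel the periodicity.\<close>

lemma hit_plane_le_hitp:
  assumes d: "d \<ge> 3" and "\<And>l. \<bar>transversal x l\<bar> + int k < int N"
  shows "hit d 1 (\<lambda>x. \<forall>k<d. k \<noteq> i \<longrightarrow> k \<noteq> j \<longrightarrow> int N dvd x k - x0 k) k x \<le> hitp (d - 2) k (transversal x)"
  using assms(2)
proof (induction k arbitrary: x)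
  case (0 x)
  show ?case
  proof (cases "\<forall>k<d. k \<noteq> i \<longrightarrow> k \<noteq> j \<longrightarrow> int N dvd x k - x0 k")
    case True
    have "transversal x l = 0" for l
    proof (cases "l < d - 2")
      case l: True
      then have "\<tau> l \<in> {..<d} - {i, j}" using \<tau> by (auto simp: bij_betw_def)
      then have "int N dvd transversal x l" using True l by (auto simp: transversal_def)
      then show ?thesis using 0[of l] by (metis abs_ge_zero abs_zero add.right_neutral dvd_abs_iff of_nat_0 zdvd_not_zless order_le_less abs_eq_0_iff)
    qed (simp add: transversal_def)
    then have "transversal x = 0" by (auto simp: fun_eq_iff)
    then show ?thesis by (simp only: hit.simps of_bool_eq(2) simp_thms) simp
  next
    case False
    then have 0: "hit d 1 (\<lambda>x. \<forall>k<d. k \<noteq> i \<longrightarrow> k \<noteq> j \<longrightarrow> int N dvd x k - x0 k) 0 x = 0"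
      by (simp only: hit.simps of_bool_eq(1))
    show ?thesis unfolding 0 by (rule hit_bounds(1)) (use d in auto)
  qed
next
  case (Suc k x)
  let ?Q = "\<lambda>x. \<forall>k<d. k \<noteq> i \<longrightarrow> k \<noteq> j \<longrightarrow> int N dvd x k - x0 k"
  let ?z = transversal
  show ?case
  proof (cases "?z x = 0")
    case True
    then have "hitp (d - 2) (Suc k) (?z x) = 1" by (simp only: hit.simps if_True simp_thms)
    then show ?thesis using hit_bounds(2)[of 1 d ?Q "Suc k" x] d by (simp only:)
  next
    case False
    have "\<not> ?Q x"
    proof
      assume Q: "?Q x"
      have "?z x l = 0" for l
      proof (cases "l < d - 2")
        case l: True
        then have "\<tau> l \<in> {..<d} - {i, j}" using \<tau> by (auto simp: bij_betw_def)
        then have "int N dvd \<bar>?z x l\<bar>" using Q l by (auto simp: transversal_def)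
        then show ?thesis using Suc.prems[of l] zdvd_not_zless[of "\<bar>?z x l\<bar>" "int N"] by fastforce
      qed (simp add: transversal_def)
      then show False using False by (auto simp: fun_eq_iff)
    qed
    then have "hit d 1 ?Q (Suc k) x = avg d (hit d 1 ?Q k) x" by (simp only: hit.simps if_False mult_1)
    also have "\<dots> \<le> avg d (\<lambda>x. hitp (d - 2) k (?z x)) x"
    proof (rule avg_mono, rule Suc.IH)
      fix e l assume e: "e \<in> unit_steps d"
      have "\<bar>e c\<bar> \<le> 1" for c using e by (auto simp: unit_steps_def basis_vec_def)
      then have "\<bar>?z (x + e) l\<bar> \<le> \<bar>?z x l\<bar> + 1"
        unfolding transversal_def
        by (smt (verit) plus_fun_apply)
      then show "\<bar>?z (x + e) l\<bar> + int k < int N" using Suc.prems[of l] by simp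
    qed
    also have "\<dots> = 2 / real d * hitp (d - 2) k (?z x) + (1 - 2 / real d) * avg (d - 2) (hitp (d - 2) k) (?z x)"
      by (rule avg_transversal)
    \<comment> \<open>A step inside the plane uses up time without moving across it; by
      \<open>hit_mono\<close> the longer horizon can only increase the probability.\<close>
    also have "\<dots> \<le> 2 / real d * hitp (d - 2) (Suc k) (?z x) + (1 - 2 / real d) * hitp (d - 2) (Suc k) (?z x)"
    proof (intro add_mono mult_left_mono)
      show "hitp (d - 2) k (?z x) \<le> hitp (d - 2) (Suc k) (?z x)" by (rule hit_mono) (use d in auto)
      show "avg (d - 2) (hitp (d - 2) k) (?z x) \<le> hitp (d - 2) (Suc k) (?z x)"
        using False by (simp only: hit.simps if_False mult_1)
    qed (use d in \<open>auto simp: field_simps\<close>)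
    also have "\<dots> = hitp (d - 2) (Suc k) (?z x)" by (simp only: ring_distribs[symmetric]) simp
    finally show ?thesis .
  qed
qed

end

definition return_rate :: "nat \<Rightarrow> real" where
  "return_rate d = 2 / real d + (1 - 2 / real d) * return_prob (d - 2)"

definition over_plane :: "nat \<Rightarrow> nat \<Rightarrow> nat \<Rightarrow> nat \<Rightarrow> point \<Rightarrow> point \<Rightarrow> bool" where
  "over_plane d N i j y x \<longleftrightarrow> (\<forall>k<d. k \<noteq> i \<longrightarrow> k \<noteq> j \<longrightarrow> int N dvd x k - y k)"

text \<open>A first step inside the plane is an immediate return; otherwise the walk must come back
  across the plane, and within L < N - 1 further steps it cannot do so by winding around the
  torus.\<close>

lemma avg_hit_plane_le:
  assumes ij: "i < j" "j < d" and d: "d \<ge> 3" and L: "L + 1 < N" and x: "over_plane d N i j y x"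
  shows "avg d (hit d 1 (over_plane d N i j y) L) x \<le> return_rate d"
proof -
  have "card ({..<d} - {i, j}) = d - 2" using ij by (subst card_Diff_subset) auto
  then obtain \<tau> where \<tau>: "bij_betw \<tau> {..<d - 2} ({..<d} - {i, j})"
    using finite_same_card_bij[of "{..<d - 2}" "{..<d} - {i, j}"] by auto
  let ?z = "transversal d x \<tau>"
  \<comment> \<open>The plane is recentred at the current point, so that the displacement starts at
    0 and is at most 1 after the first step.\<close>
  have Q: "over_plane d N i j y = (\<lambda>x'. \<forall>k<d. k \<noteq> i \<longrightarrow> k \<noteq> j \<longrightarrow> int N dvd x' k - x k)"
  proof (rule ext)
    fix x'
    have "int N dvd x' k - y k \<longleftrightarrow> int N dvd x' k - x k" if "int N dvd x k - y k" for k
    proof -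
      have "x' k - y k = (x' k - x k) + (x k - y k)" by simp
      then show ?thesis using that by (metis dvd_add_left_iff)
    qed
    then show "over_plane d N i j y x' = (\<forall>k<d. k \<noteq> i \<longrightarrow> k \<noteq> j \<longrightarrow> int N dvd x' k - x k)"
      using x unfolding over_plane_def by blast
  qed
  have z0: "?z x = 0" by (simp add: transversal_def[OF ij \<tau>] fun_eq_iff)
  have "avg d (hit d 1 (over_plane d N i j y) L) x \<le> avg d (\<lambda>x. hitp (d - 2) L (?z x)) x"
    unfolding Q
  proof (rule avg_mono, rule hit_plane_le_hitp[OF ij \<tau> d])
    fix e l assume e: "e \<in> unit_steps d"
    have "\<bar>e c\<bar> \<le> 1" for c using e by (auto simp: unit_steps_def basis_vec_def)
    then have "\<bar>?z (x + e) l\<bar> \<le> 1" by (auto simp: transversal_def[OF ij \<tau>])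
    then show "\<bar>?z (x + e) l\<bar> + int L < int N" using L by simp
  qed
  also have "\<dots> = 2 / real d * hitp (d - 2) L 0 + (1 - 2 / real d) * avg (d - 2) (hitp (d - 2) L) 0"
    unfolding avg_transversal[OF ij \<tau>] z0 by (rule refl)
  also have "\<dots> \<le> 2 / real d * 1 + (1 - 2 / real d) * return_prob (d - 2)"
    by (intro add_mono mult_left_mono hit_bounds avg_hitp_le_return_prob) (use d in \<open>auto simp: field_simps\<close>)
  finally show ?thesis by (simp add: return_rate_def)
qed

lemma avg_funpow: "avg d ((avg d ^^ n) f) x = (avg d ^^ Suc n) f x"
  by simp

lemma hit_killed_le_sum:
  assumes q: "0 \<le> q" "q \<le> 1"
  shows "hit d q Q k x \<le> (\<Sum>n\<le>k. q ^ n * (avg d ^^ n) (\<lambda>x. of_bool (Q x)) x)"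
proof (induction k arbitrary: x)
  case (Suc k)
  let ?f = "\<lambda>n. (avg d ^^ n) (\<lambda>x. of_bool (Q x) :: real)"
  have nonneg: "?f n x \<ge> 0" for n x
    using funpow_avg_mono[where f = "\<lambda>_. 0" and g = "\<lambda>x. of_bool (Q x)" and d = d and n = n and x = x]
    unfolding funpow_avg_const_0 by simp
  show ?case
  proof (cases "Q x")
    case True
    have "1 = q ^ 0 * ?f 0 x" using True by simp
    also have "\<dots> \<le> (\<Sum>n\<le>Suc k. q ^ n * ?f n x)"
      by (rule member_le_sum) (use q nonneg in auto)
    finally show ?thesis using True by simp
  next
    case False
    have "hit d q Q (Suc k) x = q * avg d (hit d q Q k) x" using False by simp
    also have "\<dots> \<le> q * avg d (\<lambda>x. \<Sum>n\<le>k. q ^ n * ?f n x) x"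
      by (intro mult_left_mono avg_mono Suc q)
    also have "\<dots> = (\<Sum>n\<le>k. q ^ Suc n * ?f (Suc n) x)"
      unfolding avg_sum avg_cmult avg_funpow by (simp add: sum_distrib_left mult.assoc)
    also have "\<dots> \<le> q ^ 0 * ?f 0 x + \<dots>" by simp
    also have "\<dots> = (\<Sum>n\<le>Suc k. q ^ n * ?f n x)" by (subst sum.atMost_Suc_shift) simp
    finally show ?thesis .
  qed
qed simp

text \<open>Hits up to time L are charged to the larger set \<open>Q\<close> and the unkilled walk;
  later hits are charged by a union bound over time, where the survival weights q^n keep the sum
  bounded in k when q < 1.\<close>

lemma hit_killed_le:
  assumes q: "0 \<le> q" "q \<le> 1" and d: "d \<ge> 1" and AQ: "\<And>x. A x \<Longrightarrow> Q x"
  shows "hit d q A k x \<le> hit d 1 Q L x + (\<Sum>n\<in>{L<..k}. q ^ n * (avg d ^^ n) (\<lambda>x. of_bool (A x)) x)"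
proof (induction k arbitrary: x L)
  case 0
  then show ?case using hit_bounds[of 1 d Q L x] d AQ by (cases L) (auto simp: of_bool_def)
next
  case (Suc k)
  let ?f = "\<lambda>n. (avg d ^^ n) (\<lambda>x. of_bool (A x) :: real)"
  have nonneg: "?f n x \<ge> 0" for n x
    using funpow_avg_mono[where f = "\<lambda>_. 0" and g = "\<lambda>x. of_bool (A x)" and d = d and n = n and x = x]
    unfolding funpow_avg_const_0 by simp
  have sum_nonneg: "(\<Sum>n\<in>{L<..Suc k}. q ^ n * ?f n x) \<ge> 0" for L
    by (intro sum_nonneg mult_nonneg_nonneg nonneg) (use q in auto)
  have h1: "hit d q A (Suc k) x \<le> 1" by (rule hit_bounds(2)[OF q d])
  show ?case
  proof (cases "Q x")
    case True
    then have "hit d 1 Q L x = 1" by (cases L) auto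
    then show ?thesis using h1 sum_nonneg[of L] by linarith
  next
    case False
    then have nA: "\<not> A x" using AQ by blast
    show ?thesis
    proof (cases L)
      case 0
      have "hit d q A (Suc k) x \<le> (\<Sum>n\<le>Suc k. q ^ n * ?f n x)" by (rule hit_killed_le_sum[OF q])
      also have "\<dots> = (\<Sum>n\<in>{0<..Suc k}. q ^ n * ?f n x)"
        by (rule sum.mono_neutral_right) (use nA in \<open>auto simp: Suc_le_eq\<close>)
      finally show ?thesis using 0 False by simp
    next
      case (Suc L')
      have "hit d q A (Suc k) x = q * avg d (hit d q A k) x" using nA by simp
      also have "\<dots> \<le> q * avg d (\<lambda>x. hit d 1 Q L' x + (\<Sum>n\<in>{L'<..k}. q ^ n * ?f n x)) x"
        by (intro mult_left_mono avg_mono Suc.IH q)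
      also have "\<dots> = q * avg d (hit d 1 Q L') x + (\<Sum>n\<in>{L'<..k}. q ^ Suc n * ?f (Suc n) x)"
        unfolding avg_add avg_sum avg_cmult avg_funpow ring_distribs by (simp add: sum_distrib_left mult.assoc)
      also have "q * avg d (hit d 1 Q L') x \<le> hit d 1 Q L x"
      proof -
        have "0 \<le> avg d (hit d 1 Q L') x" by (intro avg_nonneg hit_bounds(1)) (use d in auto)
        then show ?thesis using q mult_right_mono[of q 1 "avg d (hit d 1 Q L') x"] False Suc by simp
      qed
      also have "(\<Sum>n\<in>{L'<..k}. q ^ Suc n * ?f (Suc n) x) = (\<Sum>n\<in>{L<..Suc k}. q ^ n * ?f n x)"
        by (rule sum.reindex_bij_witness[of _ "\<lambda>n. n - 1" Suc]) (auto simp: Suc)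
      finally show ?thesis by simp
    qed
  qed
qed

lemma proj_eq_imp_congruent: "proj N x = b \<Longrightarrow> congruent_mod d N b x"
  unfolding proj_def congruent_mod_def by (auto simp: minus_mod_eq_mult_div)

lemma sum_geometric_le:
  fixes q :: real
  assumes "0 \<le> q" "q < 1" "finite I"
  shows "(\<Sum>n\<in>I. q ^ n) \<le> 1 / (1 - q)"
proof -
  have "(\<Sum>n\<in>I. q ^ n) \<le> (\<Sum>n. q ^ n)"
    by (rule sum_le_suminf) (use assms in \<open>auto intro: summable_geometric\<close>)
  then show ?thesis using assms by (simp add: suminf_geometric)
qed

text \<open>
  A walk killed at rate \<open>1 - q\<close> that starts on the plane meets \<open>S\<close> again either after a quick return
  to the plane or after having spread out; \<open>T\<close> separates the times at which the heat kernel is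
  bounded by its value at \<open>L\<close> from those at which it is of the order of the uniform distribution.
\<close>

lemma avg_hit_killed_le:
  assumes ij: "i < j" "j < d" and d: "d \<ge> 3" and L: "L + 1 < N" and q: "0 \<le> q" "q < 1"
    and S: "finite S" "\<And>b. b \<in> S \<Longrightarrow> over_plane d N i j y b" and x: "proj N x \<in> S"
  shows "avg d (hit d q (\<lambda>x. proj N x \<in> S) k) x \<le>
     return_rate d + real (card S) * (real T * heat_sup d N L + heat_sup d N T / (1 - q))"
proof -
  have N: "N > 0" using L by simp
  let ?A = "\<lambda>x. proj N x \<in> S"
  let ?Q = "over_plane d N i j y"
  let ?f = "\<lambda>n. (avg d ^^ n) (\<lambda>x. of_bool (?A x) :: real)"
  have AQ: "?Q x" if "?A x" for x
  proof -
    have "over_plane d N i j y (proj N x)" using S(2) that .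
    moreover have "int N dvd x k - y k" if "int N dvd (x k mod int N) - y k" for k
      using that by (metis mod_eq_dvd_iff mod_mod_trivial)
    ultimately show ?thesis unfolding over_plane_def proj_def by blast
  qed
  have f_le: "?f n x \<le> real (card S) * heat_sup d N n" for n x
  proof -
    have "?f n x \<le> (avg d ^^ n) (\<lambda>x. \<Sum>b\<in>S. of_bool (congruent_mod d N b x)) x"
    proof (rule funpow_avg_mono)
      fix x
      show "of_bool (?A x) \<le> (\<Sum>b\<in>S. of_bool (congruent_mod d N b x) :: real)"
      proof (cases "?A x")
        case True
        have "congruent_mod d N (proj N x) x" by (rule proj_eq_imp_congruent) simp
        then have "1 = (of_bool (congruent_mod d N (proj N x) x) :: real)" by simp
        also have "\<dots> \<le> (\<Sum>b\<in>S. of_bool (congruent_mod d N b x))"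
          by (rule member_le_sum) (use True S in auto)
        finally show ?thesis using True by simp
      qed (simp add: sum_nonneg)
    qed
    also have "(avg d ^^ n) (\<lambda>x. \<Sum>b\<in>S. of_bool (congruent_mod d N b x)) x = (\<Sum>b\<in>S. heat d N b n x)"
      unfolding heat_def
    proof (induction n arbitrary: x)
      case (Suc n)
      then have "(avg d ^^ n) (\<lambda>x. \<Sum>b\<in>S. of_bool (congruent_mod d N b x)) =
          (\<lambda>x. \<Sum>b\<in>S. (avg d ^^ n) (\<lambda>x. of_bool (congruent_mod d N b x) :: real) x)" by blast
      then show ?case by (simp only: funpow.simps o_apply avg_sum)
    qed simp
    also have "\<dots> \<le> (\<Sum>b\<in>S. heat_sup d N n)" by (intro sum_mono heat_le_heat_sup N)
    finally show ?thesis by simp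
  qed
  have "avg d (hit d q ?A k) x \<le> avg d (\<lambda>x. hit d 1 ?Q L x + (\<Sum>n\<in>{L<..k}. q ^ n * ?f n x)) x"
    by (intro avg_mono hit_killed_le) (use q d AQ in auto)
  also have "\<dots> = avg d (hit d 1 ?Q L) x + (\<Sum>n\<in>{L<..k}. q ^ n * ?f (Suc n) x)"
    unfolding avg_add avg_sum avg_cmult avg_funpow by simp
  also have "\<dots> \<le> return_rate d + (\<Sum>n\<in>{L<..k}. real (card S) * (q ^ n * heat_sup d N T + of_bool (n < T) * heat_sup d N L))"
  proof (intro add_mono sum_mono)
    show "avg d (hit d 1 ?Q L) x \<le> return_rate d"
      by (rule avg_hit_plane_le[OF ij d L AQ[OF x]])
  next
    fix n assume n: "n \<in> {L<..k}"
    have qn: "0 \<le> q ^ n" "q ^ n \<le> 1" using q by (auto intro: power_le_one)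
    have "q ^ n * heat_sup d N (Suc n) \<le> q ^ n * heat_sup d N T + of_bool (n < T) * heat_sup d N L"
    proof (cases "n < T")
      case True
      have "heat_sup d N (Suc n) \<le> heat_sup d N L" by (rule heat_sup_antimono) (use n in auto)
      then have "q ^ n * heat_sup d N (Suc n) \<le> 1 * heat_sup d N L"
        by (intro mult_mono qn) (auto intro: heat_sup_nonneg)
      then show ?thesis using True qn heat_sup_nonneg[of d N T] by (simp add: add_increasing)
    next
      case False
      have "heat_sup d N (Suc n) \<le> heat_sup d N T" by (rule heat_sup_antimono) (use False in auto)
      then show ?thesis using False qn by (simp add: mult_left_mono)
    qed
    then have "real (card S) * (q ^ n * heat_sup d N (Suc n)) \<le>
        real (card S) * (q ^ n * heat_sup d N T + of_bool (n < T) * heat_sup d N L)"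
      by (intro mult_left_mono) auto
    moreover have "q ^ n * ?f (Suc n) x \<le> q ^ n * (real (card S) * heat_sup d N (Suc n))"
      by (intro mult_left_mono f_le qn)
    ultimately show "q ^ n * ?f (Suc n) x \<le>
        real (card S) * (q ^ n * heat_sup d N T + of_bool (n < T) * heat_sup d N L)"
      by (simp only: mult.left_commute)
  qed
  also have "(\<Sum>n\<in>{L<..k}. real (card S) * (q ^ n * heat_sup d N T + of_bool (n < T) * heat_sup d N L)) =
      real (card S) * ((\<Sum>n\<in>{L<..k}. q ^ n) * heat_sup d N T + (\<Sum>n\<in>{L<..k}. of_bool (n < T)) * heat_sup d N L)"
    unfolding sum_distrib_left[symmetric] sum.distrib sum_distrib_right[symmetric] by (rule refl)
  also have "\<dots> \<le> real (card S) * (1 / (1 - q) * heat_sup d N T + real T * heat_sup d N L)"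
  proof (intro mult_left_mono add_mono mult_right_mono heat_sup_nonneg sum_geometric_le q)
    have "(\<Sum>n\<in>{L<..k}. of_bool (n < T)) = real (card ({L<..k} \<inter> {n. n < T}))"
      by (simp add: of_bool_def sum.If_cases)
    also have "\<dots> \<le> real (card {..<T})" by (intro of_nat_mono card_mono) auto
    finally show "(\<Sum>n\<in>{L<..k}. of_bool (n < T)) \<le> real T" by simp
  qed auto
  finally show ?thesis by (simp add: add.commute)
qed

section \<open>Probability of covering a given set\<close>

definition covered :: "nat \<Rightarrow> nat \<Rightarrow> point set \<Rightarrow> point \<Rightarrow> (nat \<Rightarrow> point) set" where
  "covered N n B x = {\<xi>. \<forall>b\<in>B. \<exists>k\<le>n. proj N (x + (\<Sum>l<k. \<xi> l)) = b}"

lemma covered_sets: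
  assumes "finite B"
  shows "covered N n B x \<in> sets (step_law d)"
proof -
  have "Measurable.pred (step_law d) (\<lambda>\<xi>. \<forall>b\<in>B. \<exists>k\<in>{..n}. proj N (x + (\<Sum>l<k. \<xi> l)) = b)"
    by (intro pred_intros_finite assms pred_intros_countable_bounded pred_position_proj countableI_type)
  then show ?thesis by (simp add: covered_def pred_def Bex_def)
qed

lemma covered_case_nat:
  "{\<xi>. case_nat e \<xi> \<in> covered N (Suc n) B x} = covered N n (B - {proj N x}) (x + e)"
  unfolding covered_def mem_Collect_eq all_le_Suc_shift partial_sum_case_nat
  by (auto simp: add.assoc)

text \<open>
  With \<open>h\<close> the killed hitting probability of \<open>S\<close>, the function \<open>1 + c h\<close> is a supersolution: it
  absorbs a factor \<open>1 / s\<close> at each visit to \<open>S\<close>, at the price of a factor \<open>1 + \<epsilon>\<close> per unit of time.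
\<close>

lemma measure_covered_le:
  assumes d: "d \<ge> 1" and S: "finite S" and q: "0 < q" "q \<le> 1" and s: "0 < s" "s \<le> 1" and c: "0 \<le> c"
    and sup: "\<And>k x. proj N x \<in> S \<Longrightarrow> 1 + c * avg d (hit d q (\<lambda>x. proj N x \<in> S) k) x \<le> s * (1 + c)"
    and B: "B \<subseteq> S"
  shows "measure (step_law d) (covered N n B x) \<le>
     s ^ card B * (1 + c * (1 / q - 1)) ^ Suc n * (1 + c * hit d q (\<lambda>x. proj N x \<in> S) n x)"
proof -
  interpret prob_space "step_law d" by (rule prob_space_step_law)
  let ?h = "hit d q (\<lambda>x. proj N x \<in> S)"
  define \<epsilon> where "\<epsilon> = c * (1 / q - 1)"
  have \<epsilon>: "\<epsilon> \<ge> 0" unfolding \<epsilon>_def using q c by (intro mult_nonneg_nonneg) (auto simp: field_simps)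
  have h: "0 \<le> ?h k x" "?h k x \<le> 1" for k x by (rule hit_bounds; use q d in auto)+
  have pos: "0 \<le> 1 + c * ?h k x" for k x using h[of k x] c by (intro add_nonneg_nonneg mult_nonneg_nonneg) auto
  have "measure (step_law d) (covered N n B x) \<le> s ^ card B * (1 + \<epsilon>) ^ Suc n * (1 + c * ?h n x)"
    using B
  proof (induction n arbitrary: B x)
    case (0 B x)
    consider "B = {}" | "B = {proj N x}" | b where "b \<in> B" "b \<noteq> proj N x" by blast
    then show ?case
    proof cases
      case 1
      have "1 * 1 \<le> (1 + \<epsilon>) * (1 + c * ?h 0 x)"
        using \<epsilon> h[of 0 x] c by (intro mult_mono) auto
      then have "prob (covered N 0 B x) \<le> (1 + \<epsilon>) * (1 + c * ?h 0 x)"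
        using prob_le_1[of "covered N 0 B x"] by linarith
      then show ?thesis using 1 by simp
    next
      case 2
      then have A: "proj N x \<in> S" using 0 by simp
      have "1 \<le> 1 + c * avg d (?h 0) x" using c h(1) by (simp add: avg_nonneg)
      also have "\<dots> \<le> s * (1 + c)" by (rule sup[OF A])
      finally have "1 * 1 \<le> (s * (1 + c)) * (1 + \<epsilon>)" using \<epsilon> by (intro mult_mono) auto
      then have "prob (covered N 0 B x) \<le> (s * (1 + c)) * (1 + \<epsilon>)"
        using prob_le_1[of "covered N 0 B x"] by linarith
      then show ?thesis using 2 A by (simp add: mult_ac)
    next
      case 3
      then have "covered N 0 B x = {}" by (auto simp: covered_def)
      then show ?thesis using s \<epsilon> pos[of 0 x] by simp
    qed
  next
    case (Suc n B x)
    have finB: "finite B" using Suc.prems S finite_subset by blast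
    let ?B = "B - {proj N x}"
    have "measure (step_law d) (covered N (Suc n) B x) =
        avg d (\<lambda>x. measure (step_law d) (covered N n ?B x)) x"
      unfolding measure_step_law_first_step[OF covered_sets[OF finB] d] covered_case_nat
      by (simp only: avg_def of_nat_mult of_nat_numeral)
    also have "\<dots> \<le> avg d (\<lambda>x. (s ^ card ?B * (1 + \<epsilon>) ^ Suc n) * (1 + c * ?h n x)) x"
      by (intro avg_mono Suc.IH) (use Suc.prems in auto)
    also have "\<dots> = (s ^ card ?B * (1 + \<epsilon>) ^ Suc n) * (1 + c * avg d (?h n) x)"
      unfolding avg_cmult avg_add avg_const[OF d] by simp
    also have "\<dots> \<le> s ^ card B * (1 + \<epsilon>) ^ Suc (Suc n) * (1 + c * ?h (Suc n) x)"
    proof (cases "proj N x \<in> S")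
      case True
      \<comment> \<open>If the site was visited before, \<open>B\<close> loses nothing at this
        visit; the factor s gained from the supersolution is then given away, which s \<le> 1
        permits.\<close>
      have "s ^ Suc (card ?B) \<le> s ^ card B"
        using s card_Diff1_le[of B "proj N x"] finB
        by (intro power_decreasing) (auto simp: card_Diff_singleton_if)
      have "(s ^ card ?B * (1 + \<epsilon>) ^ Suc n) * (1 + c * avg d (?h n) x) \<le>
          (s ^ card ?B * (1 + \<epsilon>) ^ Suc n) * (s * (1 + c))"
        by (intro mult_left_mono sup True) (use s \<epsilon> in auto)
      also have "\<dots> = s ^ Suc (card ?B) * ((1 + \<epsilon>) ^ Suc n * (1 + c))" by (simp add: mult_ac)
      also have "\<dots> \<le> s ^ card B * ((1 + \<epsilon>) ^ Suc (Suc n) * (1 + c))"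
      proof -
        have "(1 + \<epsilon>) ^ Suc n \<le> (1 + \<epsilon>) ^ Suc (Suc n)" by (rule power_increasing) (use \<epsilon> in auto)
        then have "(1 + \<epsilon>) ^ Suc n * (1 + c) \<le> (1 + \<epsilon>) ^ Suc (Suc n) * (1 + c)"
          by (rule mult_right_mono) (use c in auto)
        then show ?thesis
          by (rule mult_mono[OF \<open>s ^ Suc (card ?B) \<le> s ^ card B\<close>]) (use s \<epsilon> c in auto)
      qed
      finally show ?thesis using True by (simp add: mult_ac)
    next
      case False
      then have "?B = B" using Suc.prems by auto
      \<comment> \<open>Off \<open>S\<close> the function h is harmonic only up to the survival
        factor q; the defect c h (1/q - 1) \<le> \<epsilon> is what the factor 1 + \<epsilon> pays
        for.\<close>
      have "avg d (?h n) x = ?h (Suc n) x / q" using False q by simp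
      then have "1 + c * avg d (?h n) x = 1 + c * ?h (Suc n) x + ?h (Suc n) x * \<epsilon>"
        using q by (simp add: \<epsilon>_def field_simps)
      also have "\<dots> \<le> 1 + c * ?h (Suc n) x + \<epsilon>"
        using mult_right_mono[OF h(2)[of "Suc n" x] \<epsilon>] by linarith
      also have "\<dots> \<le> (1 + \<epsilon>) * (1 + c * ?h (Suc n) x)"
        using mult_nonneg_nonneg[OF \<epsilon> mult_nonneg_nonneg[OF c h(1)[of "Suc n" x]]] by (simp only: ring_distribs mult_1)
      finally have "(s ^ card ?B * (1 + \<epsilon>) ^ Suc n) * (1 + c * avg d (?h n) x) \<le>
          (s ^ card B * (1 + \<epsilon>) ^ Suc n) * ((1 + \<epsilon>) * (1 + c * ?h (Suc n) x))"
        unfolding \<open>?B = B\<close> by (intro mult_left_mono) (use s \<epsilon> in auto)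
      then show ?thesis by (simp only: mult_ac power_Suc)
    qed
    finally show ?case .
  qed
  then show ?thesis unfolding \<epsilon>_def .
qed

text \<open>After N^3 steps the one-coordinate bound t^(-1/3) is of order 1/N, so the heat kernel is
  within a constant of the uniform law. The weaker exponent 1/3 is the reason for N^3 in place of
  the diffusive N^2.\<close>

lemma heat_sup_long_time:
  assumes d: "d \<ge> 1" and N: "N \<ge> 1" "real N ^ 3 \<ge> 2 * real d"
  shows "heat_sup d N (N ^ 3) \<le> (3 + 3 * (2 * real d) powr (1 / 3)) ^ d / real N ^ d"
proof -
  let ?t = "real (N ^ 3) / (2 * real d)"
  have t: "?t \<ge> 1" using assms by (simp add: field_simps)
  have "?t powr (- 1 / 3) = (real N ^ 3) powr (- 1 / 3) / (2 * real d) powr (- 1 / 3)"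
    using assms by (simp add: powr_divide)
  also have "(real N ^ 3) powr (- 1 / 3) = 1 / real N"
    using N by (simp add: powr_powr powr_minus_divide flip: powr_numeral)
  also have "(2 * real d) powr (- 1 / 3) = 1 / (2 * real d) powr (1 / 3)"
    by (simp add: powr_minus_divide)
  finally have *: "?t powr (- 1 / 3) = (2 * real d) powr (1 / 3) / real N" by simp
  have "heat_sup d N (N ^ 3) \<le> gauss_sum N ?t ^ d" by (rule heat_sup_le_gauss_sum[OF d])
  also have "\<dots> \<le> (3 / real N + 3 * ?t powr (- 1 / 3)) ^ d"
    by (intro power_mono gauss_sum_large_time gauss_sum_nonneg N t)
  also have "3 / real N + 3 * ?t powr (- 1 / 3) = (3 + 3 * (2 * real d) powr (1 / 3)) / real N"
    unfolding * by (simp add: add_divide_distrib)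
  finally show ?thesis by (simp add: power_divide)
qed

text \<open>N - 2 is the longest time L with L + 1 < N. There the bound is of order N^(-d/3), at
  most of order N^(-5) for d \<ge> 15; the factor N^4 stands for up to N sites of \<open>S\<close>
  and the N^3 times before mixing.\<close>

lemma heat_sup_short_time:
  assumes d: "d \<ge> 15"
  shows "(\<lambda>N. real N ^ 4 * heat_sup d N (N - 2)) \<longlonglongrightarrow> 0"
proof -
  define K where "K = 3 + 3 * (4 * real d) powr (1 / 3)"
  have K: "K > 0" unfolding K_def by (intro add_pos_nonneg) auto
  have "(\<lambda>N. K * real N powr (- 1 / 3)) \<longlonglongrightarrow> 0" by real_asymp
  then have "eventually (\<lambda>N. K * real N powr (- 1 / 3) < 1) sequentially"
    by (rule order_tendstoD) simp
  then have ev: "eventually (\<lambda>N. real N ^ 4 * heat_sup d N (N - 2) \<le> K ^ 15 / real N) sequentially"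
    using eventually_ge_at_top[of "4 * d"]
  proof eventually_elim
    case (elim N)
    let ?t = "real (N - 2) / (2 * real d)"
    have N: "N \<ge> 60" using elim d by simp
    have tN: "?t \<ge> real N / (4 * real d)" using N d by (simp add: field_simps of_nat_diff)
    moreover have "real N / (4 * real d) \<ge> 1" using elim d by (simp add: field_simps flip: of_nat_mult)
    ultimately have t: "?t \<ge> 1" by linarith
    have "?t powr (- 1 / 3) \<le> (real N / (4 * real d)) powr (- 1 / 3)"
      by (rule powr_mono2') (use tN N d in auto)
    also have "\<dots> = (4 * real d) powr (1 / 3) * real N powr (- 1 / 3)"
      by (simp add: powr_divide powr_minus_divide)
    finally have "gauss_sum N ?t \<le> 3 / real N + 3 * ((4 * real d) powr (1 / 3) * real N powr (- 1 / 3))"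
      using gauss_sum_large_time[of N ?t] N t by linarith
    also have "1 / real N = real N powr (- 1)" using N by (simp add: powr_minus_divide)
    then have "3 / real N \<le> 3 * real N powr (- 1 / 3)"
      using powr_mono[of "- 1" "- 1 / 3" "real N"] N by simp
    finally have g: "gauss_sum N ?t \<le> K * real N powr (- 1 / 3)" by (simp add: K_def ring_distribs)
    have "heat_sup d N (N - 2) \<le> gauss_sum N ?t ^ d" by (rule heat_sup_le_gauss_sum) (use d in simp)
    also have "\<dots> \<le> gauss_sum N ?t ^ 15"
      by (rule power_decreasing) (use d g elim gauss_sum_nonneg in auto)
    also have "\<dots> \<le> (K * real N powr (- 1 / 3)) ^ 15" by (intro power_mono g gauss_sum_nonneg)
    also have "\<dots> = K ^ 15 / real N ^ 5"
    proof -
      have "(real N powr (- 1 / 3)) ^ 15 = (real N powr (- 1 / 3)) powr 15" using N by (simp add: powr_numeral)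
      also have "\<dots> = real N powr (- 5)" by (simp add: powr_powr)
      also have "\<dots> = 1 / real N powr 5" by (rule powr_minus_divide)
      also have "real N powr 5 = real N ^ 5" using N by (subst powr_numeral) auto
      finally show ?thesis by (simp add: power_mult_distrib)
    qed
    finally have "real N ^ 4 * heat_sup d N (N - 2) \<le> real N ^ 4 * (K ^ 15 / real N ^ 5)"
      by (rule mult_left_mono) simp
    also have "\<dots> = K ^ 15 / real N" using N by (simp add: power_numeral_reduce field_simps)
    finally show ?case .
  qed
  show ?thesis
  proof (rule real_tendsto_sandwich[OF _ ev])
    show "eventually (\<lambda>N. 0 \<le> real N ^ 4 * heat_sup d N (N - 2)) sequentially"
      by (intro always_eventually allI mult_nonneg_nonneg heat_sup_nonneg) simp
    show "(\<lambda>N. K ^ 15 / real N) \<longlonglongrightarrow> 0" by real_asymp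
  qed simp
qed

text \<open>The killing rate M |S| / N^d is proportional to |S|: then the late contribution |S| K
  N^(-d), divided by the rate, is K / M whatever |S| is, and the loss over u N^d steps is of the
  form e^(C' u |S|), which merges with s^|S|.\<close>

theorem cover_estimate:
  assumes d: "d \<ge> 15" and s: "return_rate d < s" "s < 1" "0 < s"
  shows "\<exists>C C'. C \<ge> 0 \<and> C' \<ge> 0 \<and> (\<forall>\<^sub>F N in sequentially. \<forall>i j y S u x. i < j \<longrightarrow> j < d \<longrightarrow> finite S \<longrightarrow> S \<noteq> {} \<longrightarrow>
     card S \<le> N \<longrightarrow> (\<forall>b\<in>S. over_plane d N i j y b) \<longrightarrow> 0 \<le> u \<longrightarrow>
     measure (step_law d) (covered N (nat \<lfloor>u * real N ^ d\<rfloor>) S x) \<le> C * (s * exp (C' * u)) ^ card S)"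
proof -
  define g where "g = (s - return_rate d) / 2"
  have g: "g > 0" using s by (simp add: g_def)
  \<comment> \<open>The solution of 1 + c (r + g) = s (1 + c), where r is the return rate. The
    denominator is positive because g is only half of the gap between r and s.\<close>
  define c where "c = (1 - s) / (s - (return_rate d + g))"
  have sg: "s - (return_rate d + g) > 0" using s by (simp add: g_def field_simps)
  have c: "c \<ge> 0" unfolding c_def using s sg by (intro divide_nonneg_nonneg) auto
  have cs: "1 + c * (return_rate d + g) = s * (1 + c)"
    using sg by (simp add: c_def field_simps)
  define K where "K = (3 + 3 * (2 * real d) powr (1 / 3)) ^ d"
  have K: "K \<ge> 0" unfolding K_def by (intro zero_le_power add_nonneg_nonneg) auto
  \<comment> \<open>Late returns then contribute at most K / M \<le> g / 2; the early ones stay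
    below the other g / 2 once N is large.\<close>
  define M where "M = 2 * K / g + 1"
  have M: "M \<ge> 1" using K g by (simp add: M_def)
  have KM: "K / M \<le> g / 2" using K g M by (simp add: M_def field_simps)
  show ?thesis
  proof (rule exI[of _ "exp 1 * (1 + c)"], rule exI[of _ "2 * c * M"], intro conjI)
    show "0 \<le> exp 1 * (1 + c)" "0 \<le> 2 * c * M" using c M by auto
    have e1: "\<forall>\<^sub>F N in sequentially. real N ^ 4 * heat_sup d N (N - 2) < g / 2"
      using order_tendstoD(2)[OF heat_sup_short_time[OF d], of "g / 2"] g by simp
    have e2: "\<forall>\<^sub>F N in sequentially. real N \<ge> max (2 * M) (2 * c * M)"
      using filterlim_real_sequentially by (rule filterlim_at_top[THEN iffD1, rule_format])
    have e3: "\<forall>\<^sub>F N in sequentially. N \<ge> 2 * d" by (rule eventually_ge_at_top)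
    show "\<forall>\<^sub>F N in sequentially. \<forall>i j y S u x. i < j \<longrightarrow> j < d \<longrightarrow> finite S \<longrightarrow> S \<noteq> {} \<longrightarrow>
       card S \<le> N \<longrightarrow> (\<forall>b\<in>S. over_plane d N i j y b) \<longrightarrow> 0 \<le> u \<longrightarrow>
       measure (step_law d) (covered N (nat \<lfloor>u * real N ^ d\<rfloor>) S x) \<le>
         exp 1 * (1 + c) * (s * exp (2 * c * M * u)) ^ card S"
      using e1 e2 e3
    proof eventually_elim
      case (elim N)
      show ?case
      proof (intro allI impI)
        fix i j y S and u :: real and x :: point
        assume ij: "i < j" "j < d" and S: "finite S" "S \<noteq> {}" "card S \<le> N"
          "\<forall>b\<in>S. over_plane d N i j y b" and u: "0 \<le> u"
        have N: "N \<ge> 30" using elim(3) d by simp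
        define n where "n = nat \<lfloor>u * real N ^ d\<rfloor>"
        have cS: "1 \<le> real (card S)" "real (card S) \<le> real N" using S by (auto simp: Suc_le_eq card_gt_0_iff)
        have Nd: "real N ^ 2 \<le> real N ^ d" using N d by (intro power_increasing) auto
        define \<delta> where "\<delta> = M * real (card S) / real N ^ d"
        have \<delta>0: "\<delta> > 0" unfolding \<delta>_def using M cS N by (intro divide_pos_pos mult_pos_pos) auto
        have small: "a * real (card S) / real N ^ d \<le> a / real N" if "a \<ge> 0" for a
        proof -
          have "a * real (card S) / real N ^ d \<le> a * real N / real N ^ 2"
            using that cS Nd N by (intro frac_le mult_left_mono) auto
          also have "\<dots> = a / real N" by (simp add: power2_eq_square)
          finally show ?thesis .
        qed
        have "\<delta> \<le> M / real N" unfolding \<delta>_def using M by (intro small) auto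
        also have "\<dots> \<le> 1 / 2" using elim(2) N by (simp add: field_simps)
        finally have \<delta>1: "\<delta> \<le> 1 / 2" .
        define q where "q = 1 - \<delta>"
        have q: "0 < q" "q < 1" using \<delta>0 \<delta>1 by (auto simp: q_def)
        have sup: "1 + c * avg d (hit d q (\<lambda>x. proj N x \<in> S) k) x \<le> s * (1 + c)" if x: "proj N x \<in> S" for k x
        proof -
          have "avg d (hit d q (\<lambda>x. proj N x \<in> S) k) x \<le>
             return_rate d + real (card S) * (real (N ^ 3) * heat_sup d N (N - 2) + heat_sup d N (N ^ 3) / (1 - q))"
            by (rule avg_hit_killed_le[OF ij, where y = y]) (use d N q S x in auto)
          also have "\<dots> = return_rate d + (real (card S) * real N ^ 3 * heat_sup d N (N - 2) +
              real (card S) * heat_sup d N (N ^ 3) / \<delta>)" by (simp add: q_def field_simps)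
          also have "\<dots> \<le> return_rate d + (g / 2 + g / 2)"
          proof (intro add_mono order_refl)
            have "real (card S) * real N ^ 3 * heat_sup d N (N - 2) \<le> real N * real N ^ 3 * heat_sup d N (N - 2)"
              using cS by (intro mult_right_mono heat_sup_nonneg) auto
            also have "\<dots> = real N ^ 4 * heat_sup d N (N - 2)" by (simp add: power_numeral_reduce)
            finally show "real (card S) * real N ^ 3 * heat_sup d N (N - 2) \<le> g / 2" using elim(1) by simp
            have "2 * real d \<le> real N" using elim(3) by (simp flip: of_nat_mult)
            also have "real N ^ 1 \<le> real N ^ 3" using N by (intro power_increasing) auto
            finally have "heat_sup d N (N ^ 3) \<le> K / real N ^ d"
              unfolding K_def using d N by (intro heat_sup_long_time) auto
            then have "real (card S) * heat_sup d N (N ^ 3) / \<delta> \<le> real (card S) * (K / real N ^ d) / \<delta>"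
              using \<delta>0 cS by (intro divide_right_mono mult_left_mono) auto
            also have "\<dots> = K / M" using cS N M by (simp add: \<delta>_def field_simps)
            also note KM
            finally show "real (card S) * heat_sup d N (N ^ 3) / \<delta> \<le> g / 2" .
          qed
          finally have "avg d (hit d q (\<lambda>x. proj N x \<in> S) k) x \<le> return_rate d + g" by simp
          then have "1 + c * avg d (hit d q (\<lambda>x. proj N x \<in> S) k) x \<le> 1 + c * (return_rate d + g)"
            using c by (intro add_left_mono mult_left_mono)
          then show ?thesis by (simp only: cs)
        qed
        have "measure (step_law d) (covered N n S x) \<le>
          s ^ card S * (1 + c * (1 / q - 1)) ^ Suc n * (1 + c * hit d q (\<lambda>x. proj N x \<in> S) n x)"
          by (rule measure_covered_le) (use d S q s c sup in auto)
        also have "\<dots> \<le> s ^ card S * exp (2 * c * M * u * real (card S) + 1) * (1 + c)"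
        proof -
          have cq: "0 \<le> c * (1 / q - 1)" using c q by (intro mult_nonneg_nonneg) (auto simp: field_simps)
          then have cq1: "0 \<le> (1 + c * (1 / q - 1)) ^ Suc n" by (intro zero_le_power) simp
          show ?thesis
          proof (intro mult_mono)
            have "1 / q - 1 \<le> 2 * \<delta>"
              using q \<delta>0 \<delta>1 mult_mono[of \<delta> "1 / 2" \<delta> \<delta>] by (simp add: q_def field_simps)
            then have "c * (1 / q - 1) \<le> c * (2 * \<delta>)" using c by (intro mult_left_mono)
            moreover have "0 \<le> c * (1 / q - 1)" using c q by (intro mult_nonneg_nonneg) (auto simp: field_simps)
            moreover have "1 + c * (2 * \<delta>) \<le> exp (c * (2 * \<delta>))" by (rule exp_ge_add_one_self)
            ultimately have "1 + c * (1 / q - 1) \<le> exp (c * (2 * \<delta>))" "0 \<le> 1 + c * (1 / q - 1)"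
              by linarith+
            then have "(1 + c * (1 / q - 1)) ^ Suc n \<le> exp (c * (2 * \<delta>)) ^ Suc n"
              by (rule power_mono)
            also have "\<dots> = exp (real (Suc n) * (c * (2 * \<delta>)))" by (rule exp_of_nat_mult[symmetric])
            also have "\<dots> \<le> exp (2 * c * M * u * real (card S) + 1)"
            proof (subst exp_le_cancel_iff)
              \<comment> \<open>The additional step in \<open>Suc n\<close> adds at most 1 to the
                exponent for large N; this is the factor \<open>exp 1\<close> in the
                constant.\<close>
              have "real (Suc n) \<le> u * real N ^ d + 1" unfolding n_def using u by (simp add: of_nat_nat)
              then have "real (Suc n) * (c * (2 * \<delta>)) \<le> (u * real N ^ d + 1) * (c * (2 * \<delta>))"
                using c \<delta>0 by (intro mult_right_mono) auto
              also have "\<dots> = 2 * c * M * u * real (card S) + (2 * c * M) * real (card S) / real N ^ d"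
                using N by (simp add: \<delta>_def field_simps)
              also have "(2 * c * M) * real (card S) / real N ^ d \<le> (2 * c * M) / real N"
                using c M by (intro small) auto
              also have "\<dots> \<le> 1" using elim(2) N by (simp add: field_simps)
              finally show "real (Suc n) * (c * (2 * \<delta>)) \<le> 2 * c * M * u * real (card S) + 1" by simp
            qed
            finally show "(1 + c * (1 / q - 1)) ^ Suc n \<le> exp (2 * c * M * u * real (card S) + 1)" .
            have "hit d q (\<lambda>x. proj N x \<in> S) n x \<le> 1" by (rule hit_bounds(2)) (use q d in auto)
            then show "1 + c * hit d q (\<lambda>x. proj N x \<in> S) n x \<le> 1 + c"
              using c mult_left_mono[of _ 1 c] by fastforce
            show "0 \<le> 1 + c * hit d q (\<lambda>x. proj N x \<in> S) n x"
              using c hit_bounds(1)[of q d "\<lambda>x. proj N x \<in> S" n x] q d by simp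
          qed (use s cq1 in simp_all)
        qed
        also have "\<dots> = exp 1 * (1 + c) * (s * exp (2 * c * M * u)) ^ card S"
          by (simp add: exp_add power_mult_distrib exp_of_nat2_mult[symmetric] mult_ac)
        finally show "measure (step_law d) (covered N (nat \<lfloor>u * real N ^ d\<rfloor>) S x) \<le>
            exp 1 * (1 + c) * (s * exp (2 * c * M * u)) ^ card S" unfolding n_def .
      qed
    qed
  qed
qed

section \<open>The space of walks on the torus\<close>

lemma torus_eq:
  assumes "N \<ge> 1"
  shows "torus d N = {x. (\<forall>i<d. 0 \<le> x i \<and> x i < int N) \<and> (\<forall>i\<ge>d. x i = 0)}" (is "_ = ?R")
proof
  show "torus d N \<subseteq> ?R" using assms by (auto simp: torus_def proj_def lattice_def)
  show "?R \<subseteq> torus d N"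
  proof
    fix x assume x: "x \<in> ?R"
    have "proj N x = x"
    proof (rule ext)
      fix i show "proj N x i = x i" using x by (cases "i < d") (auto simp: proj_def)
    qed
    moreover have "x \<in> lattice d" using x by (auto simp: lattice_def)
    ultimately show "x \<in> torus d N" unfolding torus_def by (metis imageI)
  qed
qed

lemma card_torus:
  assumes "N \<ge> 1"
  shows "finite (torus d N)" "card (torus d N) = N ^ d"
proof -
  let ?P = "{..<d} \<rightarrow>\<^sub>E {..<N}"
  let ?f = "\<lambda>g i. if i < d then int (g i) else 0"
  have "bij_betw ?f ?P (torus d N)"
  proof (rule bij_betw_byWitness[where f' = "\<lambda>x. \<lambda>i\<in>{..<d}. nat (x i)"])
    show "\<forall>g\<in>?P. (\<lambda>i\<in>{..<d}. nat (?f g i)) = g"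
    proof
      fix g assume "g \<in> ?P"
      then show "(\<lambda>i\<in>{..<d}. nat (?f g i)) = g"
        by (intro ext) (auto simp: PiE_def extensional_def)
    qed
    show "\<forall>x\<in>torus d N. ?f (\<lambda>i\<in>{..<d}. nat (x i)) = x"
      by (auto simp: torus_eq[OF assms] fun_eq_iff)
    show "?f ` ?P \<subseteq> torus d N"
    proof (rule image_subsetI)
      fix g assume "g \<in> ?P"
      then have "g i < N" if "i < d" for i using that by (auto simp: PiE_def)
      then show "?f g \<in> torus d N" by (simp add: torus_eq[OF assms])
    qed
    show "(\<lambda>x. \<lambda>i\<in>{..<d}. nat (x i)) ` torus d N \<subseteq> ?P"
    proof (rule image_subsetI)
      fix x assume "x \<in> torus d N"
      then have "nat (x i) < N" if "i < d" for i
        using that assms by (simp add: torus_eq[OF assms] nat_less_iff)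
      then show "(\<lambda>i\<in>{..<d}. nat (x i)) \<in> ?P" by (intro PiE_I) simp_all
    qed
  qed
  note bij = this
  have "finite ?P" "card ?P = N ^ d" by (simp_all add: card_PiE finite_PiE)
  then show "finite (torus d N)" "card (torus d N) = N ^ d"
    using bij_betw_finite[OF bij] bij_betw_same_card[OF bij] by simp_all
qed

lemma torus_nonempty: "torus d N \<noteq> {}"
  by (auto simp: torus_def lattice_def)

lemma space_walk_space [simp]: "space (walk_space d N) = UNIV"
  by (simp add: walk_space_def space_pair_measure)

lemma prob_space_walk_space: "prob_space (walk_space d N)"
proof -
  interpret M: prob_space "measure_pmf (pmf_of_set (torus d N))" by (rule prob_space_measure_pmf)
  interpret S: prob_space "step_law d" by (rule prob_space_step_law)
  interpret pair_prob_space "measure_pmf (pmf_of_set (torus d N))" "step_law d" ..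
  show ?thesis unfolding walk_space_def by unfold_locales
qed

lemma pred_walk: "Measurable.pred (walk_space d N) (\<lambda>\<omega>. walk N n \<omega> = b)"
proof -
  have fst: "(\<lambda>\<omega>. fst \<omega> i) \<in> walk_space d N \<rightarrow>\<^sub>M count_space UNIV" for i
    unfolding walk_space_def by (rule measurable_compose[OF measurable_fst]) simp
  have snd: "(\<lambda>\<omega>. snd \<omega> k i) \<in> walk_space d N \<rightarrow>\<^sub>M count_space UNIV" for k i
    unfolding walk_space_def by (rule measurable_compose[OF measurable_snd measurable_step_coordinate])
  have "Measurable.pred (walk_space d N) (\<lambda>\<omega>. \<forall>i::nat. (fst \<omega> i + (\<Sum>k<n. snd \<omega> k i)) mod int N = b i)"
  proof (rule pred_intros_countable)
    fix i
    have "(\<lambda>\<omega>. (\<lambda>c \<omega>. (fst \<omega> i + c) mod int N = b i) (\<Sum>k<n. snd \<omega> k i) \<omega>) \<in>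
        walk_space d N \<rightarrow>\<^sub>M count_space UNIV"
      by (rule measurable_compose_countable[OF measurable_compose[OF fst] measurable_coordinate_sum[OF snd]]) simp
    then show "Measurable.pred (walk_space d N) (\<lambda>\<omega>. (fst \<omega> i + (\<Sum>k<n. snd \<omega> k i)) mod int N = b i)" by simp
  qed
  then show ?thesis by (simp add: walk_def proj_def fun_eq_iff sum_fun_apply)
qed

lemma visited_eq:
  assumes "t \<ge> 0"
  shows "visited N t \<omega> = (\<lambda>k. walk N k \<omega>) ` {..nat \<lfloor>t\<rfloor>}"
proof -
  have "real n \<le> t \<longleftrightarrow> n \<le> nat \<lfloor>t\<rfloor>" for n using assms by linarith
  then show ?thesis unfolding visited_def by auto
qed

lemma visited_sets:
  assumes "t \<ge> 0"
  shows "{\<omega>. b \<in> visited N t \<omega>} \<in> sets (walk_space d N)"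
proof -
  have "Measurable.pred (walk_space d N) (\<lambda>\<omega>. \<exists>k\<in>{..nat \<lfloor>t\<rfloor>}. walk N k \<omega> = b)"
    by (intro pred_intros_countable_bounded pred_walk countableI_type)
  then show ?thesis
    unfolding visited_eq[OF assms] by (simp add: pred_def image_iff Bex_def eq_commute)
qed

lemma subset_visited_sets:
  assumes "t \<ge> 0" "finite B"
  shows "{\<omega>. B \<subseteq> visited N t \<omega>} \<in> sets (walk_space d N)"
proof (cases "B = {}")
  case False
  have "{\<omega>. B \<subseteq> visited N t \<omega>} = (\<Inter>b\<in>B. {\<omega>. b \<in> visited N t \<omega>})" by auto
  also have "\<dots> \<in> sets (walk_space d N)" by (intro sets.finite_INT visited_sets assms False)
  finally show ?thesis .
next
  case True
  then show ?thesis using sets.top[of "walk_space d N"] by simp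
qed

text \<open>The events considered only depend on the finite set of visited sites of the torus.\<close>

lemma visited_predicate_sets:
  assumes t: "t \<ge> 0" and N: "N \<ge> 1"
  shows "{\<omega>. \<Phi> (visited N t \<omega> \<inter> torus d N)} \<in> sets (walk_space d N)"
proof -
  have fin: "finite (torus d N)" by (rule card_torus[OF N])
  have "{\<omega>. \<Phi> (visited N t \<omega> \<inter> torus d N)} =
      (\<Union>V\<in>{V\<in>Pow (torus d N). \<Phi> V}. {\<omega>. V \<subseteq> visited N t \<omega>} - (\<Union>b\<in>torus d N - V. {\<omega>. b \<in> visited N t \<omega>}))"
    (is "?L = ?R")
  proof
    show "?L \<subseteq> ?R"
    proof
      fix \<omega> assume "\<omega> \<in> ?L"
      then show "\<omega> \<in> ?R" by (intro UN_I[of "visited N t \<omega> \<inter> torus d N"]) auto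
    qed
    show "?R \<subseteq> ?L"
    proof
      fix \<omega> assume "\<omega> \<in> ?R"
      then obtain V where V: "V \<subseteq> torus d N" "\<Phi> V" "V \<subseteq> visited N t \<omega>"
        "\<forall>b\<in>torus d N - V. b \<notin> visited N t \<omega>" by auto
      then have "visited N t \<omega> \<inter> torus d N = V" by auto
      then show "\<omega> \<in> ?L" using V by simp
    qed
  qed
  also have "?R \<in> sets (walk_space d N)"
    by (intro sets.finite_UN sets.Diff visited_sets subset_visited_sets t) (use fin finite_subset in auto)
  finally show ?thesis .
qed

lemma measure_walk_space:
  assumes E: "E \<in> sets (walk_space d N)" and N: "N \<ge> 1"
  shows "measure (walk_space d N) E = (\<Sum>x\<in>torus d N. measure (step_law d) {\<xi>. (x, \<xi>) \<in> E}) / real N ^ d"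
proof -
  interpret P: prob_space "walk_space d N" by (rule prob_space_walk_space)
  interpret S: prob_space "step_law d" by (rule prob_space_step_law)
  have "emeasure (walk_space d N) E =
      (\<integral>\<^sup>+ x. emeasure (step_law d) (Pair x -` E) \<partial>measure_pmf (pmf_of_set (torus d N)))"
    using E unfolding walk_space_def by (rule S.emeasure_pair_measure_alt)
  also have "\<dots> = (\<Sum>x\<in>torus d N. emeasure (step_law d) (Pair x -` E)) / card (torus d N)"
    by (rule nn_integral_pmf_of_set[OF torus_nonempty card_torus(1)[OF N]])
  also have "\<dots> = (\<Sum>x\<in>torus d N. ennreal (measure (step_law d) {\<xi>. (x, \<xi>) \<in> E})) / ennreal (real N ^ d)"
    by (simp add: S.emeasure_eq_measure vimage_def card_torus[OF N] ennreal_of_nat_eq_real_of_nat)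
  also have "\<dots> = ennreal ((\<Sum>x\<in>torus d N. measure (step_law d) {\<xi>. (x, \<xi>) \<in> E}) / real N ^ d)"
    using N by (simp add: sum_nonneg divide_ennreal[symmetric])
  finally show ?thesis
    unfolding P.emeasure_eq_measure by (subst (asm) ennreal_inj) (auto intro!: sum_nonneg divide_nonneg_nonneg)
qed

lemma measure_subset_visited_le:
  assumes t: "t \<ge> 0" and N: "N \<ge> 1" and B: "finite B"
    and le: "\<And>x. measure (step_law d) (covered N (nat \<lfloor>t\<rfloor>) B x) \<le> c"
  shows "measure (walk_space d N) {\<omega>. B \<subseteq> visited N t \<omega>} \<le> c"
proof -
  have "{\<xi>. (x, \<xi>) \<in> {\<omega>. B \<subseteq> visited N t \<omega>}} = covered N (nat \<lfloor>t\<rfloor>) B x" for x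
    unfolding visited_eq[OF t] covered_def walk_def by (auto simp: subset_iff image_iff Bex_def eq_commute)
  then have "measure (walk_space d N) {\<omega>. B \<subseteq> visited N t \<omega>} =
      (\<Sum>x\<in>torus d N. measure (step_law d) (covered N (nat \<lfloor>t\<rfloor>) B x)) / real N ^ d"
    by (subst measure_walk_space[OF subset_visited_sets[OF t B] N]) simp
  also have "\<dots> \<le> (\<Sum>x\<in>torus d N. c) / real N ^ d"
    by (intro divide_right_mono sum_mono le) auto
  also have "\<dots> = c" using N by (simp add: card_torus)
  finally show ?thesis .
qed

lemma proj_add_inj:
  assumes N: "N \<ge> 1"
  shows "inj_on (\<lambda>x. proj N (x + v)) (torus d N)"
proof (rule inj_onI)
  fix x y assume x: "x \<in> torus d N" and y: "y \<in> torus d N" and eq: "proj N (x + v) = proj N (y + v)"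
  have "x i = y i" for i
  proof -
    have "(x i + v i) mod int N = (y i + v i) mod int N" using eq by (simp add: proj_def fun_eq_iff)
    then have "x i mod int N = y i mod int N"
      by (metis add_diff_cancel_right' mod_diff_left_eq)
    then show ?thesis using x y by (cases "i < d") (auto simp: torus_eq[OF N])
  qed
  then show "x = y" by (rule ext)
qed

text \<open>The walk is stationary: for fixed steps at most one starting point of the torus leads to
  \<open>b\<close> at time k, so each of the at most t + 1 times contributes at most N^(-d).\<close>

lemma measure_site_visited_le:
  assumes t: "t \<ge> 0" and N: "N \<ge> 1"
  shows "measure (walk_space d N) {\<omega>. b \<in> visited N t \<omega>} \<le> (t + 1) / real N ^ d"
proof -
  interpret P: prob_space "walk_space d N" by (rule prob_space_walk_space)
  interpret S: prob_space "step_law d" by (rule prob_space_step_law)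
  define E where "E = (\<lambda>k. {\<omega>. walk N k \<omega> = b})"
  have E: "E k \<in> sets (walk_space d N)" for k
    using pred_walk[where d = d and N = N and n = k and b = b] by (simp add: E_def pred_def)
  have one: "measure (walk_space d N) (E k) \<le> 1 / real N ^ d" for k
  proof -
    define G where "G = (\<lambda>x. {\<xi>::nat\<Rightarrow>point. proj N (x + (\<Sum>l<k. \<xi> l)) = b})"
    have G: "G x \<in> sets (step_law d)" for x
      using pred_position_proj[where d = d and N = N and x = x and n = k and y = b] by (simp add: G_def pred_def)
    have disj: "disjoint_family_on G (torus d N)"
      unfolding disjoint_family_on_def
    proof (intro ballI impI)
      fix x y assume "x \<in> torus d N" "y \<in> torus d N" "x \<noteq> y"
      then show "G x \<inter> G y = {}" using proj_add_inj[OF N, of _ d] unfolding G_def inj_on_def by blast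
    qed
    have "(\<Sum>x\<in>torus d N. measure (step_law d) (G x)) = measure (step_law d) (\<Union>x\<in>torus d N. G x)"
      by (rule S.finite_measure_finite_Union[symmetric]) (use card_torus(1)[OF N] G disj in auto)
    also have "\<dots> \<le> 1" by (rule S.prob_le_1)
    finally show ?thesis
      unfolding measure_walk_space[OF E N] by (intro divide_right_mono) (auto simp: E_def G_def walk_def)
  qed
  have "{\<omega>. b \<in> visited N t \<omega>} = (\<Union>k\<in>{..nat \<lfloor>t\<rfloor>}. E k)"
    unfolding visited_eq[OF t] E_def by auto
  then have "measure (walk_space d N) {\<omega>. b \<in> visited N t \<omega>} \<le> (\<Sum>k\<in>{..nat \<lfloor>t\<rfloor>}. measure (walk_space d N) (E k))"
    using E by (simp only:) (intro P.finite_measure_subadditive_finite, auto)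
  also have "\<dots> \<le> (\<Sum>k\<in>{..nat \<lfloor>t\<rfloor>}. 1 / real N ^ d)" by (intro sum_mono one)
  also have "\<dots> = (real (nat \<lfloor>t\<rfloor>) + 1) / real N ^ d" by simp
  also have "\<dots> \<le> (t + 1) / real N ^ d" using t by (intro divide_right_mono add_right_mono) auto
  finally show ?thesis .
qed

section \<open>Planar duality\<close>

definition reach :: "('a \<Rightarrow> 'a \<Rightarrow> bool) \<Rightarrow> 'a set \<Rightarrow> 'a \<Rightarrow> 'a \<Rightarrow> bool" where
  "reach R S a b \<longleftrightarrow> a \<in> S \<and> (\<lambda>x y. R x y \<and> y \<in> S)\<^sup>*\<^sup>* a b"

lemma reach_refl: "a \<in> S \<Longrightarrow> reach R S a a"
  by (simp add: reach_def)

lemma reach_step: "reach R S a b \<Longrightarrow> R b c \<Longrightarrow> c \<in> S \<Longrightarrow> reach R S a c"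
  unfolding reach_def by (auto intro: rtranclp.rtrancl_into_rtrancl)

lemma reach_trans: "reach R S a b \<Longrightarrow> reach R S b c \<Longrightarrow> reach R S a c"
  unfolding reach_def by (meson rtranclp_trans)

lemma reach_induct [consumes 1, case_names refl step]:
  assumes "reach R S a b" and "a \<in> S \<Longrightarrow> P a"
    and "\<And>b c. reach R S a b \<Longrightarrow> P b \<Longrightarrow> R b c \<Longrightarrow> c \<in> S \<Longrightarrow> P c"
  shows "P b"
proof -
  from assms(1) have "a \<in> S" "(\<lambda>x y. R x y \<and> y \<in> S)\<^sup>*\<^sup>* a b" by (auto simp: reach_def)
  from this(2) have "reach R S a b \<and> P b"
    by induction (use \<open>a \<in> S\<close> assms(2,3) in \<open>auto intro: reach_refl reach_step\<close>)
  then show ?thesis ..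
qed

lemma reach_in: "reach R S a b \<Longrightarrow> a \<in> S \<and> b \<in> S"
  unfolding reach_def by (auto elim: rtranclp.cases)

lemma reach_map:
  assumes "reach R S a b" "f ` S \<subseteq> T"
    and "\<And>x y. x \<in> S \<Longrightarrow> y \<in> S \<Longrightarrow> R x y \<Longrightarrow> f x = f y \<or> Q (f x) (f y)"
  shows "reach Q T (f a) (f b)"
  using assms(1)
proof (induction rule: reach_induct)
  case refl
  then show ?case using assms(2) by (auto intro: reach_refl)
next
  case (step b c)
  moreover from step have "b \<in> S" by (blast dest: reach_in)
  ultimately show ?case using assms(2) assms(3)[of b c] by (auto intro: reach_step)
qed

lemma reach_mono: "reach R S a b \<Longrightarrow> S \<subseteq> T \<Longrightarrow> reach R T a b"
  using reach_map[where f = id and Q = R] by auto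

lemma reach_sym:
  assumes "symp R" "reach R S a b"
  shows "reach R S b a"
  using assms(2)
proof (induction rule: reach_induct)
  case (step b c)
  then have "reach R S c b"
    using assms(1) reach_in[OF step(1)] by (intro reach_step[OF reach_refl]) (auto dest: sympD)
  then show ?case using step by (blast intro: reach_trans)
qed (rule reach_refl)

definition walk_on :: "('a \<Rightarrow> 'a \<Rightarrow> bool) \<Rightarrow> (nat \<Rightarrow> 'a) \<Rightarrow> nat \<Rightarrow> bool" where
  "walk_on R p n \<longleftrightarrow> (\<forall>t<n. R (p t) (p (Suc t)))"

lemma reach_imp_walk:
  assumes "reach R S a b"
  shows "\<exists>p n. p 0 = a \<and> p n = b \<and> p ` {..n} \<subseteq> S \<and> walk_on R p n"
  using assms
proof (induction rule: reach_induct)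
  case refl
  then show ?case by (intro exI[of _ "\<lambda>_. a"] exI[of _ 0]) (auto simp: walk_on_def)
next
  case (step b c)
  then obtain p n where p: "p 0 = a" "p n = b" "p ` {..n} \<subseteq> S" "walk_on R p n" by blast
  let ?q = "\<lambda>t. if t \<le> n then p t else c"
  have "?q 0 = a" "?q (Suc n) = c" using p by auto
  moreover have "?q ` {..Suc n} \<subseteq> S" using p step by (auto simp: atMost_Suc)
  moreover have "walk_on R ?q (Suc n)"
    using p step by (auto simp: walk_on_def less_Suc_eq)
  ultimately show ?case by (intro exI[of _ ?q] exI[of _ "Suc n"] conjI)
qed

lemma walk_imp_reach:
  assumes "p ` {..n} \<subseteq> S" "walk_on R p n" "i \<le> j" "j \<le> n"
  shows "reach R S (p i) (p j)"
  using assms(3,4)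
proof (induction j)
  case 0
  then show ?case using assms by (auto intro: reach_refl)
next
  case (Suc j)
  show ?case
  proof (cases "i = Suc j")
    case True
    then show ?thesis using assms Suc by (auto intro!: reach_refl)
  next
    case False
    then show ?thesis using Suc assms by (intro reach_step[OF Suc.IH]) (auto simp: walk_on_def)
  qed
qed

text \<open>A walk of least length is self-avoiding, since a repeated site would allow a loop to be
  cut out.\<close>

lemma reach_imp_inj_walk:
  assumes "reach R S a b"
  shows "\<exists>p n. p 0 = a \<and> p n = b \<and> p ` {..n} \<subseteq> S \<and> walk_on R p n \<and> inj_on p {..n}"
proof -
  let ?Q = "\<lambda>n. \<exists>p. p 0 = a \<and> p n = b \<and> p ` {..n} \<subseteq> S \<and> walk_on R p n"
  from reach_imp_walk[OF assms] have ex: "\<exists>n. ?Q n" by blast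
  define n where "n = (LEAST n. ?Q n)"
  have "?Q n" unfolding n_def by (rule LeastI_ex[OF ex])
  then obtain p where p: "p 0 = a" "p n = b" "p ` {..n} \<subseteq> S" "walk_on R p n" by blast
  have "p i \<noteq> p j" if "i < j" "j \<le> n" for i j
  proof
    assume eq: "p i = p j"
    let ?q = "\<lambda>t. if t \<le> i then p t else p (t + (j - i))"
    have q0: "?q 0 = a" using p by simp
    have qn: "?q (n - (j - i)) = b"
    proof (cases "j = n")
      case True
      then have "n - (j - i) = i" using that by simp
      then show ?thesis using eq True p(2) by simp
    next
      case False
      then have "\<not> n - (j - i) \<le> i" "n - (j - i) + (j - i) = n" using that by auto
      then show ?thesis using p(2) by simp
    qed
    have qS: "?q ` {..n - (j - i)} \<subseteq> S"
      using p that by (auto simp: image_subset_iff)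
    have qw: "walk_on R ?q (n - (j - i))"
      unfolding walk_on_def
    proof (intro allI impI)
      fix t assume t: "t < n - (j - i)"
      consider "t < i" | "t = i" | "t > i" by linarith
      then show "R (?q t) (?q (Suc t))"
      proof cases
        case 2
        moreover have "R (p j) (p (Suc j))" using p(4) t that 2 by (auto simp: walk_on_def)
        ultimately show ?thesis using eq that by (simp add: Suc_diff_le)
      next
        case 3
        have "R (p (t + (j - i))) (p (Suc (t + (j - i))))"
          using p(4) t that by (auto simp: walk_on_def)
        then show ?thesis using 3 by simp
      qed (use p that in \<open>auto simp: walk_on_def\<close>)
    qed
    have "?Q (n - (j - i))" by (intro exI[of _ ?q] conjI q0 qn qS qw)
    then have "n \<le> n - (j - i)" unfolding n_def by (rule Least_le)
    then show False using that by linarith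
  qed
  then have "inj_on p {..n}"
    by (intro linorder_inj_onI') auto
  with p show ?thesis by (intro exI[of _ p] exI[of _ n] conjI)
qed

section \<open>Crossing theorems of Hex type\<close>

type_synonym site = "int \<times> int"

definition nn4 :: "site \<Rightarrow> site \<Rightarrow> bool" where
  "nn4 u v \<longleftrightarrow> \<bar>fst u - fst v\<bar> + \<bar>snd u - snd v\<bar> = 1"

definition star8 :: "site \<Rightarrow> site \<Rightarrow> bool" where
  "star8 u v \<longleftrightarrow> u \<noteq> v \<and> \<bar>fst u - fst v\<bar> \<le> 1 \<and> \<bar>snd u - snd v\<bar> \<le> 1"

lemma symp_nn4: "symp nn4"
  by (auto simp: symp_def nn4_def abs_minus_commute)

lemma symp_star8: "symp star8"
  by (auto simp: symp_def star8_def abs_minus_commute)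

text \<open>
  The refined grid has as vertices the sites, the midpoints of edges (closed if an endpoint is) and
  the centres of unit squares (closed if a corner is).  This turns the pair of adjacencies (nearest
  neighbour for open sites, diagonal for closed sites) into the common notion of lying in one cell,
  as needed for Kuhn's lemma.  The classes \<open>D\<close>, open not \<open>D\<close>, \<open>L\<close>, closed not \<open>L\<close> receive the
  labels \<open>(0, 0)\<close>, \<open>(1, 1)\<close>, \<open>(0, 1)\<close>, \<open>(1, 0)\<close>, so that a cell on which both labels vary must
  contain vertices of both open or of both closed classes.
\<close>

lemma hex_labelling:
  fixes W L D :: "nat \<Rightarrow> nat \<Rightarrow> bool"
  assumes P: "P \<ge> 1"
    and star: "\<And>x y x' y'. W x y \<Longrightarrow> W x' y' \<Longrightarrow> x \<le> P \<Longrightarrow> x' \<le> P \<Longrightarrow> y \<le> P \<Longrightarrow> y' \<le> P \<Longrightarrow>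
      x' \<le> x + 1 \<Longrightarrow> x \<le> x' + 1 \<Longrightarrow> y' \<le> y + 1 \<Longrightarrow> y \<le> y' + 1 \<Longrightarrow> L x y \<Longrightarrow> L x' y'"
    and nn: "\<And>x y x' y'. \<not> W x y \<Longrightarrow> \<not> W x' y' \<Longrightarrow> x \<le> P \<Longrightarrow> x' \<le> P \<Longrightarrow> y \<le> P \<Longrightarrow> y' \<le> P \<Longrightarrow>
      x = x' \<and> (y' = y + 1 \<or> y = y' + 1) \<or> y = y' \<and> (x' = x + 1 \<or> x = x' + 1) \<Longrightarrow> D x y \<Longrightarrow> D x' y'"
    and left: "\<And>y. y \<le> P \<Longrightarrow> if W 0 y then L 0 y else D 0 y"
    and right: "\<And>y. y \<le> P \<Longrightarrow> if W P y then \<not> L P y else \<not> D P y"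
    and bottom: "\<And>x. x \<le> P \<Longrightarrow> if W x 0 then \<not> L x 0 else D x 0"
    and top: "\<And>x. x \<le> P \<Longrightarrow> if W x P then L x P else \<not> D x P"
  shows False
proof -
  \<comment> \<open>Vertices of the refined grid carry doubled coordinates: an even coordinate is
    that of a site, an odd one lies halfway between its two roundings. The product has one, two or
    four sites.\<close>
  define corners :: "(nat \<Rightarrow> nat) \<Rightarrow> (nat \<times> nat) set" where
    "corners = (\<lambda>v. {v 0 div 2, (v 0 + 1) div 2} \<times> {v 1 div 2, (v 1 + 1) div 2})"
  define opn where "opn = (\<lambda>v. \<forall>(x, y)\<in>corners v. \<not> W x y)"
  define LL where "LL = (\<lambda>v. \<exists>(x, y)\<in>corners v. W x y \<and> L x y)"
  define label :: "(nat \<Rightarrow> nat) \<Rightarrow> nat \<Rightarrow> nat" where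
    "label = (\<lambda>v i. of_bool (if opn v then \<not> D (v 0 div 2) (v 1 div 2)
        else if i = 0 then \<not> LL v else LL v))"
  have lab: "\<forall>x. (\<forall>i<2. x i \<le> 2 * P) \<longrightarrow> (\<forall>i<2. label x i = 0 \<or> label x i = 1)"
    by (auto simp: label_def)
  have lab0: "\<forall>x. (\<forall>i<2. x i \<le> 2 * P) \<longrightarrow> (\<forall>i<2. x i = 0 \<longrightarrow> label x i = 0)"
  proof (intro allI impI)
    fix x :: "nat \<Rightarrow> nat" and i :: nat
    assume le: "\<forall>i<2. x i \<le> 2 * P" and i: "i < 2" and 0: "x i = 0"
    have le': "x 0 \<le> 2 * P" "x 1 \<le> 2 * P" using le by auto
    consider "i = 0" | "i = 1" using i by linarith
    then show "label x i = 0"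
    proof cases
      case 1
      have b: "if W 0 y then L 0 y else D 0 y" if "y \<in> {x 1 div 2, (x 1 + 1) div 2}" for y
        proof -
        have "y \<le> P" using that le' by auto
        then show ?thesis using left[of y] by simp
      qed
      show ?thesis using 1 0 b[of "x 1 div 2"] b[of "(x 1 + 1) div 2"]
        by (auto simp: label_def opn_def LL_def corners_def split: if_splits)
    next
      case 2
      have b: "if W y 0 then \<not> L y 0 else D y 0" if "y \<in> {x 0 div 2, (x 0 + 1) div 2}" for y
        proof -
        have "y \<le> P" using that le' by auto
        then show ?thesis using bottom[of y] by simp
      qed
      show ?thesis using 2 0 b[of "x 0 div 2"] b[of "(x 0 + 1) div 2"]
        by (auto simp: label_def opn_def LL_def corners_def split: if_splits)
    qed
  qed
  have lab1: "\<forall>x. (\<forall>i<2. x i \<le> 2 * P) \<longrightarrow> (\<forall>i<2. x i = 2 * P \<longrightarrow> label x i = 1)"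
  proof (intro allI impI)
    fix x :: "nat \<Rightarrow> nat" and i :: nat
    assume le: "\<forall>i<2. x i \<le> 2 * P" and i: "i < 2" and 0: "x i = 2 * P"
    have le': "x 0 \<le> 2 * P" "x 1 \<le> 2 * P" using le by auto
    have PP: "2 * P div 2 = P" "(2 * P + 1) div 2 = P" by auto
    consider "i = 0" | "i = 1" using i by linarith
    then show "label x i = 1"
    proof cases
      case 1
      have b: "if W P y then \<not> L P y else \<not> D P y" if "y \<in> {x 1 div 2, (x 1 + 1) div 2}" for y
        proof -
        have "y \<le> P" using that le' by auto
        then show ?thesis using right[of y] by simp
      qed
      show ?thesis using 1 0 b[of "x 1 div 2"] b[of "(x 1 + 1) div 2"]
        by (auto simp: label_def opn_def LL_def corners_def PP split: if_splits)
    next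
      case 2
      have b: "if W y P then L y P else \<not> D y P" if "y \<in> {x 0 div 2, (x 0 + 1) div 2}" for y
        proof -
        have "y \<le> P" using that le' by auto
        then show ?thesis using top[of y] by simp
      qed
      show ?thesis using 2 0 b[of "x 0 div 2"] b[of "(x 0 + 1) div 2"]
        by (auto simp: label_def opn_def LL_def corners_def PP split: if_splits)
    qed
  qed
  obtain q where q: "\<forall>i<2. q i < 2 * P"
    and vary: "\<forall>i<2. \<exists>r s. (\<forall>j<2. q j \<le> r j \<and> r j \<le> q j + 1) \<and>
       (\<forall>j<2. q j \<le> s j \<and> s j \<le> q j + 1) \<and> label r i \<noteq> label s i"
    by (rule kuhn_lemma[OF _ lab lab0 lab1]) (use P in auto)
  define X Y where "X = q 0 div 2" and "Y = q 1 div 2"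
  \<comment> \<open>(gx, gy) is the one site among the four vertices of the cell and a corner of
    each of them, so an open vertex forces it to be open and to share the class
    \<open>D\<close>.\<close>
  define gx gy where "gx = (q 0 + 1) div 2" and "gy = (q 1 + 1) div 2"
  define cell where "cell = {r. \<forall>j<2. q j \<le> r j \<and> r j \<le> q j + 1}"
  have q': "q 0 < 2 * P" "q 1 < 2 * P" using q by auto
  have cellD: "q 0 \<le> r 0" "r 0 \<le> q 0 + 1" "q 1 \<le> r 1" "r 1 \<le> q 1 + 1" if "r \<in> cell" for r
    using that unfolding cell_def by auto
  have XP: "X + 1 \<le> P" "Y + 1 \<le> P" using q' by (auto simp: X_def Y_def)
  have corner_bounds: "X \<le> x \<and> x \<le> X + 1 \<and> Y \<le> y \<and> y \<le> Y + 1"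
    if "r \<in> cell" "(x, y) \<in> corners r" for r x y
    using cellD[OF that(1)] that(2) unfolding corners_def X_def Y_def by auto
  have g_corner: "{r 0 div 2, gx} \<subseteq> {r 0 div 2, (r 0 + 1) div 2}"
    "{r 1 div 2, gy} \<subseteq> {r 1 div 2, (r 1 + 1) div 2}" if "r \<in> cell" for r
  proof -
    have h: "(k + 1) div 2 \<in> {n div 2, (n + 1) div 2}" if "k \<le> n" "n \<le> k + 1" for k n :: nat
      using that by (cases "n = k") auto
    show "{r 0 div 2, gx} \<subseteq> {r 0 div 2, (r 0 + 1) div 2}"
      using h[of "q 0" "r 0"] cellD[OF that] by (simp add: gx_def)
    show "{r 1 div 2, gy} \<subseteq> {r 1 div 2, (r 1 + 1) div 2}"
      using h[of "q 1" "r 1"] cellD[OF that] by (simp add: gy_def)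
  qed
  define dd where "dd = D gx gy"
  define ll where "ll = (\<exists>x y. X \<le> x \<and> x \<le> X + 1 \<and> Y \<le> y \<and> y \<le> Y + 1 \<and> W x y \<and> L x y)"
  have open_class: "D (r 0 div 2) (r 1 div 2) = dd" if r: "r \<in> cell" "opn r" for r
  proof -
    let ?x = "r 0 div 2" and ?y = "r 1 div 2"
    have o: "\<not> W x y" if "x \<in> {?x, gx}" "y \<in> {?y, gy}" for x y
      using r(2) g_corner[OF r(1)] that unfolding opn_def corners_def by blast
    have bd: "?x \<le> P" "?y \<le> P" "gx \<le> P" "gy \<le> P"
      using cellD[OF r(1)] q' by (auto simp: gx_def gy_def)
    have near: "gx = ?x \<or> gx = ?x + 1" "gy = ?y \<or> gy = ?y + 1"
    proof -
      have h: "(n + 1) div 2 = n div 2 \<or> (n + 1) div 2 = n div 2 + 1" for n :: nat by presburger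
      show "gx = ?x \<or> gx = ?x + 1" using g_corner(1)[OF r(1)] h[of "r 0"] by auto
      show "gy = ?y \<or> gy = ?y + 1" using g_corner(2)[OF r(1)] h[of "r 1"] by auto
    qed
    have "D ?x ?y = D gx ?y"
      using near(1) nn[of ?x ?y gx ?y] nn[of gx ?y ?x ?y] o bd by auto
    also have "\<dots> = D gx gy"
      using near(2) nn[of gx ?y gx gy] nn[of gx gy gx ?y] o bd by auto
    finally show ?thesis by (simp add: dd_def)
  qed
  \<comment> \<open>All corners of the cell lie in one unit square, where any two sites are at
    distance at most 1 in both coordinates; hence the closed ones share the class
    \<open>L\<close>.\<close>
  have closed_class: "LL r = ll" if r: "r \<in> cell" "\<not> opn r" for r
  proof
    assume "LL r"
    then show ll using corner_bounds[OF r(1)] unfolding LL_def ll_def by fast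
  next
    assume ll
    then obtain x y where xy: "X \<le> x" "x \<le> X + 1" "Y \<le> y" "y \<le> Y + 1" "W x y" "L x y"
      unfolding ll_def by blast
    from r(2) obtain x' y' where c: "(x', y') \<in> corners r" and W: "W x' y'"
      unfolding opn_def by blast
    note b = corner_bounds[OF r(1) c]
    have "L x' y'"
      by (rule star[OF xy(5) W _ _ _ _ _ _ _ _ xy(6)]) (use xy b XP in auto)
    then show "LL r" unfolding LL_def using c W by blast
  qed
  have l0: "label r 0 = of_bool (if opn r then \<not> dd else \<not> ll)"
    and l1: "label r 1 = of_bool (if opn r then \<not> dd else ll)" if "r \<in> cell" for r
    using open_class[OF that] closed_class[OF that] by (auto simp: label_def)
  \<comment> \<open>For each value of (dd, ll) the labels possible in the cell agree in one
    coordinate, contrary to the cell given by Kuhn's lemma.\<close>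
  have "\<exists>r\<in>cell. \<exists>s\<in>cell. label r i \<noteq> label s i" if "i < 2" for i
    using vary that unfolding cell_def by blast
  from this[of 0] this[of 1] show False
    by (cases dd; cases ll) (auto simp: l0 l1 simp del: One_nat_def split: if_splits)
qed

definition rect :: "int \<Rightarrow> int \<Rightarrow> int \<Rightarrow> int \<Rightarrow> site set" where
  "rect l r b t = {l..r} \<times> {b..t}"

text \<open>The rectangle gets a collar, closed on the left and right and open at the bottom and
  top. \<open>L\<close> and \<open>D\<close> mark what hangs on the left by closed star paths and on
  the bottom by open paths; without crossings neither reaches the opposite side, which
  \<open>hex_labelling\<close> excludes.\<close>

theorem rect_crossing:
  assumes "l \<le> r" "b \<le> t"
  shows "(\<exists>y y'. reach star8 (rect l r b t \<inter> W) (l, y) (r, y')) \<or>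
    (\<exists>x x'. reach nn4 (rect l r b t - W) (x, b) (x', t))"
proof (rule ccontr)
  assume contra: "\<not> ?thesis"
  define R where "R = rect l r b t"
  define P where "P = nat (max (r - l) (t - b)) + 2"
  \<comment> \<open>\<open>hex_labelling\<close> wants a square: the shorter side is padded by
    repeating its last row or column, which preserves both adjacencies up to equality. The offset -1
    leaves index 0 for the collar.\<close>
  define f :: "nat \<Rightarrow> nat \<Rightarrow> site" where
    "f = (\<lambda>X Y. (min (l + int X - 1) r, min (b + int Y - 1) t))"
  have fR: "f X Y \<in> R" if "X \<ge> 1" "Y \<ge> 1" for X Y
    using that assms by (auto simp: f_def R_def rect_def)
  have P: "P \<ge> 2" "int P - 2 \<ge> r - l" "int P - 2 \<ge> t - b" by (auto simp: P_def)
  have f1: "fst (f 1 Y) = l" "snd (f X 1) = b" for X Y using assms by (auto simp: f_def)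
  have fP: "fst (f (P - 1) Y) = r" "snd (f X (P - 1)) = t" for X Y
    using P by (auto simp: f_def of_nat_diff)
  have f_star: "f X Y = f X' Y' \<or> star8 (f X Y) (f X' Y')"
    if "X' \<le> X + 1" "X \<le> X' + 1" "Y' \<le> Y + 1" "Y \<le> Y' + 1" for X X' Y Y'
    using that by (auto simp: f_def star8_def)
  have f_nn: "f X Y = f X' Y' \<or> nn4 (f X Y) (f X' Y')"
    if "X = X' \<and> (Y' = Y + 1 \<or> Y = Y' + 1) \<or> Y = Y' \<and> (X' = X + 1 \<or> X = X' + 1)" for X X' Y Y'
    using that by (auto simp: f_def nn4_def)
  \<comment> \<open>Two boundary conditions meet at each corner and force its state: (0, 0) and (P,
    P) open, (0, P) and (P, 0) closed.\<close>
  define W' where "W' = (\<lambda>X Y. if X = 0 then 0 < Y else if X = P then Y < P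
     else if Y = 0 \<or> Y = P then False else f X Y \<in> W)"
  define L where "L = (\<lambda>X Y. X = 0 \<or> (X < P \<and> (\<exists>y. reach star8 (R \<inter> W) (l, y) (f X Y))))"
  define D where "D = (\<lambda>X Y. Y = 0 \<or> (Y < P \<and> (\<exists>x. reach nn4 (R - W) (x, b) (f X Y))))"
  have noL: "\<not> reach star8 (R \<inter> W) (l, y) (f (P - 1) Y)" for y Y
    using contra fP(1)[of Y] by (metis R_def prod.collapse)
  have noD: "\<not> reach nn4 (R - W) (x, b) (f X (P - 1))" for x X
    using contra fP(2)[of X] by (metis R_def prod.collapse)
  show False
  proof (rule hex_labelling[of P W' L D])
    show "1 \<le> P" using P by simp
  next
    fix X Y X' Y'
    assume W: "W' X Y" "W' X' Y'" and le: "X \<le> P" "X' \<le> P" "Y \<le> P" "Y' \<le> P"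
      and adj: "X' \<le> X + 1" "X \<le> X' + 1" "Y' \<le> Y + 1" "Y \<le> Y' + 1" and L: "L X Y"
    show "L X' Y'"
    proof (cases "X = 0 \<or> X' = 0")
      case True
      show ?thesis
      proof (cases "X' = 0")
        case False
        then have X': "X' = 1" using True adj by auto
        then have w: "f X' Y' \<in> W" "Y' \<ge> 1" using W(2) P by (auto simp: W'_def split: if_splits)
        have "f X' Y' = (l, snd (f X' Y'))" using X' f1(1)[of Y'] by (metis prod.collapse)
        then have "reach star8 (R \<inter> W) (l, snd (f X' Y')) (f X' Y')"
          using w fR[of X' Y'] X' by (auto intro!: reach_refl)
        then show ?thesis using X' P by (auto simp: L_def)
      qed (simp add: L_def)
    next
      case False
      with L obtain y where y: "X < P" "reach star8 (R \<inter> W) (l, y) (f X Y)" by (auto simp: L_def)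
      have "X' \<noteq> P" using noL[of y Y] y adj le by (metis Suc_eq_plus1 diff_Suc_1 le_antisym less_eq_Suc_le)
      with le have X': "X' < P" by simp
      then have w: "f X' Y' \<in> R \<inter> W" using W(2) False fR[of X' Y'] by (auto simp: W'_def split: if_splits)
      have "reach star8 (R \<inter> W) (l, y) (f X' Y')"
        using f_star[OF adj] y(2) w reach_step by metis
      then show ?thesis using X' by (auto simp: L_def)
    qed
  next
    fix X Y X' Y'
    assume W: "\<not> W' X Y" "\<not> W' X' Y'" and le: "X \<le> P" "X' \<le> P" "Y \<le> P" "Y' \<le> P"
      and adj: "X = X' \<and> (Y' = Y + 1 \<or> Y = Y' + 1) \<or> Y = Y' \<and> (X' = X + 1 \<or> X = X' + 1)"
      and D: "D X Y"
    show "D X' Y'"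
    proof (cases "Y = 0 \<or> Y' = 0")
      case True
      show ?thesis
      proof (cases "Y' = 0")
        case False
        then have Y': "Y' = 1" using True adj by auto
        then have w: "f X' Y' \<notin> W" "X' \<ge> 1" using W(2) P by (auto simp: W'_def split: if_splits)
        have "f X' Y' = (fst (f X' Y'), b)" using Y' f1(2)[of X'] by (metis prod.collapse)
        then have "reach nn4 (R - W) (fst (f X' Y'), b) (f X' Y')"
          using w fR[of X' Y'] Y' by (auto intro!: reach_refl)
        then show ?thesis using Y' P by (auto simp: D_def)
      qed (simp add: D_def)
    next
      case False
      with D obtain x where x: "Y < P" "reach nn4 (R - W) (x, b) (f X Y)" by (auto simp: D_def)
      have "Y' \<noteq> P"
      proof
        assume "Y' = P"
        then have "Y = P - 1" using adj x by auto
        then show False using noD x by blast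
      qed
      with le have Y': "Y' < P" by simp
      then have w: "f X' Y' \<in> R - W" using W(2) False fR[of X' Y'] by (auto simp: W'_def split: if_splits)
      have "reach nn4 (R - W) (x, b) (f X' Y')"
        using f_nn[OF adj] x(2) w reach_step by metis
      then show ?thesis using Y' by (auto simp: D_def)
    qed
  qed (use P in \<open>auto simp: W'_def L_def D_def\<close>)
qed

text \<open>The Hex scheme with another collar: closed on the left and bottom except for three open
  sites at the corner, which tie the origin to \<open>D\<close>, and open on the far sides. A closed
  star path joining the two near sides is the obstacle that cuts off the origin.\<close>

theorem quadrant_crossing:
  fixes m :: int
  assumes m: "m \<ge> 0" and "(0, 0) \<notin> W"
  shows "(\<exists>x y. reach star8 (rect 0 m 0 m \<inter> W) (x, 0) (0, y)) \<or>
    (\<exists>z. (fst z = m \<or> snd z = m) \<and> reach nn4 (rect 0 m 0 m - W) (0, 0) z)"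
proof (rule ccontr)
  assume contra: "\<not> ?thesis"
  define R where "R = rect 0 m 0 m"
  define P where "P = nat m + 2"
  define f :: "nat \<Rightarrow> nat \<Rightarrow> site" where "f = (\<lambda>X Y. (int X - 1, int Y - 1))"
  have fR: "f X Y \<in> R" if "0 < X" "0 < Y" "X < P" "Y < P" for X Y
    using that m by (auto simp: f_def R_def rect_def P_def)
  have P: "P \<ge> 2" by (auto simp: P_def)
  have f_star: "f X Y = f X' Y' \<or> star8 (f X Y) (f X' Y')"
    if "X' \<le> X + 1" "X \<le> X' + 1" "Y' \<le> Y + 1" "Y \<le> Y' + 1" for X X' Y Y'
    using that by (auto simp: f_def star8_def)
  have f_nn: "f X Y = f X' Y' \<or> nn4 (f X Y) (f X' Y')"
    if "X = X' \<and> (Y' = Y + 1 \<or> Y = Y' + 1) \<or> Y = Y' \<and> (X' = X + 1 \<or> X = X' + 1)" for X X' Y Y'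
    using that by (auto simp: f_def nn4_def)
  define W' where "W' = (\<lambda>X Y. if X = 0 then 2 \<le> Y else if Y = 0 then 2 \<le> X
     else if X = P \<or> Y = P then False else f X Y \<in> W)"
  define L where "L = (\<lambda>X Y. X = 0 \<or>
     (0 < Y \<and> X < P \<and> Y < P \<and> (\<exists>y. reach star8 (R \<inter> W) (0, y) (f X Y))))"
  define D where "D = (\<lambda>X Y. X < P \<and> Y < P \<and> (X = 0 \<or> Y = 0 \<or> reach nn4 (R - W) (0, 0) (f X Y)))"
  have noL: "\<not> reach star8 (R \<inter> W) (0, y) (f X 1)" for y X
    using contra reach_sym[OF symp_star8] by (fastforce simp: R_def f_def)
  have noD: "X \<noteq> P - 1 \<and> Y \<noteq> P - 1" if "reach nn4 (R - W) (0, 0) (f X Y)" for X Y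
  proof -
    have "fst (f X Y) \<noteq> m \<and> snd (f X Y) \<noteq> m" using contra that unfolding R_def by blast
    then show ?thesis using m by (auto simp: f_def P_def)
  qed
  show False
  proof (rule hex_labelling[of P W' L D])
    show "1 \<le> P" using P by simp
  next
    fix X Y X' Y'
    assume W: "W' X Y" "W' X' Y'" and le: "X \<le> P" "X' \<le> P" "Y \<le> P" "Y' \<le> P"
      and adj: "X' \<le> X + 1" "X \<le> X' + 1" "Y' \<le> Y + 1" "Y \<le> Y' + 1" and L: "L X Y"
    show "L X' Y'"
    proof (cases "X = 0 \<or> X' = 0")
      case True
      show ?thesis
      proof (cases "X' = 0")
        case False
        then have X': "X' = 1" "X = 0" using True adj by auto
        then have w: "f X' Y' \<in> W" "0 < Y'" "Y' < P" using W P adj le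
          by (auto simp: W'_def split: if_splits)
        have "f X' Y' = (0, snd (f X' Y'))" using X' by (simp add: f_def)
        then have "reach star8 (R \<inter> W) (0, snd (f X' Y')) (f X' Y')"
          using w fR[of X' Y'] X' P by (auto intro!: reach_refl)
        then show ?thesis using X' P w by (auto simp: L_def)
      qed (simp add: L_def)
    next
      case False
      with L obtain y where y: "0 < Y" "X < P" "Y < P" "reach star8 (R \<inter> W) (0, y) (f X Y)"
        by (auto simp: L_def)
      have "Y' \<noteq> 0"
      proof
        assume "Y' = 0"
        then have "Y = 1" using adj y by auto
        then show False using noL y by blast
      qed
      then have Y': "0 < Y'" "X' < P" "Y' < P" and w: "f X' Y' \<in> W"
        using W(2) False le by (auto simp: W'_def split: if_splits)
      then have "f X' Y' \<in> R \<inter> W" using False fR[of X' Y'] by auto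
      then have "reach star8 (R \<inter> W) (0, y) (f X' Y')"
        using f_star[OF adj] y(4) reach_step by metis
      then show ?thesis using Y' by (auto simp: L_def)
    qed
  next
    fix X Y X' Y'
    assume W: "\<not> W' X Y" "\<not> W' X' Y'" and le: "X \<le> P" "X' \<le> P" "Y \<le> P" "Y' \<le> P"
      and adj: "X = X' \<and> (Y' = Y + 1 \<or> Y = Y' + 1) \<or> Y = Y' \<and> (X' = X + 1 \<or> X = X' + 1)"
      and D: "D X Y"
    show "D X' Y'"
    proof (cases "X' = 0 \<or> Y' = 0")
      case True
      then show ?thesis using W D adj P by (auto simp: D_def W'_def split: if_splits)
    next
      case pos: False
      show ?thesis
      proof (cases "X = 0 \<or> Y = 0")
        case True
        then have "X' = 1 \<and> Y' = 1" using pos adj W by (auto simp: W'_def split: if_splits)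
        moreover have "(0, 0) \<in> R - W" using assms by (auto simp: R_def rect_def)
        ultimately show ?thesis using P reach_refl[of "(0, 0)" "R - W" nn4] by (auto simp: D_def f_def)
      next
        case False
        then have x: "X < P" "Y < P" "reach nn4 (R - W) (0, 0) (f X Y)" using D by (auto simp: D_def)
        then have X': "X' < P" "Y' < P" using noD[OF x(3)] adj by auto
        then have w: "f X' Y' \<in> R - W" using W(2) pos fR[of X' Y'] by (auto simp: W'_def split: if_splits)
        have "reach nn4 (R - W) (0, 0) (f X' Y')"
          using f_nn[OF adj] x(3) w reach_step by metis
        then show ?thesis using X' by (auto simp: D_def)
      qed
    qed
  qed (use P in \<open>auto simp: W'_def L_def D_def\<close>)
qed

section \<open>Intersection of crossing walks by parity\<close>

lemma even_crossings:
  "even (\<Sum>t<n. of_bool (p t \<in> U \<longleftrightarrow> p (Suc t) \<notin> U) :: nat) \<longleftrightarrow> (p 0 \<in> U \<longleftrightarrow> p n \<in> U)"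
  by (induction n) auto

text \<open>The number of steps of \<open>p\<close> crossing the vertical ray above \<open>(fst v + 1/2, snd v)\<close>.\<close>

definition above :: "(nat \<Rightarrow> site) \<Rightarrow> nat \<Rightarrow> site \<Rightarrow> nat" where
  "above p n v = (\<Sum>t<n. of_bool (snd (p t) > snd v \<and> snd (p (Suc t)) > snd v \<and>
     (fst (p t) \<le> fst v \<longleftrightarrow> \<not> fst (p (Suc t)) \<le> fst v)))"

lemma nn4_cases:
  assumes "nn4 u v"
  obtains "fst v = fst u" "snd v = snd u + 1" | "fst v = fst u" "snd v = snd u - 1"
    | "fst v = fst u + 1" "snd v = snd u" | "fst v = fst u - 1" "snd v = snd u"
  using assms unfolding nn4_def by (cases "fst u = fst v") (auto simp: abs_if split: if_splits)

text \<open>The counts differ only by horizontal steps at height y + 1 between columns x and x + 1,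
  and such a step visits (x, y + 1).\<close>

lemma above_vertical:
  assumes p: "walk_on nn4 p n" and v: "\<And>t. t \<le> n \<Longrightarrow> p t \<noteq> (x, y + 1)"
  shows "above p n (x, y) = above p n (x, y + 1)"
  unfolding above_def
proof (rule sum.cong)
  fix t assume t: "t \<in> {..<n}"
  then have "nn4 (p t) (p (Suc t))" using p by (auto simp: walk_on_def)
  moreover have "p t \<noteq> (x, y + 1)" "p (Suc t) \<noteq> (x, y + 1)" using v t by auto
  ultimately show "of_bool (snd (x, y) < snd (p t) \<and> snd (x, y) < snd (p (Suc t)) \<and>
        (fst (p t) \<le> fst (x, y)) = (\<not> fst (p (Suc t)) \<le> fst (x, y))) =
      (of_bool (snd (x, y + 1) < snd (p t) \<and> snd (x, y + 1) < snd (p (Suc t)) \<and>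
        (fst (p t) \<le> fst (x, y + 1)) = (\<not> fst (p (Suc t)) \<le> fst (x, y + 1))) :: nat)"
    by (elim nn4_cases; cases "p t"; cases "p (Suc t)") auto
qed auto

text \<open>The two counts together count entries into and exits from the half-line above (x + 1,
  y): passage through its lower end is excluded, and both ends of \<open>p\<close> lie off it, so
  the total is even.\<close>

lemma above_horizontal:
  assumes p: "walk_on nn4 p n" and v: "\<And>t. t \<le> n \<Longrightarrow> p t \<noteq> (x + 1, y)"
    and ends: "fst (p 0) < x + 1" "x + 1 < fst (p n)"
  shows "even (above p n (x, y)) \<longleftrightarrow> even (above p n (x + 1, y))"
proof -
  let ?U = "{x + 1} \<times> {y<..}"
  have "(of_bool (p t \<in> ?U \<longleftrightarrow> p (Suc t) \<notin> ?U) :: nat) =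
      of_bool (snd (p t) > y \<and> snd (p (Suc t)) > y \<and> (fst (p t) \<le> x \<longleftrightarrow> \<not> fst (p (Suc t)) \<le> x)) +
      of_bool (snd (p t) > y \<and> snd (p (Suc t)) > y \<and>
        (fst (p t) \<le> x + 1 \<longleftrightarrow> \<not> fst (p (Suc t)) \<le> x + 1))" if t: "t < n" for t
  proof -
    have "nn4 (p t) (p (Suc t))" using p t by (auto simp: walk_on_def)
    moreover have "p t \<noteq> (x + 1, y)" "p (Suc t) \<noteq> (x + 1, y)" using v t by auto
    ultimately show ?thesis
      by (elim nn4_cases; cases "p t"; cases "p (Suc t)") auto
  qed
  then have "(\<Sum>t<n. of_bool (p t \<in> ?U \<longleftrightarrow> p (Suc t) \<notin> ?U) :: nat) =
      above p n (x, y) + above p n (x + 1, y)"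
    unfolding above_def by (simp add: sum.distrib)
  moreover have "even (\<Sum>t<n. of_bool (p t \<in> ?U \<longleftrightarrow> p (Suc t) \<notin> ?U) :: nat)"
    unfolding even_crossings using ends by auto
  ultimately show ?thesis by (metis even_add)
qed

text \<open>If the walks were disjoint, the parity of \<open>above\<close> would be constant along
  \<open>q\<close>. But no part of \<open>p\<close> lies above the top end of \<open>q\<close>,
  whereas all of \<open>p\<close> passes over the bottom end from left to right, crossing an odd
  number of times.\<close>

lemma walks_cross_strict:
  assumes p: "walk_on nn4 p n" and q: "walk_on nn4 q m"
    and pq: "\<And>j. j \<le> m \<Longrightarrow> fst (p 0) < fst (q j) \<and> fst (q j) < fst (p n)"
    and qp: "\<And>t. t \<le> n \<Longrightarrow> snd (q 0) \<le> snd (p t) \<and> snd (p t) \<le> snd (q m)"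
  shows "\<exists>t\<le>n. \<exists>j\<le>m. p t = q j"
proof (rule ccontr)
  assume "\<not> ?thesis"
  then have disj: "p t \<noteq> q j" if "t \<le> n" "j \<le> m" for t j using that by blast
  have inv: "even (above p n (q j)) \<longleftrightarrow> even (above p n (q 0))" if "j \<le> m" for j
    using that
  proof (induction j)
    case (Suc j)
    have nn: "nn4 (q j) (q (Suc j))" using q Suc by (auto simp: walk_on_def)
    obtain x y where xy: "q j = (x, y)" by fastforce
    obtain x' y' where xy': "q (Suc j) = (x', y')" by fastforce
    have d: "\<And>t. t \<le> n \<Longrightarrow> p t \<noteq> (x, y)" "\<And>t. t \<le> n \<Longrightarrow> p t \<noteq> (x', y')"
      using disj[of _ j] disj[of _ "Suc j"] Suc.prems xy xy' by auto
    have e: "fst (p 0) < x" "x < fst (p n)" "fst (p 0) < x'" "x' < fst (p n)"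
      using pq[of j] pq[of "Suc j"] Suc.prems xy xy' by auto
    have "even (above p n (x, y)) \<longleftrightarrow> even (above p n (x', y'))"
      using nn
    proof (cases rule: nn4_cases)
      case 1
      then show ?thesis using above_vertical[OF p, of x y] d xy xy' by auto
    next
      case 2
      then show ?thesis using above_vertical[OF p, of x' y'] d xy xy' by auto
    next
      case 3
      then show ?thesis using above_horizontal[OF p, of x y] d xy xy' e by auto
    next
      case 4
      then show ?thesis using above_horizontal[OF p, of x' y'] d xy xy' e by auto
    qed
    then show ?case using Suc xy xy' by auto
  qed simp
  have "above p n (q m) = 0"
    unfolding above_def
  proof (rule sum.neutral, rule ballI)
    fix t assume "t \<in> {..<n}"
    then have "\<not> snd (q m) < snd (p t)" using qp[of t] by simp
    then show "of_bool (snd (q m) < snd (p t) \<and> snd (q m) < snd (p (Suc t)) \<and>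
       (fst (p t) \<le> fst (q m)) = (\<not> fst (p (Suc t)) \<le> fst (q m))) = (0::nat)" by simp
  qed
  moreover have "odd (above p n (q 0))"
  proof -
    let ?U = "{u. fst u \<le> fst (q 0)}"
    have "(of_bool (p t \<in> ?U \<longleftrightarrow> p (Suc t) \<notin> ?U) :: nat) =
        of_bool (snd (p t) > snd (q 0) \<and> snd (p (Suc t)) > snd (q 0) \<and>
     (fst (p t) \<le> fst (q 0) \<longleftrightarrow> \<not> fst (p (Suc t)) \<le> fst (q 0)))" if t: "t < n" for t
    proof -
      have "nn4 (p t) (p (Suc t))" using p t by (auto simp: walk_on_def)
      moreover have "p t \<noteq> q 0" "p (Suc t) \<noteq> q 0" using disj t by auto
      moreover have "snd (q 0) \<le> snd (p t)" using qp t by auto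
      ultimately show ?thesis
        by (elim nn4_cases; cases "p t"; cases "p (Suc t)"; cases "q 0") auto
    qed
    then have "above p n (q 0) = (\<Sum>t<n. of_bool (p t \<in> ?U \<longleftrightarrow> p (Suc t) \<notin> ?U))"
      unfolding above_def by simp
    then show ?thesis using even_crossings[of p ?U n] pq[of 0] by auto
  qed
  ultimately show False using inv[of m] by simp
qed

text \<open>Weak inequalities become strict when \<open>p\<close> is prolonged outwards by one step
  at each end; the added sites lie outside the columns of \<open>q\<close> and cannot be the meeting
  point.\<close>

lemma walks_cross:
  assumes p: "walk_on nn4 p n" and q: "walk_on nn4 q m"
    and pq: "\<And>j. j \<le> m \<Longrightarrow> fst (p 0) \<le> fst (q j) \<and> fst (q j) \<le> fst (p n)"
    and qp: "\<And>t. t \<le> n \<Longrightarrow> snd (q 0) \<le> snd (p t) \<and> snd (p t) \<le> snd (q m)"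
  shows "\<exists>t\<le>n. \<exists>j\<le>m. p t = q j"
proof -
  define p' where "p' = (\<lambda>t. if t = 0 then (fst (p 0) - 1, snd (p 0))
    else if t \<le> Suc n then p (t - 1) else (fst (p n) + 1, snd (p n)))"
  have "walk_on nn4 p' (n + 2)"
    unfolding walk_on_def
  proof (intro allI impI)
    fix t assume "t < n + 2"
    then consider "t = 0" | "1 \<le> t" "t < Suc n" | "t = Suc n" by linarith
    then show "nn4 (p' t) (p' (Suc t))"
    proof cases
      case 2
      then have "nn4 (p (t - 1)) (p (Suc (t - 1)))" using p[unfolded walk_on_def, rule_format, of "t - 1"] by linarith
      then show ?thesis using 2 by (simp add: p'_def)
    qed (auto simp: p'_def nn4_def)
  qed
  moreover have "fst (p' 0) < fst (q j) \<and> fst (q j) < fst (p' (n + 2))" if "j \<le> m" for j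
    using pq[OF that] by (auto simp: p'_def)
  moreover have "snd (q 0) \<le> snd (p' t) \<and> snd (p' t) \<le> snd (q m)" if "t \<le> n + 2" for t
    using qp[of 0] qp[of n] qp[of "t - 1"] by (auto simp: p'_def)
  ultimately obtain t j where tj: "t \<le> n + 2" "j \<le> m" "p' t = q j"
    using walks_cross_strict[of p' "n + 2" q m] q by blast
  then have "t \<noteq> 0" "t \<le> Suc n" using pq[OF tj(2)] tj
    by (cases "q j"; auto simp: p'_def split: if_splits)+
  then show ?thesis using tj by (intro exI[of _ "t - 1"] conjI exI[of _ j]) (auto simp: p'_def)
qed

section \<open>Uniqueness of long open paths\<close>

lemma reach_swap:
  assumes "reach nn4 S a b"
  shows "reach nn4 (prod.swap -` S) (prod.swap a) (prod.swap b)"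
  by (rule reach_map[OF assms]) (auto simp: nn4_def add.commute)

lemma reach_star8_swap:
  assumes "reach star8 S a b"
  shows "reach star8 (prod.swap -` S) (prod.swap a) (prod.swap b)"
  by (rule reach_map[OF assms]) (auto simp: star8_def prod_eq_iff)

lemma swap_vimage_rect: "prod.swap -` (rect l r b t - W) = rect b t l r - prod.swap -` W"
  by (auto simp: rect_def)

lemma swap_vimage_rect': "prod.swap -` (rect l r b t - prod.swap -` W) = rect b t l r - W"
  by (auto simp: rect_def)

lemma swap_vimage_Compl': "prod.swap -` (- (prod.swap -` W)) = - W"
  by auto

lemma crossings_meet:
  assumes 1: "reach nn4 (rect l1 r1 b1 t1 - W) (l1, y) (r1, y')"
    and 2: "reach nn4 (rect l2 r2 b2 t2 - W) (x, b2) (x', t2)"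
    and le: "l1 \<le> l2" "r2 \<le> r1" "b2 \<le> b1" "t1 \<le> t2"
  shows "reach nn4 (- W) (l1, y) (x, b2)"
proof -
  obtain p n where p: "p 0 = (l1, y)" "p n = (r1, y')" "p ` {..n} \<subseteq> rect l1 r1 b1 t1 - W" "walk_on nn4 p n"
    using reach_imp_walk[OF 1] by blast
  obtain q m where q: "q 0 = (x, b2)" "q m = (x', t2)" "q ` {..m} \<subseteq> rect l2 r2 b2 t2 - W" "walk_on nn4 q m"
    using reach_imp_walk[OF 2] by blast
  have "\<exists>t\<le>n. \<exists>j\<le>m. p t = q j"
  proof (rule walks_cross[OF p(4) q(4)])
    fix j assume "j \<le> m"
    then have "q j \<in> rect l2 r2 b2 t2" using q(3) by auto
    then show "fst (p 0) \<le> fst (q j) \<and> fst (q j) \<le> fst (p n)" using p le by (auto simp: rect_def)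
  next
    fix t assume "t \<le> n"
    then have "p t \<in> rect l1 r1 b1 t1" using p(3) by auto
    then show "snd (q 0) \<le> snd (p t) \<and> snd (p t) \<le> snd (q m)" using q le by (auto simp: rect_def)
  qed
  then obtain t j where tj: "t \<le> n" "j \<le> m" "p t = q j" by blast
  have "reach nn4 (- W) (p 0) (p t)"
    by (rule walk_imp_reach[OF _ p(4)]) (use p(3) tj in auto)
  moreover have "reach nn4 (- W) (q 0) (q j)"
    by (rule walk_imp_reach[OF _ q(4)]) (use q(3) tj in auto)
  ultimately show ?thesis
    using tj p(1) q(1) reach_trans reach_sym[OF symp_nn4] by metis
qed

text \<open>The path may leave the strip, yet it starts on its left side and ends at or beyond its
  right side. Once B is at least every height on the path, a vertical crossing of the strip must
  meet it.\<close>

lemma path_meets_crossings: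
  assumes ab: "reach nn4 (- W) a b" and far: "fst a + m \<le> fst b"
  shows "\<exists>B0. \<forall>B\<ge>B0. \<forall>x x'. reach nn4 (rect (fst a) (fst a + m) (- B) B - W) (x, - B) (x', B) \<longrightarrow>
    reach nn4 (- W) a (x, - B)"
proof -
  obtain p n where p: "p 0 = a" "p n = b" "p ` {..n} \<subseteq> - W" "walk_on nn4 p n"
    using reach_imp_walk[OF ab] by blast
  define B0 where "B0 = Max ((\<lambda>t. \<bar>snd (p t)\<bar>) ` {..n})"
  have B0: "\<bar>snd (p t)\<bar> \<le> B0" if "t \<le> n" for t
    unfolding B0_def using that by (intro Max_ge) auto
  show ?thesis
  proof (intro exI[of _ B0] allI impI)
    fix B x x' assume B: "B0 \<le> B" and 2: "reach nn4 (rect (fst a) (fst a + m) (- B) B - W) (x, - B) (x', B)"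
    obtain q k where q: "q 0 = (x, - B)" "q k = (x', B)"
      "q ` {..k} \<subseteq> rect (fst a) (fst a + m) (- B) B - W" "walk_on nn4 q k"
      using reach_imp_walk[OF 2] by blast
    have "\<exists>t\<le>n. \<exists>j\<le>k. p t = q j"
    proof (rule walks_cross[OF p(4) q(4)])
      fix j assume "j \<le> k"
      then have "q j \<in> rect (fst a) (fst a + m) (- B) B" using q(3) by auto
      then show "fst (p 0) \<le> fst (q j) \<and> fst (q j) \<le> fst (p n)" using p far by (auto simp: rect_def)
    next
      fix t assume "t \<le> n"
      then show "snd (q 0) \<le> snd (p t) \<and> snd (p t) \<le> snd (q k)" using B0[of t] B q by auto
    qed
    then obtain t j where tj: "t \<le> n" "j \<le> k" "p t = q j" by blast
    have "reach nn4 (- W) (p 0) (p t)"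
      by (rule walk_imp_reach[OF _ p(4)]) (use p(3) tj in auto)
    moreover have "reach nn4 (- W) (q 0) (q j)"
      by (rule walk_imp_reach[OF _ q(4)]) (use q(3) tj in auto)
    ultimately show "reach nn4 (- W) a (x, - B)"
      using tj p(1) q(1) reach_trans reach_sym[OF symp_nn4] by metis
  qed
qed

definition short_clusters :: "int \<Rightarrow> site set \<Rightarrow> bool" where
  "short_clusters m W \<longleftrightarrow>
     (\<forall>a b. reach star8 W a b \<longrightarrow> \<bar>fst a - fst b\<bar> < m \<and> \<bar>snd a - snd b\<bar> < m)"

lemma short_clusters_swap:
  assumes "short_clusters m W"
  shows "short_clusters m (prod.swap -` W)"
  unfolding short_clusters_def
proof (intro allI impI)
  fix a b assume "reach star8 (prod.swap -` W) a b"
  from reach_star8_swap[OF this] have "reach star8 W (prod.swap a) (prod.swap b)"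
    by (simp add: vimage_def)
  then show "\<bar>fst a - fst b\<bar> < m \<and> \<bar>snd a - snd b\<bar> < m"
    using assms unfolding short_clusters_def by (metis fst_swap snd_swap)
qed

lemma vertical_crossing:
  assumes W: "short_clusters m W" and m: "0 \<le> m" and "b \<le> t"
  shows "\<exists>x x'. reach nn4 (rect l (l + m) b t - W) (x, b) (x', t)"
proof -
  have "\<not> reach star8 (rect l (l + m) b t \<inter> W) (l, y) (l + m, y')" for y y'
  proof
    assume "reach star8 (rect l (l + m) b t \<inter> W) (l, y) (l + m, y')"
    then have "reach star8 W (l, y) (l + m, y')" by (rule reach_mono) auto
    then show False using W m unfolding short_clusters_def by fastforce
  qed
  then show ?thesis using rect_crossing[of l "l + m" b t W] m assms(3) by auto
qed

text \<open>A finite substitute for belonging to an infinite open cluster: at every large height B,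
  \<open>a\<close> is connected to a vertical open crossing of one fixed strip, represented by its
  lower end.\<close>

definition crosses_strips :: "int \<Rightarrow> site set \<Rightarrow> site \<Rightarrow> bool" where
  "crosses_strips m W a \<longleftrightarrow> (\<exists>l B0. \<forall>B\<ge>B0. \<exists>x x'.
     reach nn4 (rect l (l + m) (- B) B - W) (x, - B) (x', B) \<and> reach nn4 (- W) a (x, - B))"

lemma long_path_crosses_strips:
  assumes W: "short_clusters m W" and m: "0 \<le> m"
    and ab: "reach nn4 (- W) a b" and far: "fst a + m \<le> fst b"
  shows "crosses_strips m W a"
proof -
  obtain B0 where B0: "\<And>B x x'. B \<ge> B0 \<Longrightarrow>
      reach nn4 (rect (fst a) (fst a + m) (- B) B - W) (x, - B) (x', B) \<Longrightarrow> reach nn4 (- W) a (x, - B)"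
    using path_meets_crossings[OF ab far] by blast
  show ?thesis
    unfolding crosses_strips_def
  proof (rule exI[of _ "fst a"], rule exI[of _ "max 0 B0"], intro allI impI)
    fix B assume B: "max 0 B0 \<le> B"
    obtain x x' where "reach nn4 (rect (fst a) (fst a + m) (- B) B - W) (x, - B) (x', B)"
      using vertical_crossing[OF W m, of "- B" B "fst a"] B by auto
    then show "\<exists>x x'. reach nn4 (rect (fst a) (fst a + m) (- B) B - W) (x, - B) (x', B) \<and>
        reach nn4 (- W) a (x, - B)"
      using B0[of B] B by (intro exI[of _ x] exI[of _ x']) auto
  qed
qed

lemma horizontal_crossing:
  assumes W: "short_clusters m W" and m: "0 \<le> m" and "l \<le> r"
  shows "\<exists>y y'. reach nn4 (rect l r b (b + m) - W) (l, y) (r, y')"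
proof -
  obtain x x' where "reach nn4 (rect b (b + m) l r - prod.swap -` W) (x, l) (x', r)"
    using vertical_crossing[OF short_clusters_swap[OF W] m assms(3), of b] by blast
  from reach_swap[OF this] show ?thesis
    unfolding swap_vimage_rect' by auto
qed

text \<open>A vertical crossing meets all horizontal crossings of sufficiently long horizontal strips.\<close>

lemma crosses_strips_swap:
  assumes W: "short_clusters m W" and m: "0 \<le> m" and a: "crosses_strips m W a"
  shows "crosses_strips m (prod.swap -` W) (prod.swap a)"
proof -
  obtain l B0 where B0: "\<And>B. B \<ge> B0 \<Longrightarrow> \<exists>x x'. reach nn4 (rect l (l + m) (- B) B - W) (x, - B) (x', B)
      \<and> reach nn4 (- W) a (x, - B)"
    using a unfolding crosses_strips_def by blast
  show ?thesis
    unfolding crosses_strips_def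
  proof (rule exI[of _ 0], rule exI[of _ "max B0 (\<bar>l\<bar> + m)"], intro allI impI)
    fix B assume B: "max B0 (\<bar>l\<bar> + m) \<le> B"
    then have "- B \<le> B" using m by linarith
    obtain y y' where h: "reach nn4 (rect (- B) B 0 (0 + m) - W) (- B, y) (B, y')"
      using horizontal_crossing[OF W m \<open>- B \<le> B\<close>, of 0] by blast
    obtain x x' where v: "reach nn4 (rect l (l + m) (- B) B - W) (x, - B) (x', B)" "reach nn4 (- W) a (x, - B)"
      using B0[of B] B by auto
    have "reach nn4 (- W) (- B, y) (x, - B)"
      by (rule crossings_meet[OF h v(1)]) (use B m in auto)
    then have "reach nn4 (- W) a (- B, y)"
      using v(2) reach_trans reach_sym[OF symp_nn4] by metis
    from reach_swap[OF this] have "reach nn4 (- (prod.swap -` W)) (prod.swap a) (y, - B)"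
      by (simp add: vimage_Compl)
    moreover from reach_swap[OF h] have "reach nn4 (rect 0 (0 + m) (- B) B - prod.swap -` W) (y, - B) (y', B)"
      by (simp add: swap_vimage_rect)
    ultimately show "\<exists>x x'. reach nn4 (rect 0 (0 + m) (- B) B - prod.swap -` W) (x, - B) (x', B) \<and>
           reach nn4 (- (prod.swap -` W)) (prod.swap a) (x, - B)"
      by (intro exI[of _ y] exI[of _ y'] conjI)
  qed
qed

text \<open>Reflection provides a horizontal strip for \<open>c\<close>. For a common large B the
  vertical crossing tied to \<open>a\<close> and the horizontal one tied to \<open>c\<close> lie
  across each other and meet.\<close>

lemma crosses_strips_unique:
  assumes W: "short_clusters m W" and m: "0 \<le> m" and a: "crosses_strips m W a" and c: "crosses_strips m W c"
  shows "reach nn4 (- W) a c"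
proof -
  obtain l B0 where B0: "\<And>B. B \<ge> B0 \<Longrightarrow> \<exists>x x'. reach nn4 (rect l (l + m) (- B) B - W) (x, - B) (x', B)
      \<and> reach nn4 (- W) a (x, - B)"
    using a unfolding crosses_strips_def by blast
  obtain b C0 where C0: "\<And>B. B \<ge> C0 \<Longrightarrow> \<exists>x x'. reach nn4 (rect b (b + m) (- B) B - prod.swap -` W) (x, - B) (x', B)
      \<and> reach nn4 (- (prod.swap -` W)) (prod.swap c) (x, - B)"
    using crosses_strips_swap[OF W m c] unfolding crosses_strips_def by blast
  define B where "B = Max {B0, C0, \<bar>l\<bar> + m, \<bar>b\<bar> + m}"
  have B: "B \<ge> B0" "B \<ge> C0" "B \<ge> \<bar>l\<bar> + m" "B \<ge> \<bar>b\<bar> + m" unfolding B_def by (intro Max_ge; simp)+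
  obtain x x' where v: "reach nn4 (rect l (l + m) (- B) B - W) (x, - B) (x', B)" "reach nn4 (- W) a (x, - B)"
    using B0[OF B(1)] by blast
  obtain y y' where h': "reach nn4 (rect b (b + m) (- B) B - prod.swap -` W) (y, - B) (y', B)"
      "reach nn4 (- (prod.swap -` W)) (prod.swap c) (y, - B)"
    using C0[OF B(2)] by blast
  have h: "reach nn4 (rect (- B) B b (b + m) - W) (- B, y) (B, y')"
    using reach_swap[OF h'(1)] unfolding swap_vimage_rect' by simp
  have c': "reach nn4 (- W) c (- B, y)"
    using reach_swap[OF h'(2)] unfolding swap_vimage_Compl' by simp
  have "reach nn4 (- W) (- B, y) (x, - B)"
    by (rule crossings_meet[OF h v(1)]) (use B m in auto)
  then show ?thesis
    using v(2) c' reach_trans reach_sym[OF symp_nn4] by metis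
qed

text \<open>A path that spans m in either direction is tied to crossings of arbitrarily tall strips,
  after reflection if the span is vertical. Two such paths are joined at this large scale, however
  far apart they are.\<close>

theorem long_paths_connected:
  assumes W: "short_clusters m W" and m: "0 \<le> m"
    and ab: "reach nn4 (- W) a b" and ab': "\<bar>fst a - fst b\<bar> \<ge> m \<or> \<bar>snd a - snd b\<bar> \<ge> m"
    and cd: "reach nn4 (- W) c d" and cd': "\<bar>fst c - fst d\<bar> \<ge> m \<or> \<bar>snd c - snd d\<bar> \<ge> m"
  shows "reach nn4 (- W) a c"
proof -
  have fsts: "\<exists>a'. reach nn4 (- W) a a' \<and> crosses_strips m W a'"
    if W: "short_clusters m W" and "reach nn4 (- W) a b" "\<bar>fst a - fst b\<bar> \<ge> m" for W a b
  proof (cases "fst a + m \<le> fst b")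
    case True
    then show ?thesis using long_path_crosses_strips[OF W m that(2)] reach_in[OF that(2)]
      by (blast intro: reach_refl)
  next
    case False
    then have "fst b + m \<le> fst a" using that(3) by auto
    then show ?thesis
      using long_path_crosses_strips[OF W m reach_sym[OF symp_nn4 that(2)]] that(2) by blast
  qed
  have cr: "\<exists>a'. reach nn4 (- W) a a' \<and> crosses_strips m W a'"
    if ab: "reach nn4 (- W) a b" and far: "\<bar>fst a - fst b\<bar> \<ge> m \<or> \<bar>snd a - snd b\<bar> \<ge> m" for a b
  proof (cases "\<bar>fst a - fst b\<bar> \<ge> m")
    case False
    note W' = short_clusters_swap[OF W]
    have "reach nn4 (- (prod.swap -` W)) (prod.swap a) (prod.swap b)"
      using reach_swap[OF ab] by (simp add: vimage_Compl)
    then obtain a' where a': "reach nn4 (- (prod.swap -` W)) (prod.swap a) a'"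
        "crosses_strips m (prod.swap -` W) a'"
      using fsts[OF W', of "prod.swap a" "prod.swap b"] False far by auto
    have "crosses_strips m W (prod.swap a')"
      using crosses_strips_swap[OF W' m a'(2)] by (simp add: vimage_def)
    moreover have "reach nn4 (- W) a (prod.swap a')"
      using reach_swap[OF a'(1)] unfolding swap_vimage_Compl' by simp
    ultimately show ?thesis by blast
  qed (use fsts[OF W ab] in blast)
  obtain a' c' where "reach nn4 (- W) a a'" "crosses_strips m W a'" "reach nn4 (- W) c c'" "crosses_strips m W c'"
    using cr[OF ab ab'] cr[OF cd cd'] by blast
  then show ?thesis
    using crosses_strips_unique[OF W m, of a' c'] reach_trans reach_sym[OF symp_nn4] by metis
qed

section \<open>Length and number of star paths\<close>

lemma walk_on_star8_bound:
  assumes "walk_on star8 p n" "i \<le> j" "j \<le> n"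
  shows "\<bar>fst (p i) - fst (p j)\<bar> \<le> int (j - i) \<and> \<bar>snd (p i) - snd (p j)\<bar> \<le> int (j - i)"
  using assms(2,3)
proof (induction j rule: dec_induct)
  case (step k)
  then have "star8 (p k) (p (Suc k))" using assms(1) by (auto simp: walk_on_def)
  then show ?case using step by (auto simp: star8_def Suc_diff_le)
qed simp

text \<open>A star step moves each coordinate by at most 1, so a cluster of span m has a
  self-avoiding path of at least m steps. Cutting it after m steps leaves a single length for the
  union bound.\<close>

lemma short_clustersI:
  assumes "\<And>p. walk_on star8 p m \<Longrightarrow> inj_on p {..m} \<Longrightarrow> \<not> p ` {..m} \<subseteq> W"
  shows "short_clusters (int m) W"
  unfolding short_clusters_def
proof (intro allI impI)
  fix a b assume "reach star8 W a b"
  then obtain p n where p: "p 0 = a" "p n = b" "p ` {..n} \<subseteq> W" "walk_on star8 p n" "inj_on p {..n}"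
    using reach_imp_inj_walk by metis
  have "n < m"
  proof (rule ccontr)
    assume "\<not> n < m"
    then have "walk_on star8 p m" "inj_on p {..m}" "p ` {..m} \<subseteq> W"
      using p by (auto simp: walk_on_def intro: inj_on_subset)
    then show False using assms by blast
  qed
  then show "\<bar>fst a - fst b\<bar> < int m \<and> \<bar>snd a - snd b\<bar> < int m"
    using walk_on_star8_bound[OF p(4), of 0 n] p by auto
qed

text \<open>Ranges instead of paths: a path is a function on all of \<open>nat\<close> with
  arbitrary values beyond n, and the covering events see only the range.\<close>

definition star_ranges :: "nat \<Rightarrow> site \<Rightarrow> site set set" where
  "star_ranges n c = {p ` {..n} | p. p 0 = c \<and> walk_on star8 p n}"

definition star_steps :: "site set" where
  "star_steps = {-1..1} \<times> {-1..1} - {(0, 0)}"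

lemma card_star_steps: "finite star_steps" "card star_steps = 8"
proof -
  show "finite star_steps" by (simp add: star_steps_def)
  show "card star_steps = 8" by (simp add: star_steps_def card_Diff_subset)
qed

lemma card_star_ranges: "finite (star_ranges n c) \<and> card (star_ranges n c) \<le> 8 ^ n"
proof (induction n arbitrary: c)
  case 0
  have "star_ranges 0 c \<subseteq> {{c}}" by (auto simp: star_ranges_def)
  then show ?case using card_mono[of "{{c}}"] finite_subset by fastforce
next
  case (Suc n)
  define f where "f = (\<lambda>e. (fst c + fst e, snd c + snd e) :: site)"
  let ?U = "\<Union>e\<in>star_steps. insert c ` star_ranges n (f e)"
  have sub: "star_ranges (Suc n) c \<subseteq> ?U"
  proof
    fix A assume "A \<in> star_ranges (Suc n) c"
    then obtain p where p: "A = p ` {..Suc n}" "p 0 = c" "walk_on star8 p (Suc n)"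
      by (auto simp: star_ranges_def)
    define e where "e = (fst (p 1) - fst c, snd (p 1) - snd c)"
    have "star8 c (p 1)" using p by (auto simp: walk_on_def)
    then have "e \<in> star_steps" unfolding e_def star_steps_def star8_def by (auto simp: prod_eq_iff)
    moreover have "A = insert c ((\<lambda>t. p (Suc t)) ` {..n})"
      using p by (simp add: atMost_Suc_eq_insert_0 image_image)
    moreover have "(\<lambda>t. p (Suc t)) ` {..n} \<in> star_ranges n (f e)"
      unfolding star_ranges_def using p(3)
      by (intro CollectI exI[of _ "\<lambda>t. p (Suc t)"]) (auto simp: walk_on_def f_def e_def)
    ultimately show "A \<in> ?U" by blast
  qed
  have fin: "finite ?U" using Suc card_star_steps by auto
  have "card (star_ranges (Suc n) c) \<le> card ?U" by (rule card_mono[OF fin sub])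
  also have "card ?U \<le> (\<Sum>e\<in>star_steps. card (insert c ` star_ranges n (f e)))"
    by (rule card_UN_le) (rule card_star_steps)
  also have "(\<Sum>e\<in>star_steps. card (insert c ` star_ranges n (f e))) \<le> (\<Sum>e\<in>star_steps. 8 ^ n)"
    using Suc card_image_le le_trans by (intro sum_mono) blast
  finally show ?case
    using finite_subset[OF sub fin] card_star_steps by simp
qed

section \<open>Planes in the torus\<close>

lemma joined_in_imp_reach:
  assumes "joined_in d N A x y"
  shows "reach (neighbors d N) A x y"
proof -
  have "reach (neighbors d N) A (hd p) (last p)"
    if "p \<noteq> []" "set p \<subseteq> A" "successively (neighbors d N) p" for p
    using that
  proof (induction p rule: rev_nonempty_induct)
    case (single x)
    then show ?case by (auto intro: reach_refl)
  next
    case (snoc x xs)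
    then have "reach (neighbors d N) A (hd xs) (last xs)" "neighbors d N (last xs) x" "x \<in> A"
      by (auto simp: successively_append_iff)
    then show ?case using snoc.hyps by (auto intro: reach_step)
  qed
  then show ?thesis using assms unfolding joined_in_def by blast
qed

lemma reach_imp_joined_in:
  assumes "reach (neighbors d N) A x y"
  shows "joined_in d N A x y"
  using assms
proof (induction rule: reach_induct)
  case refl
  then show ?case unfolding joined_in_def by (intro exI[of _ "[x]"]) auto
next
  case (step b c)
  then obtain p where "p \<noteq> []" "hd p = x" "last p = b" "set p \<subseteq> A" "successively (neighbors d N) p"
    unfolding joined_in_def by blast
  then show ?case
    unfolding joined_in_def using step by (intro exI[of _ "p @ [c]"]) (auto simp: successively_append_iff)
qed

lemma l2_dist_eq_sqrt: "l2_dist d a b = sqrt (real_of_int (\<Sum>i<d. (a i - b i)\<^sup>2))"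
  by (simp add: l2_dist_def)

text \<open>Squared lattice distances are integers, so an infimum equal to 1 is attained:
  representatives at distance in [1, sqrt 2) are at distance exactly 1 and differ in one
  coordinate.\<close>

lemma neighborsD:
  assumes "neighbors d N x y"
  obtains a b c where "proj N a = x" "proj N b = y" "c < d" "\<bar>a c - b c\<bar> = 1"
    "\<And>k. k < d \<Longrightarrow> k \<noteq> c \<Longrightarrow> a k = b k"
proof -
  let ?S = "{l2_dist d a b | a b. a \<in> lattice d \<and> b \<in> lattice d \<and> proj N a = x \<and> proj N b = y}"
  have inf: "Inf ?S = 1" and xy: "x \<in> torus d N" "y \<in> torus d N"
    using assms by (auto simp: neighbors_def induced_dist_def)
  have ne: "?S \<noteq> {}" using xy unfolding torus_def by blast
  have bdd: "bdd_below ?S" by (rule bdd_belowI[of _ 0]) (auto simp: l2_dist_def intro!: sum_nonneg)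
  have "Inf ?S < sqrt 2" unfolding inf by simp
  then obtain a b where ab: "proj N a = x" "proj N b = y" "l2_dist d a b < sqrt 2" "l2_dist d a b \<in> ?S"
    using cInf_lessD[OF ne] by blast
  have "1 \<le> l2_dist d a b" using cInf_lower[OF ab(4) bdd] inf by simp
  then have sum: "(\<Sum>i<d. (a i - b i)\<^sup>2) = 1"
    using ab(3) unfolding l2_dist_eq_sqrt real_sqrt_less_iff real_sqrt_ge_1_iff by linarith
  then obtain c where c: "c < d" "(a c - b c)\<^sup>2 \<noteq> 0"
    by (metis (no_types, lifting) lessThan_iff sum.neutral zero_neq_one)
  have split: "(\<Sum>i<d. (a i - b i)\<^sup>2) = (a c - b c)\<^sup>2 + (\<Sum>i\<in>{..<d} - {c}. (a i - b i)\<^sup>2)"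
    using c by (intro sum.remove) auto
  have "(a c - b c)\<^sup>2 \<ge> 1" using c(2) by (simp add: int_one_le_iff_zero_less)
  moreover have nn: "(\<Sum>i\<in>{..<d} - {c}. (a i - b i)\<^sup>2) \<ge> 0" by (intro sum_nonneg) auto
  ultimately have 1: "(a c - b c)\<^sup>2 = 1" "(\<Sum>i\<in>{..<d} - {c}. (a i - b i)\<^sup>2) = 0"
    using sum split by linarith+
  show thesis
  proof (rule that[OF ab(1,2) c(1)])
    have "a c - b c = 1 \<or> a c - b c = - 1" using 1(1) by (simp only: power2_eq_1_iff)
    then show "\<bar>a c - b c\<bar> = 1" by arith
  next
    fix k assume "k < d" "k \<noteq> c"
    then have "(a k - b k)\<^sup>2 = 0" using 1(2) by (subst (asm) sum_nonneg_eq_0_iff) auto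
    then show "a k = b k" by simp
  qed
qed

lemma neighborsI:
  assumes ab: "a \<in> lattice d" "b \<in> lattice d" and sum: "(\<Sum>i<d. (a i - b i)\<^sup>2) = 1" and ne: "proj N a \<noteq> proj N b"
  shows "neighbors d N (proj N a) (proj N b)"
proof -
  let ?S = "{l2_dist d a' b' | a' b'. a' \<in> lattice d \<and> b' \<in> lattice d \<and> proj N a' = proj N a \<and> proj N b' = proj N b}"
  have "l2_dist d a b = 1" unfolding l2_dist_eq_sqrt sum by simp
  then have "1 \<in> ?S" using ab by force
  moreover have "1 \<le> z" if "z \<in> ?S" for z
  proof -
    obtain a' b' where z: "z = l2_dist d a' b'" "a' \<in> lattice d" "b' \<in> lattice d"
      "proj N a' = proj N a" "proj N b' = proj N b" using \<open>z \<in> ?S\<close> by blast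
    have "a' \<noteq> b'" using z ne by auto
    then obtain i where i: "a' i \<noteq> b' i" by auto
    have "a' i = 0 \<and> b' i = 0" if "\<not> i < d" using z(2,3) that by (auto simp: lattice_def)
    then have "i < d" using i by fastforce
    then have "(a' i - b' i)\<^sup>2 \<le> (\<Sum>i<d. (a' i - b' i)\<^sup>2)" by (intro member_le_sum) auto
    moreover have "(a' i - b' i)\<^sup>2 \<ge> 1" using i by (simp add: int_one_le_iff_zero_less)
    ultimately have "1 \<le> (\<Sum>i<d. (a' i - b' i)\<^sup>2)" by linarith
    then have "1 \<le> real_of_int (\<Sum>i<d. (a' i - b' i)\<^sup>2)" by (simp only: of_int_1_le_iff)
    then show ?thesis unfolding z(1) l2_dist_eq_sqrt by (simp only: real_sqrt_ge_1_iff)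
  qed
  ultimately have "Inf ?S = 1" by (rule cInf_eq_minimum)
  then show ?thesis using ab by (auto simp: neighbors_def induced_dist_def torus_def)
qed

section \<open>The covering of a plane of the torus by the square lattice\<close>

definition plane_point :: "nat \<Rightarrow> nat \<Rightarrow> point \<Rightarrow> site \<Rightarrow> point" where
  "plane_point i j y s = (\<lambda>k. y k + fst s * basis_vec i k + snd s * basis_vec j k)"

text \<open>Planar duality is applied to the pullback of the visited set under this map, a periodic
  subset of Z^2; paths that wind around the torus lift to ordinary ones.\<close>

definition plane_map :: "nat \<Rightarrow> nat \<Rightarrow> nat \<Rightarrow> point \<Rightarrow> site \<Rightarrow> point" where
  "plane_map N i j y s = proj N (plane_point i j y s)"

lemma planes_eq: "planes d N = {range (plane_map N i j y) | y i j. y \<in> lattice d \<and> i < j \<and> j < d}"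
proof -
  have "proj N ` {(\<lambda>k. y k + a * basis_vec i k + b * basis_vec j k) | a b :: int. True} = range (plane_map N i j y)"
    for y i j
    by (force simp: plane_map_def plane_point_def image_iff)
  then show ?thesis unfolding planes_def by simp
qed

context
  fixes d N i j :: nat and y :: point
  assumes ij: "i < j" "j < d" and y: "y \<in> lattice d"
begin

lemma plane_point_lattice: "plane_point i j y s \<in> lattice d"
  using ij y by (auto simp: plane_point_def lattice_def basis_vec_def)

lemma plane_map_torus: "plane_map N i j y s \<in> torus d N"
  unfolding plane_map_def torus_def by (intro imageI plane_point_lattice)

lemma plane_map_coordinates:
  "plane_map N i j y s i = (y i + fst s) mod int N"
  "plane_map N i j y s j = (y j + snd s) mod int N"
  "k \<noteq> i \<Longrightarrow> k \<noteq> j \<Longrightarrow> plane_map N i j y s k = y k mod int N"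
  using ij by (auto simp: plane_map_def plane_point_def proj_def basis_vec_def)

lemma plane_map_eqI:
  assumes "k < N" "\<bar>fst s - fst s'\<bar> \<le> int k" "\<bar>snd s - snd s'\<bar> \<le> int k" "plane_map N i j y s = plane_map N i j y s'"
  shows "s = s'"
proof -
  have eq: "u = v" if "(c + u) mod int N = (c + v) mod int N" "\<bar>u - v\<bar> \<le> int k" for c u v :: int
  proof -
    have "int N dvd u - v" using that(1) by (metis add_diff_cancel_left mod_eq_dvd_iff)
    then show ?thesis using that(2) assms(1) zdvd_not_zless[of "\<bar>u - v\<bar>" "int N"] by fastforce
  qed
  have "(y i + fst s) mod int N = (y i + fst s') mod int N"
    "(y j + snd s) mod int N = (y j + snd s') mod int N"
    using assms(4) plane_map_coordinates(1,2) by metis+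
  then have "fst s = fst s'" "snd s = snd s'" using eq assms(2,3) by blast+
  then show ?thesis by (rule prod_eqI)
qed

lemma neighbors_plane_map:
  assumes N: "N \<ge> 2" and "nn4 s s'"
  shows "neighbors d N (plane_map N i j y s) (plane_map N i j y s')"
  unfolding plane_map_def
proof (rule neighborsI)
  have nn: "\<bar>fst s - fst s'\<bar> + \<bar>snd s - snd s'\<bar> = 1" using assms(2) by (simp add: nn4_def)
  show "proj N (plane_point i j y s) \<noteq> proj N (plane_point i j y s')"
  proof
    assume "proj N (plane_point i j y s) = proj N (plane_point i j y s')"
    moreover have "\<bar>fst s - fst s'\<bar> \<le> int 1" "\<bar>snd s - snd s'\<bar> \<le> int 1" using nn by linarith+
    ultimately have "s = s'" using plane_map_eqI[of 1 s s'] N unfolding plane_map_def by simp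
    then show False using nn by simp
  qed
  have "(\<Sum>k<d. (plane_point i j y s k - plane_point i j y s' k)\<^sup>2) =
      (\<Sum>k\<in>{i, j}. (plane_point i j y s k - plane_point i j y s' k)\<^sup>2)"
    using ij by (intro sum.mono_neutral_right) (auto simp: plane_point_def basis_vec_def)
  also have "\<dots> = (fst s - fst s')\<^sup>2 + (snd s - snd s')\<^sup>2"
    using ij by (simp add: plane_point_def basis_vec_def)
  also have "\<dots> = 1"
    using assms(2)
    by (cases rule: nn4_cases) auto
  finally show "(\<Sum>k<d. (plane_point i j y s k - plane_point i j y s' k)\<^sup>2) = 1" .
qed (rule plane_point_lattice)+

text \<open>Path lifting, one step. A neighbour within the plane cannot differ in an orthogonal
  direction, where coordinates are constant modulo N; so the step is in direction i or j and is
  copied upstairs.\<close>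

lemma neighbors_plane_map_lift:
  assumes N: "N \<ge> 2" and nb: "neighbors d N (plane_map N i j y s) z" and z: "z \<in> range (plane_map N i j y)"
  shows "\<exists>s'. nn4 s s' \<and> plane_map N i j y s' = z"
proof -
  obtain a b c where ab: "proj N a = plane_map N i j y s" "proj N b = z" "c < d" "\<bar>a c - b c\<bar> = 1"
    "\<And>k. k < d \<Longrightarrow> k \<noteq> c \<Longrightarrow> a k = b k"
    using neighborsD[OF nb] by blast
  obtain s2 where s2: "z = plane_map N i j y s2" using z by auto
  have other: "z k = plane_map N i j y s' k" if "k \<noteq> i" "k \<noteq> j" for k s'
    unfolding s2 using plane_map_coordinates(3) that by simp
  have same: "z k = plane_map N i j y s k" if "k < d" "k \<noteq> c" for k
    using ab(5)[OF that] fun_cong[OF ab(1), of k] fun_cong[OF ab(2), of k] by (simp add: proj_def)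
  have step: "z c = (plane_map N i j y s c + (b c - a c)) mod int N"
    using fun_cong[OF ab(1), of c, symmetric] fun_cong[OF ab(2), of c] by (simp add: proj_def mod_add_left_eq)
  have "c = i \<or> c = j"
  proof (rule ccontr)
    assume "\<not> (c = i \<or> c = j)"
    then have "a c mod int N = b c mod int N"
      using other[of c s] fun_cong[OF ab(1), of c] fun_cong[OF ab(2), of c] by (simp add: proj_def)
    then have "int N dvd a c - b c" by (simp add: mod_eq_dvd_iff)
    then show False using ab(4) N by (metis abs_dvd_iff dvd_abs_iff int_one_le_iff_zero_less of_nat_dvd_iff
        nat_dvd_1_iff_1 of_nat_1 one_less_numeral_iff Suc_1 not_less_eq_eq numeral_2_eq_2 le_refl)
  qed
  then show ?thesis
  proof
    assume c: "c = i"
    let ?s' = "(fst s + (b c - a c), snd s)"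
    have "plane_map N i j y ?s' k = z k" for k
    proof (cases "k = i")
      case True
      then show ?thesis using step c by (simp add: plane_map_coordinates mod_add_left_eq add.assoc)
    next
      case False
      then show ?thesis using other[of k ?s'] same[of j] c ij
        by (cases "k = j") (simp_all add: plane_map_coordinates)
    qed
    moreover have "nn4 s ?s'" using ab(4) by (simp add: nn4_def abs_minus_commute)
    ultimately show ?thesis by blast
  next
    assume c: "c = j"
    let ?s' = "(fst s, snd s + (b c - a c))"
    have "plane_map N i j y ?s' k = z k" for k
    proof (cases "k = j")
      case True
      then show ?thesis using step c by (simp add: plane_map_coordinates mod_add_left_eq add.assoc)
    next
      case False
      then show ?thesis using other[of k ?s'] same[of i] c ij
        by (cases "k = i") (simp_all add: plane_map_coordinates)
    qed
    moreover have "nn4 s ?s'" using ab(4) by (simp add: nn4_def abs_minus_commute)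
    ultimately show ?thesis by blast
  qed
qed

lemma reach_plane_map:
  assumes "N \<ge> 2" "reach nn4 (- (plane_map N i j y -` V)) s s'"
  shows "joined_in d N (range (plane_map N i j y) - V) (plane_map N i j y s) (plane_map N i j y s')"
  by (rule reach_imp_joined_in, rule reach_map[OF assms(2)]) (auto intro: neighbors_plane_map assms)

lemma joined_in_lift:
  assumes N: "N \<ge> 2" and O: "O1 \<subseteq> range (plane_map N i j y) - V"
    and joined: "joined_in d N O1 (plane_map N i j y s) v"
  shows "\<exists>s'. plane_map N i j y s' = v \<and> reach nn4 (- (plane_map N i j y -` V)) s s'"
  using joined_in_imp_reach[OF joined]
proof (induction rule: reach_induct)
  case refl
  then show ?case using O by (intro exI[of _ s] conjI reach_refl) auto
next
  case (step b c)
  then obtain s' where s': "plane_map N i j y s' = b" "reach nn4 (- (plane_map N i j y -` V)) s s'" by blast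
  have "\<exists>s''. nn4 s' s'' \<and> plane_map N i j y s'' = c"
    by (rule neighbors_plane_map_lift[OF N]) (use step s' O in auto)
  then obtain s'' where "nn4 s' s''" "plane_map N i j y s'' = c" by blast
  then show ?case using s' step O by (intro exI[of _ s'']) (auto intro: reach_step)
qed

text \<open>Torus distance is an infimum over representatives, so a pair at torus distance at least
  m lifts to sites at least m apart.\<close>

lemma torus_linf_plane_map_le:
  "torus_linf d N (plane_map N i j y s) (plane_map N i j y s') \<le> nat (max \<bar>fst s - fst s'\<bar> \<bar>snd s - snd s'\<bar>)"
proof -
  let ?S = "{linf_dist d a b | a b. a \<in> lattice d \<and> b \<in> lattice d \<and>
     proj N a = plane_map N i j y s \<and> proj N b = plane_map N i j y s'}"
  have "Inf ?S \<le> linf_dist d (plane_point i j y s) (plane_point i j y s')"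
  proof (rule cInf_lower)
    show "linf_dist d (plane_point i j y s) (plane_point i j y s') \<in> ?S"
      unfolding plane_map_def using plane_point_lattice by blast
  qed simp
  also have "\<dots> \<le> nat (max \<bar>fst s - fst s'\<bar> \<bar>snd s - snd s'\<bar>)"
    unfolding linf_dist_def using ij
    by (subst Max_le_iff) (auto simp: plane_point_def basis_vec_def)
  finally show ?thesis by (simp add: induced_dist_def)
qed

lemma finite_subset_torus_diam:
  assumes "N \<ge> 1" "O1 \<subseteq> torus d N" "m \<ge> 1" "diam_inf d N O1 \<ge> m"
  shows "\<exists>u\<in>O1. \<exists>v\<in>O1. torus_linf d N u v \<ge> m"
proof -
  let ?S = "(\<lambda>(u, v). torus_linf d N u v) ` (O1 \<times> O1)"
  have S: "diam_inf d N O1 = Sup ?S" unfolding diam_inf_def by (rule arg_cong[of _ _ Sup]) auto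
  have fin: "finite ?S" using assms card_torus(1)[OF assms(1)] finite_subset by blast
  \<comment> \<open>\<open>Sup {} = 0\<close> on \<open>nat\<close>, so a diameter of at least m
    \<ge> 1 excludes the empty set.\<close>
  have ne: "?S \<noteq> {}" using assms(3,4) unfolding S by (auto simp: Sup_nat_def)
  have "Sup ?S \<in> ?S" unfolding cSup_eq_Max[OF fin ne] by (rule Max_in[OF fin ne])
  then obtain u v where "u \<in> O1" "v \<in> O1" "Sup ?S = torus_linf d N u v" by auto
  then show ?thesis using assms(4) unfolding S by metis
qed

theorem unique_long_component:
  assumes N: "N \<ge> 2" and m: "m \<ge> 1" and W: "short_clusters (int m) (plane_map N i j y -` V)"
    and O1: "O1 \<subseteq> range (plane_map N i j y) - V" "nn_connected d N O1" "diam_inf d N O1 \<ge> m"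
    and O2: "O2 \<subseteq> range (plane_map N i j y) - V" "nn_connected d N O2" "diam_inf d N O2 \<ge> m"
  shows "\<exists>C\<in>nn_components d N (range (plane_map N i j y) - V). O1 \<subseteq> C \<and> O2 \<subseteq> C"
proof -
  let ?F = "range (plane_map N i j y)" and ?W = "plane_map N i j y -` V"
  have long: "\<exists>s s'. plane_map N i j y s \<in> O' \<and> reach nn4 (- ?W) s s' \<and>
      (\<bar>fst s - fst s'\<bar> \<ge> int m \<or> \<bar>snd s - snd s'\<bar> \<ge> int m)"
    if O': "O' \<subseteq> ?F - V" "nn_connected d N O'" "diam_inf d N O' \<ge> m" for O'
  proof -
    have "O' \<subseteq> torus d N" using O'(1) plane_map_torus by blast
    then obtain u v where uv: "u \<in> O'" "v \<in> O'" "torus_linf d N u v \<ge> m"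
      using finite_subset_torus_diam[of O' m] N m O'(3) by auto
    obtain s where s: "u = plane_map N i j y s" using uv O'(1) by blast
    have "joined_in d N O' (plane_map N i j y s) v" using O'(2) uv s by (auto simp: nn_connected_def)
    then obtain s' where s': "plane_map N i j y s' = v" "reach nn4 (- ?W) s s'"
      using joined_in_lift[OF N O'(1)] by blast
    have "m \<le> nat (max \<bar>fst s - fst s'\<bar> \<bar>snd s - snd s'\<bar>)"
      using uv(3) torus_linf_plane_map_le[of s s'] s s' by simp
    then have "\<bar>fst s - fst s'\<bar> \<ge> int m \<or> \<bar>snd s - snd s'\<bar> \<ge> int m" by linarith
    then show ?thesis using s s' uv by blast
  qed
  obtain a b where a: "plane_map N i j y a \<in> O1" "reach nn4 (- ?W) a b"
    "\<bar>fst a - fst b\<bar> \<ge> int m \<or> \<bar>snd a - snd b\<bar> \<ge> int m" using long[OF O1] by blast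
  obtain c e where c: "plane_map N i j y c \<in> O2" "reach nn4 (- ?W) c e"
    "\<bar>fst c - fst e\<bar> \<ge> int m \<or> \<bar>snd c - snd e\<bar> \<ge> int m" using long[OF O2] by blast
  have "reach nn4 (- ?W) a c"
    by (rule long_paths_connected[OF W _ a(2,3) c(2,3)]) simp
  then have ac: "reach (neighbors d N) (?F - V) (plane_map N i j y a) (plane_map N i j y c)"
    by (intro joined_in_imp_reach reach_plane_map N)
  have mem: "reach (neighbors d N) (?F - V) u v" if "O' \<subseteq> ?F - V" "nn_connected d N O'" "u \<in> O'" "v \<in> O'" for O' u v
    using that joined_in_imp_reach reach_mono unfolding nn_connected_def by metis
  let ?C = "{z. joined_in d N (?F - V) (plane_map N i j y a) z}"
  have "?C \<in> nn_components d N (?F - V)" unfolding nn_components_def using a(1) O1(1) by blast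
  moreover have "O1 \<subseteq> ?C" using mem[OF O1(1,2) a(1)] reach_imp_joined_in by blast
  moreover have "O2 \<subseteq> ?C" using mem[OF O2(1,2) c(1)] reach_trans[OF ac] reach_imp_joined_in by blast
  ultimately show ?thesis by blast
qed

lemma over_plane_plane_map: "over_plane d N i j y (plane_map N i j y s)"
  unfolding over_plane_def by (simp add: plane_map_coordinates mod_eq_dvd_iff[symmetric])

text \<open>Every star path can be made to start at (0, 0) by moving the base point within the
  torus, which leaves N^d base points for the union bound.\<close>

lemma plane_map_shift:
  "plane_map N i j (proj N (plane_point i j y c)) s = plane_map N i j y (fst c + fst s, snd c + snd s)"
proof (rule ext)
  fix k
  let ?a = "y k + fst c * basis_vec i k + snd c * basis_vec j k"
  have "(?a mod int N + fst s * basis_vec i k + snd s * basis_vec j k) mod int N =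
      (?a + fst s * basis_vec i k + snd s * basis_vec j k) mod int N"
    by (simp only: add.assoc mod_add_left_eq)
  also have "?a + fst s * basis_vec i k + snd s * basis_vec j k =
      y k + (fst c + fst s) * basis_vec i k + (snd c + snd s) * basis_vec j k"
    by (simp add: algebra_simps)
  finally show "plane_map N i j (proj N (plane_point i j y c)) s k = plane_map N i j y (fst c + fst s, snd c + snd s) k"
    by (simp add: plane_map_def proj_def plane_point_def)
qed

text \<open>Fewer than N steps are too few to wind around the torus, so no sites are identified and
  the cover estimate gets its full exponent n + 1.\<close>

lemma card_plane_map_image:
  assumes "walk_on star8 p n" "inj_on p {..n}" "n < N"
  shows "card (plane_map N i j y ` p ` {..n}) = Suc n"
proof -
  have "inj_on (\<lambda>t. plane_map N i j y (p t)) {..n}"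
  proof (rule linorder_inj_onI')
    fix t t' assume t: "t \<in> {..n}" "t' \<in> {..n}" "t < t'"
    show "plane_map N i j y (p t) \<noteq> plane_map N i j y (p t')"
    proof
      assume "plane_map N i j y (p t) = plane_map N i j y (p t')"
      moreover have "\<bar>fst (p t) - fst (p t')\<bar> \<le> int n" "\<bar>snd (p t) - snd (p t')\<bar> \<le> int n"
        using walk_on_star8_bound[OF assms(1), of t t'] t by auto
      ultimately have "p t = p t'" using plane_map_eqI[OF assms(3)] by blast
      then show False using assms(2) t by (auto simp: inj_on_def)
    qed
  qed
  then show ?thesis by (simp add: image_image card_image)
qed

end

text \<open>For 2 m \<le> N no winding shortens the coordinate difference: |m + N k| \<ge> m for
  every integer k. This puts the end of the open path on the sphere and not inside it.\<close>

lemma torus_linf_ge: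
  assumes N: "2 * m \<le> N" and x: "c < d" "x c = int m" and z: "x \<in> torus d N"
  shows "torus_linf d N x 0 \<ge> m"
proof -
  let ?S = "{linf_dist d a b | a b. a \<in> lattice d \<and> b \<in> lattice d \<and> proj N a = x \<and> proj N b = 0}"
  have "0 \<in> torus d N" by (auto simp: torus_def lattice_def proj_def fun_eq_iff image_iff intro!: exI[of _ 0])
  then have "?S \<noteq> {}" using z unfolding torus_def by (auto simp: image_iff)
  moreover have "m \<le> r" if "r \<in> ?S" for r
  proof -
    obtain a b where ab: "r = linf_dist d a b" "proj N a = x" "proj N b = 0" using \<open>r \<in> ?S\<close> by blast
    have a: "a c mod int N = int m" using fun_cong[OF ab(2), of c] x by (simp add: proj_def)
    have b: "b c mod int N = 0" using fun_cong[OF ab(3), of c] by (simp add: proj_def)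
    have "(a c - b c) mod int N = (int m - 0) mod int N" using a b by (metis mod_diff_eq mod_mod_trivial)
    then obtain k where k: "a c - b c = int m + int N * k"
      by (metis diff_zero mod_eqE mult.commute add.commute diff_add_cancel mod_eq_dvd_iff dvdE)
    have "int m \<le> \<bar>a c - b c\<bar>"
    proof (cases "k \<ge> 0")
      case True
      then have "int N * k \<ge> 0" by simp
      then show ?thesis using k by linarith
    next
      case False
      then have "int N * k \<le> int N * (- 1)" by (intro mult_left_mono) auto
      then show ?thesis using k N by linarith
    qed
    then have "m \<le> nat \<bar>a c - b c\<bar>" by linarith
    also have "\<dots> \<le> linf_dist d a b" unfolding linf_dist_def using x by (intro Max_ge) auto
    finally show ?thesis using ab by simp
  qed
  ultimately have "m \<le> Inf ?S" by (rule cInf_greatest)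
  then show ?thesis by (simp add: induced_dist_def)
qed

text \<open>A closed star path cutting off the origin in this coordinate plane starts at some (k, 0)
  and reaches column 0, hence has at least k steps. Path lengths thus grow with k, which keeps the
  sum over starting sites bounded.\<close>

theorem open_quadrant_connection:
  assumes d: "d \<ge> 2" and N: "N \<ge> 2" "2 * m \<le> N" and 0: "0 \<notin> V"
    and no: "\<And>k p. 1 \<le> k \<Longrightarrow> k \<le> m \<Longrightarrow> p 0 = (int k, 0) \<Longrightarrow> walk_on star8 p k \<Longrightarrow> inj_on p {..k} \<Longrightarrow>
       \<not> plane_map N 0 1 0 ` p ` {..k} \<subseteq> V"
  shows "\<exists>F\<in>planes d N. 0 \<in> F \<and> (\<exists>z\<in>sphere_inf d N 0 m. joined_in d N (F - V) 0 z)"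
proof -
  let ?f = "plane_map N 0 1 0"
  have ij: "0 < (1::nat)" "1 < d" and y: "0 \<in> lattice d" using d by (auto simp: lattice_def)
  have f0: "?f (0, 0) = 0" by (simp add: plane_map_def plane_point_def proj_def fun_eq_iff)
  note f0' = f0 f0[unfolded One_nat_def]
  define W where "W = ?f -` V"
  have W0: "(0, 0) \<notin> W" using 0 by (simp add: W_def f0')
  have "\<not> reach star8 (rect 0 (int m) 0 (int m) \<inter> W) (x, 0) (0, w)" for x w
  proof
    assume r: "reach star8 (rect 0 (int m) 0 (int m) \<inter> W) (x, 0) (0, w)"
    then obtain p n where p: "p 0 = (x, 0)" "p n = (0, w)" "p ` {..n} \<subseteq> rect 0 (int m) 0 (int m) \<inter> W"
      "walk_on star8 p n" "inj_on p {..n}" using reach_imp_inj_walk by metis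
    have x: "x \<noteq> 0" "0 \<le> x" "x \<le> int m" using reach_in[OF r] W0 by (auto simp: rect_def)
    define k where "k = nat x"
    have k: "1 \<le> k" "k \<le> m" "x = int k" using x by (auto simp: k_def)
    have "x \<le> int n" using walk_on_star8_bound[OF p(4), of 0 n] p(1,2) x by auto
    then have kn: "k \<le> n" using k by simp
    have "walk_on star8 p k" "inj_on p {..k}" "p ` {..k} \<subseteq> W"
      using p kn by (auto simp: walk_on_def intro: inj_on_subset)
    moreover have "?f ` p ` {..k} \<subseteq> V" using calculation(3) by (auto simp: W_def)
    ultimately show False using no[of k p] k p(1) by auto
  qed
  then obtain z where z: "fst z = int m \<or> snd z = int m" "reach nn4 (rect 0 (int m) 0 (int m) - W) (0, 0) z"
    using quadrant_crossing[OF of_nat_0_le_iff W0, of m] by blast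
  have zr: "0 \<le> fst z" "fst z \<le> int m" "0 \<le> snd z" "snd z \<le> int m"
    using reach_in[OF z(2)] by (auto simp: rect_def)
  have "reach nn4 (- W) (0, 0) z" by (rule reach_mono[OF z(2)]) auto
  then have join: "joined_in d N (range ?f - V) 0 (?f z)"
    using reach_plane_map[OF ij y N(1), of V "(0, 0)" z] by (simp add: W_def f0')
  have zt: "?f z \<in> torus d N" by (rule plane_map_torus[OF ij y])
  have "torus_linf d N (?f z) (?f (0, 0)) \<le> nat (max \<bar>fst z - fst (0::int, 0::int)\<bar> \<bar>snd z - snd (0::int, 0::int)\<bar>)"
    by (rule torus_linf_plane_map_le[OF ij y])
  also have "\<dots> \<le> m" using zr by auto
  finally have le: "torus_linf d N (?f z) 0 \<le> m" by (simp add: f0')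
  have co: "?f z 0 = fst z mod int N" "?f z 1 = snd z mod int N"
    using plane_map_coordinates(1,2)[OF ij y, of N z] by simp_all
  have mN: "int m mod int N = int m" using N by simp
  have "torus_linf d N (?f z) 0 \<ge> m"
    using z(1)
  proof
    assume "fst z = int m"
    then show ?thesis using torus_linf_ge[OF N(2) _ _ zt, of 0] co mN d by simp
  next
    assume "snd z = int m"
    then show ?thesis using torus_linf_ge[OF N(2) _ _ zt, of 1] co mN d by simp
  qed
  with le have "?f z \<in> sphere_inf d N 0 m" using zt by (simp add: sphere_inf_def)
  moreover have "range ?f \<in> planes d N" unfolding planes_eq using ij y by blast
  moreover have "0 \<in> range ?f" using f0 by (metis rangeI)
  ultimately show ?thesis using join by blast
qed

section \<open>The Peierls argument\<close>

lemma mu_eq: "mu d = 49 * return_rate d"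
  by (simp add: mu_def return_rate_def)

lemma mu_ge:
  assumes "d \<ge> 2"
  shows "mu d \<ge> 98 / real d"
proof -
  have "0 \<le> (1 - 2 / real d) * return_prob (d - 2)"
    using assms by (intro mult_nonneg_nonneg) (auto simp: return_prob_def)
  then show ?thesis by (simp add: mu_def)
qed

section \<open>Union bounds over star paths\<close>

definition star_event :: "nat \<Rightarrow> real \<Rightarrow> nat \<Rightarrow> nat \<Rightarrow> point \<Rightarrow> site \<Rightarrow> nat \<Rightarrow> (point \<times> (nat \<Rightarrow> point)) set" where
  "star_event N t i j y c n = {\<omega>. \<exists>p. p 0 = c \<and> walk_on star8 p n \<and> inj_on p {..n} \<and>
     plane_map N i j y ` p ` {..n} \<subseteq> visited N t \<omega>}"

lemma star_event_eq:
  "star_event N t i j y c n =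
    (\<Union>A\<in>{p ` {..n} | p. p 0 = c \<and> walk_on star8 p n \<and> inj_on p {..n}}.
       {\<omega>. plane_map N i j y ` A \<subseteq> visited N t \<omega>})"
  unfolding star_event_def by auto

lemma finite_inj_star_ranges: "finite {p ` {..n} | p. p 0 = c \<and> walk_on star8 p n \<and> inj_on p {..n}}"
  by (rule finite_subset[OF _ card_star_ranges[THEN conjunct1, of n c]]) (auto simp: star_ranges_def)

lemma star_event_sets:
  assumes "t \<ge> 0"
  shows "star_event N t i j y c n \<in> sets (walk_space d N)"
  unfolding star_event_eq
proof (intro sets.finite_UN subset_visited_sets assms)
  show "finite {p ` {..n} | p. p 0 = c \<and> walk_on star8 p n \<and> inj_on p {..n}}"
    by (rule finite_inj_star_ranges)
qed auto

lemma measure_star_event_le: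
  assumes t: "t \<ge> 0" and C: "C \<ge> 0"
    and le: "\<And>p. walk_on star8 p n \<Longrightarrow> inj_on p {..n} \<Longrightarrow>
      measure (walk_space d N) {\<omega>. plane_map N i j y ` p ` {..n} \<subseteq> visited N t \<omega>} \<le> C"
  shows "measure (walk_space d N) (star_event N t i j y c n) \<le> 8 ^ n * C"
proof -
  interpret P: prob_space "walk_space d N" by (rule prob_space_walk_space)
  let ?I = "{p ` {..n} | p. p 0 = c \<and> walk_on star8 p n \<and> inj_on p {..n}}"
  have fin: "finite ?I" by (rule finite_inj_star_ranges)
  have sets: "{\<omega>. plane_map N i j y ` A \<subseteq> visited N t \<omega>} \<in> P.events" if "A \<in> ?I" for A
    by (rule subset_visited_sets[OF t]) (use that in auto)
  have "P.prob (star_event N t i j y c n) \<le> (\<Sum>A\<in>?I. P.prob {\<omega>. plane_map N i j y ` A \<subseteq> visited N t \<omega>})"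
    unfolding star_event_eq by (rule P.finite_measure_subadditive_finite[OF fin]) (use sets in blast)
  also have "\<dots> \<le> (\<Sum>A\<in>?I. C)"
  proof (rule sum_mono)
    fix A assume "A \<in> ?I"
    then obtain p where "A = p ` {..n}" "walk_on star8 p n" "inj_on p {..n}" by blast
    then show "P.prob {\<omega>. plane_map N i j y ` A \<subseteq> visited N t \<omega>} \<le> C" using le[of p] by simp
  qed
  also have "\<dots> = real (card ?I) * C" by simp
  also have "\<dots> \<le> real (8 ^ n) * C"
  proof (intro mult_right_mono of_nat_mono C)
    have "card ?I \<le> card (star_ranges n c)"
      using card_star_ranges by (intro card_mono) (auto simp: star_ranges_def)
    also have "\<dots> \<le> 8 ^ n" using card_star_ranges by blast
    finally show "card ?I \<le> 8 ^ n" .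
  qed
  finally show ?thesis by simp
qed

lemma uniqueness_event_sets:
  assumes "t \<ge> 0" "N \<ge> 1"
  shows "uniqueness_event d N K t \<in> sets (walk_space d N)"
proof -
  \<comment> \<open>The sample space also contains the null starting points off the torus, so
    \<open>visited\<close> may leave the torus; the planes do not.\<close>
  have F: "F - visited N t \<omega> = F - (visited N t \<omega> \<inter> torus d N)" if "F \<in> planes d N" for F \<omega>
    using that plane_map_torus unfolding planes_eq by blast
  define \<Phi> where "\<Phi> = (\<lambda>V. \<forall>F\<in>planes d N. \<forall>O1 O2.
       O1 \<subseteq> F - V \<and> nn_connected d N O1 \<and> diam_inf d N O1 \<ge> nat \<lfloor>K * ln (real N)\<rfloor> \<and>
       O2 \<subseteq> F - V \<and> nn_connected d N O2 \<and> diam_inf d N O2 \<ge> nat \<lfloor>K * ln (real N)\<rfloor>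
       \<longrightarrow> (\<exists>C\<in>nn_components d N (F - V). O1 \<subseteq> C \<and> O2 \<subseteq> C))"
  have "uniqueness_event d N K t = {\<omega>. \<Phi> (visited N t \<omega> \<inter> torus d N)}"
    unfolding uniqueness_event_def \<Phi>_def space_walk_space by (intro Collect_cong) (simp add: F cong: ball_cong)
  then show ?thesis using visited_predicate_sets[OF assms, of \<Phi> d] by simp
qed

lemma connection_event_sets:
  assumes "t \<ge> 0" "N \<ge> 1"
  shows "connection_event d N K x t \<in> sets (walk_space d N)"
proof -
  have F: "F - visited N t \<omega> = F - (visited N t \<omega> \<inter> torus d N)" if "F \<in> planes d N" for F \<omega>
    using that plane_map_torus unfolding planes_eq by blast
  define \<Phi> where "\<Phi> = (\<lambda>V. \<exists>F\<in>planes d N. x \<in> F \<and>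
       (\<exists>y\<in>sphere_inf d N x (nat \<lfloor>K * ln (real N)\<rfloor>). joined_in d N (F - V) x y))"
  have "connection_event d N K x t = {\<omega>. \<Phi> (visited N t \<omega> \<inter> torus d N)}"
    unfolding connection_event_def \<Phi>_def space_walk_space by (intro Collect_cong) (simp add: F cong: bex_cong)
  then show ?thesis using visited_predicate_sets[OF assms, of \<Phi> d] by simp
qed

lemma uniqueness_event_superset:
  assumes N: "N \<ge> 2" and m: "m = nat \<lfloor>K * ln (real N)\<rfloor>" "m \<ge> 1"
  shows "- (\<Union>y\<in>torus d N. \<Union>i\<in>{..<d}. \<Union>j\<in>{i<..<d}. star_event N t i j y (0, 0) m) \<subseteq> uniqueness_event d N K t"
proof
  fix \<omega> assume \<omega>: "\<omega> \<in> - (\<Union>y\<in>torus d N. \<Union>i\<in>{..<d}. \<Union>j\<in>{i<..<d}. star_event N t i j y (0, 0) m)"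
  let ?V = "visited N t \<omega>"
  have short: "short_clusters (int m) (plane_map N i j y -` ?V)" if ij: "i < j" "j < d" and y: "y \<in> lattice d" for i j y
  proof (rule short_clustersI)
    fix p assume p: "walk_on star8 p m" "inj_on p {..m}"
    define p' where "p' = (\<lambda>t. (fst (p t) - fst (p 0), snd (p t) - snd (p 0)))"
    define y' where "y' = proj N (plane_point i j y (p 0))"
    have y': "y' \<in> torus d N" using plane_map_torus[OF ij y] by (simp add: y'_def plane_map_def)
    have p': "p' 0 = (0, 0)" "walk_on star8 p' m" "inj_on p' {..m}"
      using p by (auto simp: p'_def walk_on_def star8_def inj_on_def prod_eq_iff)
    have "plane_map N i j y' (p' t) = plane_map N i j y (p t)" for t
      unfolding y'_def plane_map_shift[OF ij y] by (simp add: p'_def)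
    then have "plane_map N i j y' ` p' ` {..m} = plane_map N i j y ` p ` {..m}" by (simp add: image_image)
    moreover have "\<omega> \<notin> star_event N t i j y' (0, 0) m" using \<omega> y' ij by auto
    ultimately have "\<not> plane_map N i j y ` p ` {..m} \<subseteq> ?V"
      using p' unfolding star_event_def by blast
    then show "\<not> p ` {..m} \<subseteq> plane_map N i j y -` ?V" by blast
  qed
  show "\<omega> \<in> uniqueness_event d N K t"
    unfolding uniqueness_event_def space_walk_space m(1)[symmetric]
  proof (intro CollectI conjI ballI allI impI UNIV_I)
    fix F O1 O2 assume F: "F \<in> planes d N"
      and O: "O1 \<subseteq> F - ?V \<and> nn_connected d N O1 \<and> m \<le> diam_inf d N O1 \<and>
        O2 \<subseteq> F - ?V \<and> nn_connected d N O2 \<and> m \<le> diam_inf d N O2"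
    obtain i j y where ijy: "i < j" "j < d" "y \<in> lattice d" "F = range (plane_map N i j y)"
      using F unfolding planes_eq by blast
    show "\<exists>C\<in>nn_components d N (F - ?V). O1 \<subseteq> C \<and> O2 \<subseteq> C"
      unfolding ijy(4)
      by (rule unique_long_component[OF ijy(1-3) N m(2) short[OF ijy(1-3)]]) (use O ijy(4) in auto)
  qed
qed

lemma connection_event_superset:
  assumes d: "d \<ge> 2" and N: "N \<ge> 2" "2 * m \<le> N" and m: "m = nat \<lfloor>K * ln (real N)\<rfloor>"
  shows "- ({\<omega>. 0 \<in> visited N t \<omega>} \<union> (\<Union>k\<in>{1..m}. star_event N t 0 1 0 (int k, 0) k)) \<subseteq> connection_event d N K 0 t"
proof
  fix \<omega> assume \<omega>: "\<omega> \<in> - ({\<omega>. 0 \<in> visited N t \<omega>} \<union> (\<Union>k\<in>{1..m}. star_event N t 0 1 0 (int k, 0) k))"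
  have "\<exists>F\<in>planes d N. 0 \<in> F \<and> (\<exists>z\<in>sphere_inf d N 0 m. joined_in d N (F - visited N t \<omega>) 0 z)"
  proof (rule open_quadrant_connection[OF d N])
    show "0 \<notin> visited N t \<omega>" using \<omega> by auto
    fix k p assume "1 \<le> k" "k \<le> m" "p 0 = (int k, 0)" "walk_on star8 p k" "inj_on p {..k}"
    moreover have "\<omega> \<notin> star_event N t 0 1 0 (int k, 0) k" using \<omega> \<open>1 \<le> k\<close> \<open>k \<le> m\<close> by auto
    ultimately show "\<not> plane_map N 0 1 0 ` p ` {..k} \<subseteq> visited N t \<omega>" unfolding star_event_def by blast
  qed
  then show "\<omega> \<in> connection_event d N K 0 t" unfolding connection_event_def m by simp
qed

lemma sum_half_powers_le: "(\<Sum>k\<in>{K<..m}. (1 / 2 :: real) ^ k) \<le> (1 / 2) ^ K"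
proof -
  have "(\<Sum>k\<in>{K<..m}. (1 / 2 :: real) ^ k) \<le> (1 / 2) ^ K - (1 / 2) ^ m" if "K \<le> m"
    using that
  proof (induction m rule: dec_induct)
    case (step m)
    have "{K<..Suc m} = insert (Suc m) {K<..m}" using step by auto
    then show ?case using step by simp
  qed simp
  then show ?thesis by (cases "K \<le> m") (auto intro: order_trans)
qed

section \<open>The two limits in a fixed dimension\<close>

context
  fixes d :: nat
  assumes d5: "d \<ge> 5" and mu1: "mu d < 1"
begin

text \<open>The contribution 98/d of steps inside the plane forces this; it brings the dimension
  into the range d \<ge> 15 of the heat kernel bounds.\<close>

lemma d99: "d \<ge> 99"
proof -
  have "98 / real d < 1" using mu_ge[of d] d5 mu1 by linarith
  then have "98 < real d" using d5 by (simp add: field_simps)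
  then show ?thesis by simp
qed

lemma mu_pos: "mu d > 0"
proof -
  have "0 < 98 / real d" using d5 by simp
  then show ?thesis using mu_ge[of d] d5 by linarith
qed

lemma log_mu_pos: "ln (1 / mu d) > 0"
  using mu_pos mu1 by simp

lemma c0_pos: "c0 d > 0"
  unfolding c0_def using log_mu_pos d5 by simp

text \<open>Since \<open>mu d < 1\<close>, its square root is strictly larger, which puts
  \<open>rate\<close> above the return rate as the supersolution requires; the factor 1/49 leaves
  room for the number of paths.\<close>

definition rate :: real where "rate = sqrt (mu d) / 49"

lemma rate_bounds: "0 < rate" "rate < 1" "return_rate d < rate"
proof -
  show "0 < rate" using mu_pos by (simp add: rate_def)
  show "rate < 1" using mu_pos mu1 real_sqrt_lt_1_iff[of "mu d"] unfolding rate_def by linarith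
  have "mu d < sqrt (mu d)"
    using mu_pos mu1 by (intro real_less_rsqrt) (simp add: power2_eq_square)
  then show "return_rate d < rate" unfolding rate_def using mu_eq[of d] by linarith
qed

text \<open>A union bound over at most 8^n ranges, each covered with probability of order (2
  rate)^(n + 1) when u \<le> u0; per step this is 16 rate \<le> sqrt(mu) / 2.\<close>

lemma star_event_estimate:
  "\<exists>C u0. C \<ge> 0 \<and> u0 > 0 \<and> (\<forall>\<^sub>F N in sequentially. \<forall>i j y c n u. i < j \<longrightarrow> j < d \<longrightarrow> y \<in> lattice d \<longrightarrow>
     n < N \<longrightarrow> 0 \<le> u \<longrightarrow> u \<le> u0 \<longrightarrow>
     measure (walk_space d N) (star_event N (u * real N ^ d) i j y c n) \<le> C * (sqrt (mu d) / 2) ^ n)"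
proof -
  obtain C C' where C: "C \<ge> 0" "C' \<ge> 0" and ev: "\<forall>\<^sub>F N in sequentially. \<forall>i j y S u x. i < j \<longrightarrow> j < d \<longrightarrow>
     finite S \<longrightarrow> S \<noteq> {} \<longrightarrow> card S \<le> N \<longrightarrow> (\<forall>b\<in>S. over_plane d N i j y b) \<longrightarrow> 0 \<le> u \<longrightarrow>
     measure (step_law d) (covered N (nat \<lfloor>u * real N ^ d\<rfloor>) S x) \<le> C * (rate * exp (C' * u)) ^ card S"
    using cover_estimate[of d rate] rate_bounds d99 by auto
  \<comment> \<open>Ensures exp (C' u) \<le> 2; the added 1 covers the case C' = 0.\<close>
  define u0 where "u0 = ln 2 / (C' + 1)"
  have u0: "u0 > 0" using C by (simp add: u0_def)
  have "\<forall>\<^sub>F N in sequentially. \<forall>i j y c n u. i < j \<longrightarrow> j < d \<longrightarrow> y \<in> lattice d \<longrightarrow>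
     n < N \<longrightarrow> 0 \<le> u \<longrightarrow> u \<le> u0 \<longrightarrow>
     measure (walk_space d N) (star_event N (u * real N ^ d) i j y c n) \<le> C * (sqrt (mu d) / 2) ^ n"
    using ev
  proof eventually_elim
    case (elim N)
    show ?case
    proof (intro allI impI)
      fix i j y c n and u :: real
      assume ij: "i < j" "j < d" and y: "y \<in> lattice d" and n: "n < N" and u: "0 \<le> u" "u \<le> u0"
      have t: "u * real N ^ d \<ge> 0" using u by simp
      have "C' * u \<le> C' * u0" using u C by (intro mult_left_mono) auto
      also have "\<dots> \<le> ln 2" using C by (simp add: u0_def field_simps)
      finally have e: "exp (C' * u) \<le> 2" by (metis exp_le_cancel_iff exp_ln zero_less_numeral)
      have "measure (walk_space d N) (star_event N (u * real N ^ d) i j y c n) \<le> 8 ^ n * (C * (2 * rate) ^ Suc n)"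
      proof (rule measure_star_event_le[OF t])
        show "0 \<le> C * (2 * rate) ^ Suc n" using C rate_bounds by simp
        fix p assume p: "walk_on star8 p n" "inj_on p {..n}"
        let ?S = "plane_map N i j y ` p ` {..n}"
        have card: "card ?S = Suc n" by (rule card_plane_map_image[OF ij y p n])
        show "measure (walk_space d N) {\<omega>. ?S \<subseteq> visited N (u * real N ^ d) \<omega>} \<le> C * (2 * rate) ^ Suc n"
        proof (rule measure_subset_visited_le[OF t])
          fix x
          have "measure (step_law d) (covered N (nat \<lfloor>u * real N ^ d\<rfloor>) ?S x) \<le> C * (rate * exp (C' * u)) ^ card ?S"
          proof (rule elim[rule_format, OF ij, where y = y])
            show "over_plane d N i j y b" if "b \<in> ?S" for b
              using that over_plane_plane_map[OF ij y] by blast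
          qed (use card n u in auto)
          also have "\<dots> \<le> C * (2 * rate) ^ Suc n"
            unfolding card using C rate_bounds e by (intro mult_left_mono power_mono) (auto simp: mult.commute)
          finally show "measure (step_law d) (covered N (nat \<lfloor>u * real N ^ d\<rfloor>) ?S x) \<le> C * (2 * rate) ^ Suc n" .
        qed (use n in auto)
      qed
      also have "\<dots> = C * ((16 * rate) ^ n * (2 * rate))"
      proof -
        have "16 * rate = 8 * (2 * rate)" by simp
        then have "(16 * rate) ^ n = 8 ^ n * (2 * rate) ^ n" by (simp only: power_mult_distrib)
        then show ?thesis by (simp only: power_Suc mult_ac)
      qed
      also have "\<dots> \<le> C * ((sqrt (mu d) / 2) ^ n * 1)"
      proof (intro mult_left_mono mult_mono power_mono C)
        show "16 * rate \<le> sqrt (mu d) / 2" using mu_pos by (simp add: rate_def)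
        show "2 * rate \<le> 1" using mu_pos mu1 real_sqrt_lt_1_iff[of "mu d"] unfolding rate_def by linarith
      qed (use rate_bounds mu_pos in auto)
      finally show "measure (walk_space d N) (star_event N (u * real N ^ d) i j y c n) \<le> C * (sqrt (mu d) / 2) ^ n"
        by simp
    qed
  qed
  then show ?thesis using C u0 by blast
qed

definition scale :: "nat \<Rightarrow> nat" where "scale N = nat \<lfloor>c0 d * ln (real N)\<rfloor>"

lemma eventually_scale: "\<forall>\<^sub>F N in sequentially. N \<ge> 2 \<and> 1 \<le> scale N \<and> 2 * scale N \<le> N"
proof -
  have 1: "\<forall>\<^sub>F N in sequentially. ln (real N) \<ge> 1 / c0 d"
    using filterlim_compose[OF ln_at_top filterlim_real_sequentially] by (simp add: filterlim_at_top)
  have "(\<lambda>N. ln (real N) / real N) \<longlonglongrightarrow> 0" by real_asymp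
  then have 2: "\<forall>\<^sub>F N in sequentially. ln (real N) / real N < 1 / (2 * c0 d)"
    by (rule order_tendstoD) (use c0_pos in simp)
  show ?thesis
    using 1 2 eventually_ge_at_top[of 2]
  proof eventually_elim
    case (elim N)
    have "c0 d * ln (real N) \<ge> 1" using elim(1) c0_pos by (simp add: field_simps)
    moreover have "2 * (c0 d * ln (real N)) \<le> real N" using elim(2,3) c0_pos by (simp add: field_simps)
    ultimately show ?case using elim(3) unfolding scale_def by linarith
  qed
qed

text \<open>The origin of \<open>c0\<close>: half of log(1/mu), multiplied by 8 d / log(1/mu), is
  the exponent 4 d. Rounding \<open>scale\<close> down loses at most one factor sqrt(mu), made up
  for by exp(log(1/mu) / 2).\<close>

lemma power_scale_le:
  assumes "N \<ge> 1"
  shows "sqrt (mu d) ^ scale N \<le> exp (ln (1 / mu d) / 2) * (1 / real N ^ (4 * d))"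
proof -
  let ?l = "ln (1 / mu d)"
  have "sqrt (mu d) = exp (- ?l / 2)"
    using mu_pos by (simp add: ln_div ln_sqrt[symmetric])
  then have "sqrt (mu d) ^ scale N = exp (real (scale N) * (- ?l / 2))"
    by (simp only: exp_of_nat_mult)
  also have "\<dots> \<le> exp ((c0 d * ln (real N) - 1) * (- ?l / 2))"
  proof (subst exp_le_cancel_iff, rule mult_right_mono_neg)
    show "c0 d * ln (real N) - 1 \<le> real (scale N)" unfolding scale_def by linarith
  qed (use log_mu_pos in simp)
  also have "(c0 d * ln (real N) - 1) * (- ?l / 2) = ?l / 2 - real (4 * d) * ln (real N)"
    using log_mu_pos by (simp add: c0_def field_simps)
  also have "exp (?l / 2 - real (4 * d) * ln (real N)) = exp (?l / 2) * (1 / exp (ln (real N)) ^ (4 * d))"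
    by (simp only: exp_diff exp_of_nat_mult) simp
  also have "exp (ln (real N)) = real N" using assms by simp
  finally show ?thesis .
qed

lemma uniqueness_limit:
  "\<exists>u0::real. u0 > 0 \<and> (\<forall>u. 0 < u \<and> u \<le> u0 \<longrightarrow>
     (\<lambda>N. measure (walk_space d N) (uniqueness_event d N (c0 d) (u * real N ^ d))) \<longlonglongrightarrow> 1)"
proof -
  obtain C u0 where C: "C \<ge> 0" "u0 > 0" and ev: "\<forall>\<^sub>F N in sequentially. \<forall>i j y c n u. i < j \<longrightarrow> j < d \<longrightarrow>
     y \<in> lattice d \<longrightarrow> n < N \<longrightarrow> 0 \<le> u \<longrightarrow> u \<le> u0 \<longrightarrow>
     measure (walk_space d N) (star_event N (u * real N ^ d) i j y c n) \<le> C * (sqrt (mu d) / 2) ^ n"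
    using star_event_estimate by blast
  define K where "K = real d * real d * C * exp (ln (1 / mu d) / 2)"
  have K: "K \<ge> 0" unfolding K_def using C by simp
  show ?thesis
  proof (intro exI[of _ u0] conjI allI impI)
    fix u assume u: "0 < u \<and> u \<le> u0"
    show "(\<lambda>N. measure (walk_space d N) (uniqueness_event d N (c0 d) (u * real N ^ d))) \<longlonglongrightarrow> 1"
    proof (rule real_tendsto_sandwich)
      show "\<forall>\<^sub>F N in sequentially. 1 - K / real N \<le>
          measure (walk_space d N) (uniqueness_event d N (c0 d) (u * real N ^ d))"
        using ev eventually_scale
      proof eventually_elim
        case (elim N)
        interpret P: prob_space "walk_space d N" by (rule prob_space_walk_space)
        have N: "N \<ge> 1" and mN: "scale N < N" using elim(2) by auto
        let ?t = "u * real N ^ d"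
        have t: "?t \<ge> 0" using u by simp
        let ?R = "\<lambda>y i j. star_event N ?t i j y (0, 0) (scale N)"
        let ?B = "\<Union>y\<in>torus d N. \<Union>i\<in>{..<d}. \<Union>j\<in>{i<..<d}. ?R y i j"
        have R: "P.prob (?R y i j) \<le> C * sqrt (mu d) ^ scale N" if "y \<in> torus d N" "i < j" "j < d" for y i j
        proof -
          have "y \<in> lattice d" using that(1) unfolding torus_eq[OF N] by (auto simp: lattice_def)
          then have "P.prob (?R y i j) \<le> C * (sqrt (mu d) / 2) ^ scale N"
            using elim(1) that mN u by simp
          also have "\<dots> \<le> C * sqrt (mu d) ^ scale N"
            using C mu_pos by (intro mult_left_mono power_mono) auto
          finally show ?thesis .
        qed
        have sets: "?R y i j \<in> P.events" for y i j by (rule star_event_sets[OF t])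
        have "P.prob ?B \<le> (\<Sum>y\<in>torus d N. P.prob (\<Union>i\<in>{..<d}. \<Union>j\<in>{i<..<d}. ?R y i j))"
          by (rule P.finite_measure_subadditive_finite) (use card_torus[OF N] sets in auto)
        also have "\<dots> \<le> (\<Sum>y\<in>torus d N. \<Sum>i\<in>{..<d}. P.prob (\<Union>j\<in>{i<..<d}. ?R y i j))"
          by (intro sum_mono P.finite_measure_subadditive_finite) (use sets in auto)
        also have "\<dots> \<le> (\<Sum>y\<in>torus d N. \<Sum>i\<in>{..<d}. \<Sum>j\<in>{i<..<d}. P.prob (?R y i j))"
          by (intro sum_mono P.finite_measure_subadditive_finite) (use sets in auto)
        also have "\<dots> \<le> (\<Sum>y\<in>torus d N. \<Sum>i\<in>{..<d}. real d * (C * sqrt (mu d) ^ scale N))"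
        proof (intro sum_mono)
          fix y i assume "y \<in> torus d N"
          then have "(\<Sum>j\<in>{i<..<d}. P.prob (?R y i j)) \<le> (\<Sum>j\<in>{i<..<d}. C * sqrt (mu d) ^ scale N)"
            by (intro sum_mono R) auto
          also have "\<dots> = real (card {i<..<d}) * (C * sqrt (mu d) ^ scale N)" by simp
          also have "\<dots> \<le> real d * (C * sqrt (mu d) ^ scale N)"
            using C mu_pos by (intro mult_right_mono) auto
          finally show "(\<Sum>j\<in>{i<..<d}. P.prob (?R y i j)) \<le> real d * (C * sqrt (mu d) ^ scale N)" .
        qed
        also have "\<dots> = real N ^ d * (real d * real d * C) * sqrt (mu d) ^ scale N"
          by (simp add: card_torus[OF N] mult_ac)
        also have "\<dots> \<le> real N ^ d * (real d * real d * C) * (exp (ln (1 / mu d) / 2) * (1 / real N ^ (4 * d)))"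
          using C N by (intro mult_left_mono power_scale_le) auto
        also have "\<dots> = K * (real N ^ d / real N ^ (4 * d))" by (simp add: K_def)
        also have "\<dots> \<le> K * (1 / real N)"
        proof (rule mult_left_mono[OF _ K])
          have "real N ^ d * real N ^ 1 \<le> real N ^ (4 * d)"
            unfolding power_add[symmetric] by (rule power_increasing) (use N d5 in auto)
          then show "real N ^ d / real N ^ (4 * d) \<le> 1 / real N" using N by (simp add: field_simps)
        qed
        finally have B: "P.prob ?B \<le> K / real N" by simp
        have B_sets: "?B \<in> P.events"
          by (intro sets.finite_UN sets card_torus[OF N]) auto
        have "1 - P.prob ?B = P.prob (- ?B)"
          using P.prob_compl[OF B_sets] by (simp add: Compl_eq_Diff_UNIV)
        also have "\<dots> \<le> P.prob (uniqueness_event d N (c0 d) ?t)"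
          by (rule P.finite_measure_mono[OF uniqueness_event_superset uniqueness_event_sets])
             (use elim(2) t N in \<open>auto simp: scale_def\<close>)
        finally show ?case using B by linarith
      qed
      show "\<forall>\<^sub>F N in sequentially. measure (walk_space d N) (uniqueness_event d N (c0 d) (u * real N ^ d)) \<le> 1"
        by (intro always_eventually allI prob_space.prob_le_1 prob_space_walk_space)
      show "(\<lambda>N. 1 - K / real N) \<longlonglongrightarrow> 1" by real_asymp
    qed simp
  qed (rule C)
qed

text \<open>The exponential bound is uniform in u and does not become small with it. So star paths
  starting within distance K are bounded by the probability 2 u that their first site is visited,
  and the farther ones by a geometric series.\<close>

lemma connection_lower_bound:
  "\<exists>C u0. C \<ge> 0 \<and> u0 > 0 \<and> (\<forall>K u. 0 < u \<longrightarrow> u \<le> u0 \<longrightarrow> (\<forall>\<^sub>F N in sequentially.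
     1 - (2 * (real K + 1) * u + C * (1 / 2) ^ K) \<le>
       measure (walk_space d N) (connection_event d N (c0 d) 0 (u * real N ^ d))))"
proof -
  obtain C u0 where C: "C \<ge> 0" "u0 > 0" and ev: "\<forall>\<^sub>F N in sequentially. \<forall>i j y c n u. i < j \<longrightarrow> j < d \<longrightarrow>
     y \<in> lattice d \<longrightarrow> n < N \<longrightarrow> 0 \<le> u \<longrightarrow> u \<le> u0 \<longrightarrow>
     measure (walk_space d N) (star_event N (u * real N ^ d) i j y c n) \<le> C * (sqrt (mu d) / 2) ^ n"
    using star_event_estimate by blast
  have "\<forall>\<^sub>F N in sequentially. 1 - (2 * (real K + 1) * u + C * (1 / 2) ^ K) \<le>
       measure (walk_space d N) (connection_event d N (c0 d) 0 (u * real N ^ d))"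
    if u: "0 < u" "u \<le> u0" for K u
  proof -
    have "(\<lambda>N. 1 / real N) \<longlonglongrightarrow> 0" by real_asymp
    \<comment> \<open>Absorbs the visit at time 0, so that a site is visited with probability at
      most 2 u.\<close>
    then have ev_u: "\<forall>\<^sub>F N in sequentially. 1 / real N < u" by (rule order_tendstoD) (rule u)
    show ?thesis
      using ev eventually_scale ev_u
    proof eventually_elim
      case (elim N)
      interpret P: prob_space "walk_space d N" by (rule prob_space_walk_space)
      have N: "N \<ge> 1" and mN: "scale N < N" using elim(2) by auto
      let ?t = "u * real N ^ d" and ?m = "scale N"
      have t: "?t \<ge> 0" using u by simp
      have zero: "(0::point) \<in> lattice d" by (simp add: lattice_def)
      let ?R = "\<lambda>k. star_event N ?t 0 1 0 (int k, 0) k"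
      have sets: "?R k \<in> P.events" for k by (rule star_event_sets[OF t])
      have site: "P.prob {\<omega>. b \<in> visited N ?t \<omega>} \<le> 2 * u" for b
      proof -
        have "P.prob {\<omega>. b \<in> visited N ?t \<omega>} \<le> (?t + 1) / real N ^ d"
          by (rule measure_site_visited_le[OF t N])
        also have "\<dots> = u + 1 / real N ^ d" using N by (simp add: field_simps)
        also have "1 / real N ^ d \<le> 1 / real N ^ 1"
          using N d5 by (intro divide_left_mono power_increasing) auto
        finally show ?thesis using elim(3) by simp
      qed
      have short: "P.prob (?R k) \<le> 2 * u" for k
      proof -
        have "?R k \<subseteq> {\<omega>. plane_map N 0 1 0 (int k, 0) \<in> visited N ?t \<omega>}"
          unfolding star_event_def by force
        then have "P.prob (?R k) \<le> P.prob {\<omega>. plane_map N 0 1 0 (int k, 0) \<in> visited N ?t \<omega>}"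
          by (rule P.finite_measure_mono[OF _ visited_sets[OF t]])
        also have "\<dots> \<le> 2 * u" by (rule site)
        finally show ?thesis .
      qed
      have long: "P.prob (?R k) \<le> C * (1 / 2) ^ k" if "k \<le> ?m" for k
      proof -
        have "P.prob (?R k) \<le> C * (sqrt (mu d) / 2) ^ k"
          using elim(1) that mN u d5 zero by simp
        also have "\<dots> \<le> C * (1 / 2) ^ k"
          using C mu_pos mu1 by (intro mult_left_mono power_mono) auto
        finally show ?thesis .
      qed
      let ?B = "{\<omega>. 0 \<in> visited N ?t \<omega>} \<union> (\<Union>k\<in>{1..?m}. ?R k)"
      have B_sets: "(\<Union>k\<in>{1..?m}. ?R k) \<in> P.events" "{\<omega>. 0 \<in> visited N ?t \<omega>} \<in> P.events"
        by (intro sets.finite_UN sets visited_sets t; simp)+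
      have "(\<Sum>k\<in>{1..?m}. P.prob (?R k)) \<le> (\<Sum>k\<in>{1..K} \<union> {K<..?m}. P.prob (?R k))"
        by (rule sum_mono2) auto
      also have "\<dots> = (\<Sum>k\<in>{1..K}. P.prob (?R k)) + (\<Sum>k\<in>{K<..?m}. P.prob (?R k))"
        by (rule sum.union_disjoint) auto
      also have "\<dots> \<le> (\<Sum>k\<in>{1..K}. 2 * u) + (\<Sum>k\<in>{K<..?m}. C * (1 / 2) ^ k)"
        by (intro add_mono sum_mono short long) auto
      also have "\<dots> = real K * (2 * u) + C * (\<Sum>k\<in>{K<..?m}. (1 / 2) ^ k)"
        by (simp add: sum_distrib_left)
      also have "\<dots> \<le> real K * (2 * u) + C * (1 / 2) ^ K"
        by (intro add_left_mono mult_left_mono sum_half_powers_le C)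
      finally have sum: "(\<Sum>k\<in>{1..?m}. P.prob (?R k)) \<le> real K * (2 * u) + C * (1 / 2) ^ K" .
      have "P.prob ?B \<le> P.prob {\<omega>. 0 \<in> visited N ?t \<omega>} + P.prob (\<Union>k\<in>{1..?m}. ?R k)"
        by (rule measure_Un_le[OF B_sets(2,1)])
      also have "\<dots> \<le> 2 * u + (\<Sum>k\<in>{1..?m}. P.prob (?R k))"
        by (intro add_mono site P.finite_measure_subadditive_finite) (use sets in auto)
      also have "\<dots> \<le> 2 * u + (real K * (2 * u) + C * (1 / 2) ^ K)"
        by (rule add_left_mono[OF sum])
      also have "2 * u + (real K * (2 * u) + C * (1 / 2) ^ K) = 2 * (real K + 1) * u + C * (1 / 2) ^ K"
        by (simp add: algebra_simps)
      finally have B: "P.prob ?B \<le> 2 * (real K + 1) * u + C * (1 / 2) ^ K" .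
      have "1 - P.prob ?B = P.prob (- ?B)"
        using P.prob_compl[OF sets.Un[OF B_sets(2,1)]]
        unfolding space_walk_space Compl_eq_Diff_UNIV by (rule sym)
      also have "\<dots> \<le> P.prob (connection_event d N (c0 d) 0 ?t)"
        by (rule P.finite_measure_mono[OF connection_event_superset connection_event_sets])
           (use elim(2) t N d5 in \<open>auto simp: scale_def\<close>)
      finally show ?case using B by linarith
    qed
  qed
  then show ?thesis using C by blast
qed

text \<open>The upper bound is that probabilities are at most 1. For the lower one K is fixed first,
  to make the tail small, and u afterwards, to make the K + 1 site probabilities small.\<close>

lemma connection_limit:
  "((\<lambda>u::real. liminf (\<lambda>N. ereal (measure (walk_space d N)
      (connection_event d N (c0 d) 0 (u * real N ^ d))))) \<longlongrightarrow> 1) (at_right 0)"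
proof (rule order_tendstoI)
  let ?L = "\<lambda>u::real. liminf (\<lambda>N. ereal (measure (walk_space d N)
      (connection_event d N (c0 d) 0 (u * real N ^ d))))"
  {
    fix a :: ereal assume "1 < a"
    have "?L u \<le> liminf (\<lambda>N. 1)" for u
      by (intro Liminf_mono always_eventually allI)
         (simp add: prob_space.prob_le_1[OF prob_space_walk_space])
    then have "?L u < a" for u using \<open>1 < a\<close> by (simp add: Liminf_const) (meson le_less_trans)
    then show "\<forall>\<^sub>F u in at_right 0. ?L u < a" by simp
  next
    fix a :: ereal assume "a < 1"
    then obtain r where r: "a < ereal r" "ereal r < 1" using ereal_dense2 by blast
    then have r1: "r < 1" by simp
    obtain C u0 where C: "C \<ge> 0" "u0 > 0" and low: "\<And>K u. 0 < u \<Longrightarrow> u \<le> u0 \<Longrightarrow> \<forall>\<^sub>F N in sequentially.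
     1 - (2 * (real K + 1) * u + C * (1 / 2) ^ K) \<le>
       measure (walk_space d N) (connection_event d N (c0 d) 0 (u * real N ^ d))"
      using connection_lower_bound by blast
    have "(\<lambda>K. C * (1 / 2) ^ K) \<longlonglongrightarrow> 0" by real_asymp
    then have "\<forall>\<^sub>F K in sequentially. C * (1 / 2) ^ K < (1 - r) / 2"
      by (rule order_tendstoD) (use r1 in simp)
    then obtain K where K: "C * (1 / 2) ^ K < (1 - r) / 2" by (auto simp: eventually_sequentially)
    define b where "b = min u0 ((1 - r) / (4 * (real K + 1)))"
    have b: "b > 0" using C r1 by (simp add: b_def)
    have "a < ?L u" if u: "0 < u" "u < b" for u
    proof -
      have "u \<le> (1 - r) / (4 * (real K + 1))" using u by (simp add: b_def)
      then have "2 * (real K + 1) * u \<le> (1 - r) / 2" by (simp add: field_simps)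
      moreover have "r \<le> 1 - (X + Y)" if "X \<le> (1 - r) / 2" "Y < (1 - r) / 2" for X Y :: real
        using add_mono[OF that(1) less_imp_le[OF that(2)]] by (simp add: field_simps)
      ultimately have "r \<le> 1 - (2 * (real K + 1) * u + C * (1 / 2) ^ K)" using K by blast
      moreover have "\<forall>\<^sub>F N in sequentially. 1 - (2 * (real K + 1) * u + C * (1 / 2) ^ K) \<le>
         measure (walk_space d N) (connection_event d N (c0 d) 0 (u * real N ^ d))"
        by (rule low) (use u in \<open>auto simp: b_def\<close>)
      ultimately have "\<forall>\<^sub>F N in sequentially. ereal r \<le>
         ereal (measure (walk_space d N) (connection_event d N (c0 d) 0 (u * real N ^ d)))"
        by (auto elim!: eventually_mono)
      then have "ereal r \<le> ?L u" by (rule Liminf_bounded)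
      then show ?thesis using r(1) by (rule less_le_trans[rotated])
    qed
    then show "\<forall>\<^sub>F u in at_right 0. a < ?L u"
      unfolding eventually_at_right_field using b by blast
  }
qed

end

theorem corollary2p5:
  "\<exists>d0::nat. d0 \<ge> 5 \<and> (\<forall>d\<ge>d0. mu d < 1) \<and>
     (\<forall>m\<ge>5. (\<forall>d\<ge>m. mu d < 1) \<longrightarrow> d0 \<le> m) \<and>
     (\<forall>d\<ge>d0.
        c0 d > 0 \<and>
        (\<exists>u0::real. u0 > 0 \<and> (\<forall>u. 0 < u \<and> u \<le> u0 \<longrightarrow>
           (\<lambda>N. measure (walk_space d N) (uniqueness_event d N (c0 d) (u * real N ^ d)))
             \<longlonglongrightarrow> 1)) \<and>
        ((\<lambda>u::real. liminf (\<lambda>N. ereal (measure (walk_space d N)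
             (connection_event d N (c0 d) 0 (u * real N ^ d))))) \<longlongrightarrow> 1) (at_right 0))"
proof -
  let ?P = "\<lambda>m. m \<ge> 5 \<and> (\<forall>d\<ge>m. mu d < 1)"
  have "\<forall>\<^sub>F d in sequentially. mu d < 1" by (rule order_tendstoD(2)[OF mu_tendsto_0]) simp
  then obtain m0 where "\<forall>d\<ge>m0. mu d < 1" by (auto simp: eventually_sequentially)
  then have ex: "?P (max 5 m0)" by simp
  define d0 where "d0 = (LEAST m. ?P m)"
  have d0: "?P d0" unfolding d0_def by (rule LeastI[of ?P, OF ex])
  have least: "d0 \<le> m" if "?P m" for m unfolding d0_def by (rule Least_le[of ?P, OF that])
  show ?thesis
  proof (intro exI[of _ d0] conjI allI impI)
    fix d assume "d0 \<le> d"
    then have d: "5 \<le> d" "mu d < 1" using d0 by auto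
    show "c0 d > 0" by (rule c0_pos[OF d])
    show "\<exists>u0::real. u0 > 0 \<and> (\<forall>u. 0 < u \<and> u \<le> u0 \<longrightarrow>
           (\<lambda>N. measure (walk_space d N) (uniqueness_event d N (c0 d) (u * real N ^ d))) \<longlonglongrightarrow> 1)"
      by (rule uniqueness_limit[OF d])
    show "((\<lambda>u::real. liminf (\<lambda>N. ereal (measure (walk_space d N)
             (connection_event d N (c0 d) 0 (u * real N ^ d))))) \<longlongrightarrow> 1) (at_right 0)"
      by (rule connection_limit[OF d])
  qed (use d0 least in auto)
qed

end
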